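(* Let $M$ be a loopless matroid on $[n]$ ($n\ge1$) of rank $r$ with lattice of flats $\mathcal L(M)$, and let $G$ be a subgroup of the automorphism group $\mathrm{Aut}(M)$. Then, as virtual representations of $G$, $$\sum_{i=0}^{r}(-1)^i\widetilde A^i(M)_{\mathbb C}\cong_G\begin{cases}(-1)^{\frac{r}{2}}\,\tilde H_{\frac{r-2}{2}}\big(\mathcal L(M)_{\mathrm{Odd}(r-1)}\big)&\text{if $r$ is even},\\0&\text{if $r$ is odd}.\end{cases}$$ In particular, the $G$-equivariant Charney--Davis quantity $CD^G(\widetilde A(M))$ is nonnegative in $R_{\mathbb C}(G)$, i.e. it is (the class of) a genuine representation of $G$.
   Context: An automorphism of $M$ is a permutation of the ground set $E=[n]$ preserving the rank of every subset; it permutes the flats preserving rank. The augmented Chow ring is the graded $\mathbb{Q}$-algebra (all variables in degree 1) $$\widetilde A(M)=\mathbb{Q}\big[\{x_F\}_{F\in\mathcal L(M)\setminus\{E\}}\cup\{y_i\}_{i\in E}\big]/(\widetilde I_1+\widetilde I_2+\widetilde J),$$ where $\widetilde I_1$ is generated by $x_Fx_{F'}$ for incomparable proper flats $F,F'$; $\widetilde I_2$ by $y_ix_F$ for $i\in E$ and proper flats $F$ with $i\notin F$; $\widetilde J$ by $y_i-\sum_{F\in\mathcal L(M)\setminus\{E\}:\, i\notin F}x_F$ for $i\in E$. $\widetilde A^i(M)$ is its degree $i$ part and $\widetilde A^i(M)_{\mathbb C}=\mathbb C\otimes_{\mathbb Q}\widetilde A^i(M)$. $G$ acts by $\sigma x_F=x_{\sigma(F)}$,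 $\sigma y_i=y_{\sigma(i)}$. The ring $\widetilde A(M)$ has top degree $r$. $R_{\mathbb C}(G)$ is the representation ring (virtual character ring) of $G$. For a graded $\mathbb C$-algebra $A=\bigoplus_{i=0}^mA^i$ of top degree $m$ with graded $\mathbb CG$-module structure, $\mathrm{Hilb}^G(A,t)=\sum_iA^it^i\in R_{\mathbb C}(G)[t]$, and $CD^G(A)=(-1)^{m/2}\mathrm{Hilb}^G(A,-1)$ if $m$ is even, $CD^G(A)=\mathrm{Hilb}^G(A,-1)$ if $m$ is odd; $CD^G(\widetilde A(M))$ means $CD^G(\widetilde A(M)_{\mathbb C})$. $\mathrm{Odd}(\ell)=\{1,3,\dots,\ell\}$ for odd $\ell$. For a graded poset $P$ of rank $m$ with minimum $\hat0$, maximum $\hat1$ and rank function $\mathrm{rk}_P$, and $S\subseteq[m-1]$, the rank-selected subposet is $P_S=\{x\in P:\mathrm{rk}_P(x)\in S\}\cup\{\hat0,\hat1\}$. $\tilde H_i(P_S)$ is the reduced simplicial homology, with complex coefficients, of the order complex of $P_S\setminus\{\hat0,\hat1\}$, with the induced $G$-action. *)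

theory Defs
  imports
    Complex_Main
    "HOL-Library.Poly_Mapping"
    "HOL-Library.Function_Algebras"
    "HOL-Computational_Algebra.Polynomial"
    "HOL-Algebra.QuotRing"
    "HOL-Algebra.Sym_Groups"
    "Jordan_Normal_Form.VS_Connect"
begin

hide_const (open) Multiset.mult Polynomial.smult

section \<open>Matroids\<close>

definition matroid :: "'a set \<Rightarrow> ('a set \<Rightarrow> nat) \<Rightarrow> bool" where
  "matroid E rk \<longleftrightarrow> finite E \<and>
     (\<forall>A\<subseteq>E. rk A \<le> card A) \<and>
     (\<forall>A B. A \<subseteq> B \<and> B \<subseteq> E \<longrightarrow> rk A \<le> rk B) \<and>
     (\<forall>A\<subseteq>E. \<forall>B\<subseteq>E. rk (A \<union> B) + rk (A \<inter> B) \<le> rk A + rk B)"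

definition loopless :: "'a set \<Rightarrow> ('a set \<Rightarrow> nat) \<Rightarrow> bool" where
  "loopless E rk \<longleftrightarrow> (\<forall>i\<in>E. rk {i} \<noteq> 0)"

definition flats :: "'a set \<Rightarrow> ('a set \<Rightarrow> nat) \<Rightarrow> 'a set set" where
  "flats E rk = {F. F \<subseteq> E \<and> (\<forall>i\<in>E - F. rk F < rk (insert i F))}"

definition proper_flats :: "'a set \<Rightarrow> ('a set \<Rightarrow> nat) \<Rightarrow> 'a set set" where
  "proper_flats E rk = flats E rk - {E}"

definition matroid_aut :: "nat \<Rightarrow> (nat set \<Rightarrow> nat) \<Rightarrow> (nat \<Rightarrow> nat) monoid" where
  "matroid_aut n rk = (sym_group n)
     \<lparr>carrier := {\<sigma> \<in> carrier (sym_group n). \<forall>S\<subseteq>{1..n}. rk (\<sigma> ` S) = rk S}\<rparr>"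


section \<open>Vector spaces\<close>

text \<open>
  A vector space over the field \<open>'k\<close> is a \<^typ>\<open>('k, 'v) module\<close> record over \<^const>\<open>class_ring\<close>.
  The ring fields \<open>mult\<close> and \<open>one\<close> of such a record play no role.
\<close>

definition pm_push :: "('b \<Rightarrow> 'c) \<Rightarrow> ('b \<Rightarrow>\<^sub>0 'k::comm_monoid_add) \<Rightarrow> ('c \<Rightarrow>\<^sub>0 'k)" where
  "pm_push f p = (\<Sum>k\<in>Poly_Mapping.keys p.
     Poly_Mapping.single (f k) (Poly_Mapping.lookup p k))"

definition free_vs :: "'b set \<Rightarrow> ('k::field, 'b \<Rightarrow>\<^sub>0 'k) module" where
  "free_vs S = \<lparr>carrier = {p. Poly_Mapping.keys p \<subseteq> S}, mult = undefined, one = undefined,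
     zero = 0, add = (+), smult = (\<lambda>c. Poly_Mapping.map ((*) c))\<rparr>"

text \<open>The scalar multiple is a union over representatives, as in \<^const>\<open>rcoset_mult\<close>; the
  image of a coset under \<open>x \<mapsto> c \<odot> x\<close> would not be a coset when \<open>c = 0\<close>.\<close>

definition quot_vs :: "('k, 'v) module \<Rightarrow> 'v set \<Rightarrow> ('k, 'v set) module" where
  "quot_vs V W = \<lparr>carrier = a_rcosets\<^bsub>V\<^esub> W, mult = undefined, one = undefined,
     zero = W, add = (<+>\<^bsub>V\<^esub>), smult = (\<lambda>c X. \<Union>x\<in>X. W +>\<^bsub>V\<^esub> (c \<odot>\<^bsub>V\<^esub> x))\<rparr>"

text \<open>
  \<open>\<complex> \<otimes>\<^sub>\<rat> V\<close>, presented as a complex vector space: the basis vector at \<open>v\<close> of the free space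
  stands for \<open>1 \<otimes> v\<close>, and the relations make \<open>v \<mapsto> 1 \<otimes> v\<close> additive and \<open>\<rat>\<close>-linear.
\<close>

definition complexify_rel :: "(rat, 'v) module \<Rightarrow> ('v \<Rightarrow>\<^sub>0 complex) set" where
  "complexify_rel V =
     {Poly_Mapping.single (v \<oplus>\<^bsub>V\<^esub> w) 1 - Poly_Mapping.single v 1 - Poly_Mapping.single w 1 | v w.
        v \<in> carrier V \<and> w \<in> carrier V} \<union>
     {Poly_Mapping.single (q \<odot>\<^bsub>V\<^esub> v) 1 - Poly_Mapping.single v (of_rat q) | q v.
        v \<in> carrier V}"

definition complexify :: "(rat, 'v) module \<Rightarrow> (complex, ('v \<Rightarrow>\<^sub>0 complex) set) module" where
  "complexify V = quot_vs (free_vs (carrier V))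
     (LinearCombinations.module.span class_ring (free_vs (carrier V)) (complexify_rel V))"

definition complexify_map ::
    "('v \<Rightarrow> 'v) \<Rightarrow> ('v \<Rightarrow>\<^sub>0 complex) set \<Rightarrow> ('v \<Rightarrow>\<^sub>0 complex) set" where
  "complexify_map f = (`) (pm_push f)"

definition coord :: "('k::field, 'v) module \<Rightarrow> 'v set \<Rightarrow> 'v \<Rightarrow> 'v \<Rightarrow> 'k" where
  "coord V B v = (THE a. a \<in> extensional B \<and> v = LinearCombinations.module.lincomb V a B)"

text \<open>The trace of an endomorphism of a finite-dimensional vector space; it does not depend
  on the basis chosen.\<close>

definition lin_trace :: "('k::field, 'v) module \<Rightarrow> ('v \<Rightarrow> 'v) \<Rightarrow> 'k" where
  "lin_trace V f =
     (let B = (SOME B. finite B \<and> vectorspace.basis class_ring V B)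
      in \<Sum>b\<in>B. coord V B (f b) b)"


section \<open>The representation ring\<close>

text \<open>
  The class of a representation \<open>\<rho>\<close> of \<open>\<Gamma>\<close> on \<open>V\<close> in the ring of virtual characters. Elements of
  this ring are functions on the group, extended by zero to the ambient type so that equality of
  class functions is equality in HOL; sums and products are pointwise (theory
  \<open>Function_Algebras\<close>), and an integer is the corresponding constant function.
\<close>

definition rep_class ::
    "'g monoid \<Rightarrow> (complex, 'v) module \<Rightarrow> ('g \<Rightarrow> 'v \<Rightarrow> 'v) \<Rightarrow> 'g \<Rightarrow> complex" where
  "rep_class \<Gamma> V \<rho> = (\<lambda>g. if g \<in> carrier \<Gamma> then lin_trace V (\<rho> g) else 0)"

text \<open>The classes of genuine finite-dimensional representations: characters of homomorphisms
  \<open>\<Gamma> \<rightarrow> GL\<^sub>d(\<complex>)\<close>, with \<open>d = 0\<close> allowed. Invertibility of \<open>\<rho> g\<close> follows from the other conditions.\<close>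

definition genuine_classes :: "'g monoid \<Rightarrow> ('g \<Rightarrow> complex) set" where
  "genuine_classes \<Gamma> = {\<chi>. \<exists>(d::nat) (\<rho> :: 'g \<Rightarrow> complex mat).
     (\<forall>g\<in>carrier \<Gamma>. \<rho> g \<in> carrier_mat d d) \<and>
     \<rho> \<one>\<^bsub>\<Gamma>\<^esub> = 1\<^sub>m d \<and>
     (\<forall>g\<in>carrier \<Gamma>. \<forall>h\<in>carrier \<Gamma>. \<rho> (g \<otimes>\<^bsub>\<Gamma>\<^esub> h) = \<rho> g * \<rho> h) \<and>
     \<chi> = (\<lambda>g. if g \<in> carrier \<Gamma> then \<Sum>i<d. \<rho> g $$ (i, i) else 0)}"

definition equivariant_hilb ::
    "'g monoid \<Rightarrow> nat \<Rightarrow> (nat \<Rightarrow> (complex, 'v) module) \<Rightarrow> ('g \<Rightarrow> 'v \<Rightarrow> 'v) \<Rightarrow>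
     ('g \<Rightarrow> complex) poly" where
  "equivariant_hilb \<Gamma> m A \<rho> = (\<Sum>i=0..m. Polynomial.monom (rep_class \<Gamma> (A i) \<rho>) i)"

text \<open>\<open>m\<close> is the top degree of the graded algebra \<open>A\<close>.\<close>

definition charney_davis ::
    "'g monoid \<Rightarrow> nat \<Rightarrow> (nat \<Rightarrow> (complex, 'v) module) \<Rightarrow> ('g \<Rightarrow> 'v \<Rightarrow> 'v) \<Rightarrow>
     'g \<Rightarrow> complex" where
  "charney_davis \<Gamma> m A \<rho> =
     (if even m then (-1) ^ (m div 2) * poly (equivariant_hilb \<Gamma> m A \<rho>) (-1)
      else poly (equivariant_hilb \<Gamma> m A \<rho>) (-1))"


section \<open>The augmented Chow ring\<close>

text \<open>A monomial in variables from \<open>'v\<close> is a finitely supported exponent vector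
  \<open>'v \<Rightarrow>\<^sub>0 nat\<close>, and a polynomial over \<open>'k\<close> a finitely supported map from monomials to \<open>'k\<close>.\<close>

definition poly_ring :: "'v set \<Rightarrow> (('v \<Rightarrow>\<^sub>0 nat) \<Rightarrow>\<^sub>0 'k::comm_ring_1) ring" where
  "poly_ring Vs = \<lparr>carrier = {p. \<forall>m\<in>Poly_Mapping.keys p. Poly_Mapping.keys m \<subseteq> Vs},
     mult = (*), one = 1, zero = 0, add = (+)\<rparr>"

definition pvar :: "'v \<Rightarrow> (('v \<Rightarrow>\<^sub>0 nat) \<Rightarrow>\<^sub>0 'k::comm_ring_1)" where
  "pvar v = Poly_Mapping.single (Poly_Mapping.single v 1) 1"

definition pconst :: "'k \<Rightarrow> (('v \<Rightarrow>\<^sub>0 nat) \<Rightarrow>\<^sub>0 'k::comm_ring_1)" where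
  "pconst c = Poly_Mapping.single 0 c"

definition homogeneous :: "nat \<Rightarrow> (('v \<Rightarrow>\<^sub>0 nat) \<Rightarrow>\<^sub>0 'k::comm_ring_1) \<Rightarrow> bool" where
  "homogeneous d p \<longleftrightarrow> (\<forall>m\<in>Poly_Mapping.keys p.
     (\<Sum>v\<in>Poly_Mapping.keys m. Poly_Mapping.lookup m v) = d)"

datatype 'a chow_var = Xvar "'a set" | Yvar 'a

type_synonym 'a chow_poly = "('a chow_var \<Rightarrow>\<^sub>0 nat) \<Rightarrow>\<^sub>0 rat"

definition aug_poly_ring :: "'a set \<Rightarrow> ('a set \<Rightarrow> nat) \<Rightarrow> 'a chow_poly ring" where
  "aug_poly_ring E rk = poly_ring (Xvar ` proper_flats E rk \<union> Yvar ` E)"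

definition aug_I1 :: "'a set \<Rightarrow> ('a set \<Rightarrow> nat) \<Rightarrow> 'a chow_poly set" where
  "aug_I1 E rk = Idl\<^bsub>aug_poly_ring E rk\<^esub> {pvar (Xvar F) * pvar (Xvar F') | F F'.
     F \<in> proper_flats E rk \<and> F' \<in> proper_flats E rk \<and> \<not> F \<subseteq> F' \<and> \<not> F' \<subseteq> F}"

definition aug_I2 :: "'a set \<Rightarrow> ('a set \<Rightarrow> nat) \<Rightarrow> 'a chow_poly set" where
  "aug_I2 E rk = Idl\<^bsub>aug_poly_ring E rk\<^esub> {pvar (Yvar i) * pvar (Xvar F) | i F.
     i \<in> E \<and> F \<in> proper_flats E rk \<and> i \<notin> F}"

definition aug_J :: "'a set \<Rightarrow> ('a set \<Rightarrow> nat) \<Rightarrow> 'a chow_poly set" where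
  "aug_J E rk = Idl\<^bsub>aug_poly_ring E rk\<^esub>
     {pvar (Yvar i) - (\<Sum>F\<in>{F \<in> proper_flats E rk. i \<notin> F}. pvar (Xvar F)) | i. i \<in> E}"

definition aug_ideal :: "'a set \<Rightarrow> ('a set \<Rightarrow> nat) \<Rightarrow> 'a chow_poly set" where
  "aug_ideal E rk =
     aug_I1 E rk <+>\<^bsub>aug_poly_ring E rk\<^esub> aug_I2 E rk <+>\<^bsub>aug_poly_ring E rk\<^esub> aug_J E rk"

definition aug_chow_ring :: "'a set \<Rightarrow> ('a set \<Rightarrow> nat) \<Rightarrow> 'a chow_poly set ring" where
  "aug_chow_ring E rk = aug_poly_ring E rk Quot aug_ideal E rk"

text \<open>The graded piece of degree \<open>i\<close> of the augmented Chow ring, as a rational vector space.\<close>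

definition aug_chow_part ::
    "'a set \<Rightarrow> ('a set \<Rightarrow> nat) \<Rightarrow> nat \<Rightarrow> (rat, 'a chow_poly set) module" where
  "aug_chow_part E rk i =
     \<lparr>carrier = {aug_ideal E rk +>\<^bsub>aug_poly_ring E rk\<^esub> p | p.
        p \<in> carrier (aug_poly_ring E rk) \<and> homogeneous i p},
      mult = undefined, one = undefined,
      zero = \<zero>\<^bsub>aug_chow_ring E rk\<^esub>, add = add (aug_chow_ring E rk),
      smult = (\<lambda>q a. (aug_ideal E rk +>\<^bsub>aug_poly_ring E rk\<^esub> pconst q) \<otimes>\<^bsub>aug_chow_ring E rk\<^esub> a)\<rparr>"

fun relabel :: "('a \<Rightarrow> 'a) \<Rightarrow> 'a chow_var \<Rightarrow> 'a chow_var" where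
  "relabel \<sigma> (Xvar F) = Xvar (\<sigma> ` F)"
| "relabel \<sigma> (Yvar i) = Yvar (\<sigma> i)"

text \<open>The inner \<^const>\<open>pm_push\<close> relabels the variables of a monomial, the outer one the monomials
  of a polynomial, and a coset is sent to its elementwise image.\<close>

definition aug_chow_act :: "('a \<Rightarrow> 'a) \<Rightarrow> 'a chow_poly set \<Rightarrow> 'a chow_poly set" where
  "aug_chow_act \<sigma> = (`) (pm_push (pm_push (relabel \<sigma>)))"

definition aug_chow_part_C :: "'a set \<Rightarrow> ('a set \<Rightarrow> nat) \<Rightarrow> nat \<Rightarrow>
    (complex, ('a chow_poly set \<Rightarrow>\<^sub>0 complex) set) module" where
  "aug_chow_part_C E rk i = complexify (aug_chow_part E rk i)"

definition aug_chow_act_C :: "('a \<Rightarrow> 'a) \<Rightarrow>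
    ('a chow_poly set \<Rightarrow>\<^sub>0 complex) set \<Rightarrow> ('a chow_poly set \<Rightarrow>\<^sub>0 complex) set" where
  "aug_chow_act_C \<sigma> = complexify_map (aug_chow_act \<sigma>)"


section \<open>Rank selection and reduced homology of order complexes\<close>

definition Odd :: "nat \<Rightarrow> nat set" where
  "Odd l = {k. odd k \<and> k \<le> l}"

definition rank_selected :: "'a set \<Rightarrow> ('a \<Rightarrow> nat) \<Rightarrow> 'a \<Rightarrow> 'a \<Rightarrow> nat set \<Rightarrow> 'a set" where
  "rank_selected P rkP zer uni S = {x \<in> P. rkP x \<in> S} \<union> {zer, uni}"

text \<open>The empty face, of dimension \<open>-1\<close>, is included, so that the chain complex below is the
  augmented one.\<close>

definition order_complex :: "'a::order set \<Rightarrow> 'a set set" where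
  "order_complex P = {c. finite c \<and> c \<subseteq> P \<and> (\<forall>x\<in>c. \<forall>y\<in>c. x \<le> y \<or> y \<le> x)}"

definition simplicial_chains :: "'a set set \<Rightarrow> int \<Rightarrow> (complex, 'a set \<Rightarrow>\<^sub>0 complex) module" where
  "simplicial_chains \<Delta> i = free_vs {c \<in> \<Delta>. int (card c) = i + 1}"

text \<open>Each face of an order complex is oriented by the order of the poset: the coefficient of the
  face omitting \<open>x\<close> is \<open>(-1)\<^sup>j\<close>, with \<open>j\<close> the position of \<open>x\<close> in the chain, counted from zero.\<close>

definition simplicial_boundary :: "('a::order set \<Rightarrow>\<^sub>0 complex) \<Rightarrow> ('a set \<Rightarrow>\<^sub>0 complex)" where
  "simplicial_boundary z = (\<Sum>c\<in>Poly_Mapping.keys z. \<Sum>x\<in>c.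
     Poly_Mapping.single (c - {x}) ((-1) ^ card {y \<in> c. y < x} * Poly_Mapping.lookup z c))"

definition reduced_homology ::
    "'a::order set set \<Rightarrow> int \<Rightarrow> (complex, ('a set \<Rightarrow>\<^sub>0 complex) set) module" where
  "reduced_homology \<Delta> i = quot_vs
     ((simplicial_chains \<Delta> i)\<lparr>carrier :=
        {z \<in> carrier (simplicial_chains \<Delta> i). simplicial_boundary z = 0}\<rparr>)
     (simplicial_boundary ` carrier (simplicial_chains \<Delta> (i + 1)))"

text \<open>The map induced on homology classes by an order preserving map \<open>f\<close> that is injective on
  the poset; it respects the orientations of the faces, so no signs occur.\<close>

definition homology_map ::
    "('a \<Rightarrow> 'a) \<Rightarrow> ('a set \<Rightarrow>\<^sub>0 complex) set \<Rightarrow> ('a set \<Rightarrow>\<^sub>0 complex) set" where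
  "homology_map f = (`) (pm_push ((`) f))"

text \<open>The rank function of the lattice of flats of a matroid is the restriction of the rank function
  of the matroid; its maximum is the ground set and, for a loopless matroid, its minimum is the
  empty flat.\<close>

definition flats_rank_selected_homology :: "'a set \<Rightarrow> ('a set \<Rightarrow> nat) \<Rightarrow> nat set \<Rightarrow> int \<Rightarrow>
    (complex, ('a set set \<Rightarrow>\<^sub>0 complex) set) module" where
  "flats_rank_selected_homology E rk S i =
     reduced_homology (order_complex (rank_selected (flats E rk) rk {} E S - {{}, E})) i"

definition flats_homology_act ::
    "('a \<Rightarrow> 'a) \<Rightarrow> ('a set set \<Rightarrow>\<^sub>0 complex) set \<Rightarrow> ('a set set \<Rightarrow>\<^sub>0 complex) set" where
  "flats_homology_act \<sigma> = homology_map ((`) \<sigma>)"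

end

theory Submission
  imports Defs
begin

text \<open>
  The character of each graded piece of the augmented Chow ring is a permutation character. For a flat
  \<open>F\<close> let \<open>h F\<close> be the sum of the variables of the proper flats that do not contain \<open>F\<close>. Certain monomials in
  the \<open>h F\<close>, indexed by multisets of nonempty flats (\<open>fy\<close>), form a basis of the ring that is permuted by
  automorphisms, so an automorphism acts on the piece of degree \<open>i\<close> with trace equal to the number of fixed
  multisets of size \<open>i\<close> (\<open>trace_aug_chow_part\<close>).

  That the monomials span is a straightening argument: the relations \<open>h_mult_h\<close>, \<open>h_power_relation\<close> and
  \<open>h_power_rk\<close> replace a monomial that violates the conditions by monomials in larger flats (\<open>H_spanned\<close>).
  That they are independent needs a degree functional. It is given explicitly: a product of \<open>r\<close>
  classes \<open>h F\<close> has degree one if the flats satisfy Rado's condition for an independent transversal,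
  and degree zero otherwise. Matroid arguments about tight sets show that this functional respects the
  relations (\<open>Deg_ideal\<close>) and that the resulting pairing is triangular on the monomials
  (\<open>test_functional_exists\<close>, \<open>comb_independent\<close>).

  In the alternating sum over degrees the multiplicities of a fixed support cancel unless all flats of
  the support have odd rank. What remains is the sum of \<open>(-1) ^ card c\<close> over the chains \<open>c\<close> of fixed
  nonempty flats of odd rank (\<open>signed_fixed_fy\<close>). In odd rank the ground set is such a flat and
  toggling it cancels everything. In even rank these chains are the fixed faces of the order
  complex of the rank selection at the odd ranks.

  That complex is shellable for a lexicographic order on maximal chains (\<open>shelling\<close>), so its homology is
  concentrated in top degree (\<open>rank_selection_acyclic\<close>), and the Hopf trace formula identifies the signed
  number of fixed faces with the character of the top homology (\<open>homology_character\<close>). Its dimension and the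
  signs match those of the statement, and the homology, with the action of the group by matrices in a
  basis of cycles, is a genuine representation.
\<close>

section \<open>Traces and coordinate functions\<close>

lemma functional_lincomb:
  fixes V :: "('k::field, 'v) module" and L :: "'v \<Rightarrow> 'k"
  assumes vs: "vectorspace class_ring V"
    and L_add: "\<And>v w. v \<in> carrier V \<Longrightarrow> w \<in> carrier V \<Longrightarrow> L (v \<oplus>\<^bsub>V\<^esub> w) = L v + L w"
    and L_smult: "\<And>c v. v \<in> carrier V \<Longrightarrow> L (c \<odot>\<^bsub>V\<^esub> v) = c * L v"
    and finA: "finite A" and A: "A \<subseteq> carrier V"
  shows "L (LinearCombinations.module.lincomb V a A) = (\<Sum>x\<in>A. a x * L x)"
proof -
  interpret vectorspace class_ring V by (rule vs)
  have L0: "L \<zero>\<^bsub>V\<^esub> = 0"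
    using L_add[of "\<zero>\<^bsub>V\<^esub>" "\<zero>\<^bsub>V\<^esub>"] by (metis M.zero_closed M.l_zero add_cancel_right_right)
  from finA A show ?thesis
  proof (induction A)
    case empty
    then show ?case by (simp add: lincomb_def L0)
  next
    case (insert x A)
    have "lincomb a (insert x A) = a x \<odot>\<^bsub>V\<^esub> x \<oplus>\<^bsub>V\<^esub> lincomb a A"
      using insert by (intro lincomb_insert2) auto
    moreover have "a x \<odot>\<^bsub>V\<^esub> x \<in> carrier V" "lincomb a A \<in> carrier V"
      using insert by (auto intro!: lincomb_closed smult_closed)
    ultimately have "L (lincomb a (insert x A)) = L (a x \<odot>\<^bsub>V\<^esub> x) + L (lincomb a A)"
      using L_add by simp
    moreover have "L (a x \<odot>\<^bsub>V\<^esub> x) = a x * L x" using insert L_smult by auto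
    ultimately show ?case using insert by auto
  qed
qed

text \<open>The trace is defined through an arbitrarily chosen basis. Coordinate functions \<open>\<kappa>\<close> dual to vectors
\<open>u\<close> give \<open>L v = (\<Sum>i\<in>I. \<kappa> v i * L (u i))\<close> for every linear functional \<open>L\<close>; applied to the coordinates of
the chosen basis, and to the \<open>\<kappa>\<close> of the images of that basis, this is the invariance of the trace
under a change of basis.\<close>

lemma lin_trace_eq_sum_coordinates:
  fixes V :: "('k::field, 'v) module" and u :: "'i \<Rightarrow> 'v" and \<kappa> :: "'v \<Rightarrow> 'i \<Rightarrow> 'k"
  assumes vs: "vectorspace class_ring V"
    and finI: "finite I" and u: "\<And>i. i \<in> I \<Longrightarrow> u i \<in> carrier V"
    and \<kappa>_add: "\<And>v w i. v \<in> carrier V \<Longrightarrow> w \<in> carrier V \<Longrightarrow> i \<in> I \<Longrightarrow> \<kappa> (v \<oplus>\<^bsub>V\<^esub> w) i = \<kappa> v i + \<kappa> w i"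
    and \<kappa>_smult: "\<And>c v i. v \<in> carrier V \<Longrightarrow> i \<in> I \<Longrightarrow> \<kappa> (c \<odot>\<^bsub>V\<^esub> v) i = c * \<kappa> v i"
    and \<kappa>_u: "\<And>i j. i \<in> I \<Longrightarrow> j \<in> I \<Longrightarrow> \<kappa> (u j) i = (if i = j then 1 else 0)"
    and \<kappa>_inj: "\<And>v w. v \<in> carrier V \<Longrightarrow> w \<in> carrier V \<Longrightarrow> (\<And>i. i \<in> I \<Longrightarrow> \<kappa> v i = \<kappa> w i) \<Longrightarrow> v = w"
    and f: "\<And>v. v \<in> carrier V \<Longrightarrow> f v \<in> carrier V"
    and f_add: "\<And>v w. v \<in> carrier V \<Longrightarrow> w \<in> carrier V \<Longrightarrow> f (v \<oplus>\<^bsub>V\<^esub> w) = f v \<oplus>\<^bsub>V\<^esub> f w"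
    and f_smult: "\<And>c v. v \<in> carrier V \<Longrightarrow> f (c \<odot>\<^bsub>V\<^esub> v) = c \<odot>\<^bsub>V\<^esub> f v"
  shows "lin_trace V f = (\<Sum>i\<in>I. \<kappa> (f (u i)) i)"
proof -
  interpret vectorspace class_ring V by (rule vs)
  have inj: "inj_on u I"
  proof (rule inj_onI)
    fix i j assume ij: "i \<in> I" "j \<in> I" "u i = u j"
    then have "\<kappa> (u i) i = \<kappa> (u j) i" by simp
    then show "i = j" using ij \<kappa>_u[of i i] \<kappa>_u[of i j] by (auto split: if_splits)
  qed
  have functional: "L (lincomb a A) = (\<Sum>x\<in>A. a x * L x)"
    if "\<And>v w. v \<in> carrier V \<Longrightarrow> w \<in> carrier V \<Longrightarrow> L (v \<oplus>\<^bsub>V\<^esub> w) = L v + L w"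
      "\<And>c v. v \<in> carrier V \<Longrightarrow> L (c \<odot>\<^bsub>V\<^esub> v) = c * L v" "finite A" "A \<subseteq> carrier V" for L :: "'v \<Rightarrow> 'k" and a A
    by (rule functional_lincomb[OF vs]) (use that in auto)
  have expand: "v = lincomb (\<lambda>x. \<kappa> v (the_inv_into I u x)) (u ` I)" if v: "v \<in> carrier V" for v
  proof (rule \<kappa>_inj[OF v])
    show "lincomb (\<lambda>x. \<kappa> v (the_inv_into I u x)) (u ` I) \<in> carrier V"
      using u by (intro lincomb_closed) auto
    fix i assume i: "i \<in> I"
    have "\<kappa> (lincomb (\<lambda>x. \<kappa> v (the_inv_into I u x)) (u ` I)) i
        = (\<Sum>x\<in>u ` I. \<kappa> v (the_inv_into I u x) * \<kappa> x i)"
      by (rule functional[of "\<lambda>v. \<kappa> v i"]) (use i u finI \<kappa>_add \<kappa>_smult in auto)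
    also have "\<dots> = (\<Sum>j\<in>I. \<kappa> v j * (if i = j then 1 else 0))"
      using \<kappa>_u i by (subst sum.reindex[OF inj]) (auto intro!: sum.cong simp: the_inv_into_f_f[OF inj])
    also have "\<dots> = \<kappa> v i" using i finI by (simp add: if_distrib[of "\<lambda>x. _ * x"] cong: if_cong)
    finally show "\<kappa> v i = \<kappa> (lincomb (\<lambda>x. \<kappa> v (the_inv_into I u x)) (u ` I)) i" by simp
  qed
  have expand_functional: "L v = (\<Sum>i\<in>I. \<kappa> v i * L (u i))"
    if L: "\<And>v w. v \<in> carrier V \<Longrightarrow> w \<in> carrier V \<Longrightarrow> L (v \<oplus>\<^bsub>V\<^esub> w) = L v + L w"
      "\<And>c v. v \<in> carrier V \<Longrightarrow> L (c \<odot>\<^bsub>V\<^esub> v) = c * L v" and v: "v \<in> carrier V" for L :: "'v \<Rightarrow> 'k" and v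
  proof -
    have "L v = (\<Sum>x\<in>u ` I. \<kappa> v (the_inv_into I u x) * L x)"
      by (subst expand[OF v], rule functional[OF L]) (use finI u in auto)
    also have "\<dots> = (\<Sum>i\<in>I. \<kappa> v i * L (u i))"
      by (subst sum.reindex[OF inj]) (auto intro!: sum.cong simp: the_inv_into_f_f[OF inj])
    finally show ?thesis .
  qed
  have "basis (u ` I)"
  proof (subst basis_criterion)
    show "finite (u ` I)" "u ` I \<subseteq> carrier V" using finI u by auto
    show "\<forall>v. v \<in> carrier V \<longrightarrow> (\<exists>!a. a \<in> u ` I \<rightarrow>\<^sub>E carrier class_ring \<and> lincomb a (u ` I) = v)"
    proof (intro allI impI)
      fix v assume v: "v \<in> carrier V"
      let ?a = "restrict (\<lambda>x. \<kappa> v (the_inv_into I u x)) (u ` I)"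
      show "\<exists>!a. a \<in> u ` I \<rightarrow>\<^sub>E carrier class_ring \<and> lincomb a (u ` I) = v"
      proof (rule ex1I[of _ ?a], intro conjI)
        have "lincomb ?a (u ` I) = lincomb (\<lambda>x. \<kappa> v (the_inv_into I u x)) (u ` I)"
          using finI u by (intro lincomb_cong) auto
        then show "lincomb ?a (u ` I) = v" using expand[OF v] by simp
        fix a assume a: "a \<in> u ` I \<rightarrow>\<^sub>E carrier class_ring \<and> lincomb a (u ` I) = v"
        have "a (u i) = \<kappa> v i" if i: "i \<in> I" for i
        proof -
          have "\<kappa> v i = (\<Sum>x\<in>u ` I. a x * \<kappa> x i)"
            using a by (subst conjunct2[OF a, symmetric], intro functional[of "\<lambda>v. \<kappa> v i"])
              (use i u finI \<kappa>_add \<kappa>_smult in auto)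
          also have "\<dots> = (\<Sum>j\<in>I. a (u j) * (if i = j then 1 else 0))"
            using \<kappa>_u i by (subst sum.reindex[OF inj]) (auto intro!: sum.cong)
          also have "\<dots> = a (u i)" using i finI by (simp add: if_distrib[of "\<lambda>x. _ * x"] cong: if_cong)
          finally show ?thesis by simp
        qed
        then show "a = ?a"
          using a by (intro ext) (auto simp: the_inv_into_f_f[OF inj] restrict_def PiE_def extensional_def)
      qed auto
    qed
  qed
  then have ex: "\<exists>B. finite B \<and> basis B" using finI by blast
  define B where "B = (SOME B. finite B \<and> basis B)"
  have finB: "finite B" and basB: "basis B" using someI_ex[OF ex] by (auto simp: B_def)
  have BV: "B \<subseteq> carrier V" using basB by (simp add: basis_def)
  have ex1: "\<exists>!a. a \<in> B \<rightarrow>\<^sub>E carrier class_ring \<and> lincomb a B = v" if "v \<in> carrier V" for v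
    using basis_criterion[OF finB BV] basB that by simp
  have coord_eq: "coord V B v = (THE a. a \<in> B \<rightarrow>\<^sub>E carrier class_ring \<and> lincomb a B = v)" for v
    unfolding coord_def by (rule arg_cong[of _ _ The]) (auto simp: PiE_def)
  have coord: "coord V B v \<in> B \<rightarrow>\<^sub>E carrier class_ring" "lincomb (coord V B v) B = v" if "v \<in> carrier V" for v
    using theI'[OF ex1[OF that]] by (auto simp: coord_eq)
  have coord_unique: "coord V B v b = a b" if "v \<in> carrier V" "lincomb a B = v" "b \<in> B" for v a b
  proof -
    have "lincomb (restrict a B) B = v"
      using that finB BV by (subst lincomb_cong[of _ B _ a]) auto
    then have "coord V B v = restrict a B"
      using the1_equality[OF ex1[OF that(1)], of "restrict a B"] by (auto simp: coord_eq)
    then show ?thesis using that by simp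
  qed
  have coord_add: "coord V B (v \<oplus>\<^bsub>V\<^esub> w) b = coord V B v b + coord V B w b"
    if "v \<in> carrier V" "w \<in> carrier V" "b \<in> B" for v w b
  proof (rule coord_unique)
    have "lincomb (\<lambda>b. coord V B v b \<oplus>\<^bsub>class_ring\<^esub> coord V B w b) B = lincomb (coord V B v) B \<oplus>\<^bsub>V\<^esub> lincomb (coord V B w) B"
      by (rule lincomb_sum) (use finB BV in auto)
    then show "lincomb (\<lambda>b. coord V B v b + coord V B w b) B = v \<oplus>\<^bsub>V\<^esub> w"
      using coord that by simp
  qed (use that in auto)
  have coord_smult: "coord V B (c \<odot>\<^bsub>V\<^esub> v) b = c * coord V B v b"
    if "v \<in> carrier V" "b \<in> B" for c v b
  proof (rule coord_unique)
    have "lincomb (\<lambda>b. c \<otimes>\<^bsub>class_ring\<^esub> coord V B v b) B = c \<odot>\<^bsub>V\<^esub> lincomb (coord V B v) B"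
      by (rule lincomb_smult) (use finB BV in auto)
    then show "lincomb (\<lambda>b. c * coord V B v b) B = c \<odot>\<^bsub>V\<^esub> v"
      using coord that by simp
  qed (use that in auto)
  have "lin_trace V f = (\<Sum>b\<in>B. coord V B (f b) b)"
    by (simp add: lin_trace_def Let_def B_def)
  also have "\<dots> = (\<Sum>b\<in>B. \<Sum>i\<in>I. \<kappa> b i * coord V B (f (u i)) b)"
  proof (rule sum.cong[OF refl])
    fix b assume b: "b \<in> B"
    show "coord V B (f b) b = (\<Sum>i\<in>I. \<kappa> b i * coord V B (f (u i)) b)"
      by (rule expand_functional[of "\<lambda>v. coord V B (f v) b"])
        (use b BV f f_add f_smult coord_add coord_smult in auto)
  qed
  also have "\<dots> = (\<Sum>b\<in>B. \<Sum>i\<in>I. \<kappa> b i * (\<Sum>j\<in>I. \<kappa> (f (u i)) j * coord V B (u j) b))"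
  proof (intro sum.cong refl arg_cong[of _ _ "(*) _"])
    fix b i assume b: "b \<in> B" and i: "i \<in> I"
    show "coord V B (f (u i)) b = (\<Sum>j\<in>I. \<kappa> (f (u i)) j * coord V B (u j) b)"
      by (rule expand_functional[of "\<lambda>v. coord V B v b"])
        (use b i u BV f coord_add coord_smult in auto)
  qed
  also have "\<dots> = (\<Sum>i\<in>I. \<Sum>j\<in>I. \<Sum>b\<in>B. \<kappa> b i * (\<kappa> (f (u i)) j * coord V B (u j) b))"
    by (subst sum.swap) (simp add: sum_distrib_left sum.swap[of _ _ B])
  also have "\<dots> = (\<Sum>i\<in>I. \<Sum>j\<in>I. \<kappa> (f (u i)) j * \<kappa> (u j) i)"
  proof (intro sum.cong refl)
    fix i j assume i: "i \<in> I" and j: "j \<in> I"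
    have "\<kappa> (u j) i = \<kappa> (lincomb (coord V B (u j)) B) i" using coord u j by simp
    also have "\<dots> = (\<Sum>b\<in>B. coord V B (u j) b * \<kappa> b i)"
      by (rule functional[of "\<lambda>v. \<kappa> v i"]) (use i finB BV \<kappa>_add \<kappa>_smult in auto)
    finally show "(\<Sum>b\<in>B. \<kappa> b i * (\<kappa> (f (u i)) j * coord V B (u j) b)) = \<kappa> (f (u i)) j * \<kappa> (u j) i"
      by (simp add: sum_distrib_left mult_ac)
  qed
  also have "\<dots> = (\<Sum>i\<in>I. \<kappa> (f (u i)) i)"
  proof (intro sum.cong refl)
    fix i assume i: "i \<in> I"
    have "(\<Sum>j\<in>I. \<kappa> (f (u i)) j * \<kappa> (u j) i) = (\<Sum>j\<in>I. if i = j then \<kappa> (f (u i)) j else 0)"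
      using i \<kappa>_u by (intro sum.cong) auto
    then show "(\<Sum>j\<in>I. \<kappa> (f (u i)) j * \<kappa> (u j) i) = \<kappa> (f (u i)) i"
      using i finI by simp
  qed
  finally show ?thesis .
qed


section \<open>Quotients of spaces of finitely supported functions\<close>

abbreviation pm_scale :: "'k::field \<Rightarrow> ('b \<Rightarrow>\<^sub>0 'k) \<Rightarrow> ('b \<Rightarrow>\<^sub>0 'k)" where
  "pm_scale c \<equiv> Poly_Mapping.map ((*) c)"

lemma lookup_pm_scale [simp]: "Poly_Mapping.lookup (pm_scale c p) x = c * Poly_Mapping.lookup p x"
  by (simp add: Poly_Mapping.map.rep_eq when_def)

lemma pm_scale_simps:
  "pm_scale c (x + y) = pm_scale c x + pm_scale c y" "pm_scale (a + b) x = pm_scale a x + pm_scale b x"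
  "pm_scale a (pm_scale b x) = pm_scale (a * b) x" "pm_scale 1 x = x" "pm_scale 0 x = 0"
  "pm_scale c 0 = 0" "pm_scale c (- x) = - pm_scale c x" "pm_scale c (x - y) = pm_scale c x - pm_scale c y"
  "pm_scale c (Poly_Mapping.single k a) = Poly_Mapping.single k (c * a)"
  by (auto intro!: poly_mapping_eqI simp: lookup_add lookup_minus lookup_single algebra_simps when_def)

lemma pm_scale_minus_one: "pm_scale (- 1) x = - x"
  by (auto intro!: poly_mapping_eqI)

lemma vectorspaceI:
  fixes V :: "('k::field, 'v) module"
  assumes "abelian_group V"
    and "\<And>c x. x \<in> carrier V \<Longrightarrow> c \<odot>\<^bsub>V\<^esub> x \<in> carrier V"
    and "\<And>a b x. x \<in> carrier V \<Longrightarrow> (a + b) \<odot>\<^bsub>V\<^esub> x = a \<odot>\<^bsub>V\<^esub> x \<oplus>\<^bsub>V\<^esub> b \<odot>\<^bsub>V\<^esub> x"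
    and "\<And>c x y. x \<in> carrier V \<Longrightarrow> y \<in> carrier V \<Longrightarrow> c \<odot>\<^bsub>V\<^esub> (x \<oplus>\<^bsub>V\<^esub> y) = c \<odot>\<^bsub>V\<^esub> x \<oplus>\<^bsub>V\<^esub> c \<odot>\<^bsub>V\<^esub> y"
    and "\<And>a b x. x \<in> carrier V \<Longrightarrow> (a * b) \<odot>\<^bsub>V\<^esub> x = a \<odot>\<^bsub>V\<^esub> (b \<odot>\<^bsub>V\<^esub> x)"
    and "\<And>x. x \<in> carrier V \<Longrightarrow> 1 \<odot>\<^bsub>V\<^esub> x = x"
  shows "vectorspace class_ring V"
proof -
  have "cring (class_ring :: 'k ring)"
    using class_field by (auto simp: Ring.field_def domain_def)
  then have "Module.module class_ring V"
    by (intro moduleI) (use assms in auto)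
  then show ?thesis by (simp add: vectorspace_def class_field)
qed

locale subspace_record =
  fixes U :: "('k::field, 'b \<Rightarrow>\<^sub>0 'k) module"
  assumes U_ops: "zero U = 0" "add U = (+)" "smult U = pm_scale"
    and zero_in: "0 \<in> carrier U"
    and add_in: "x \<in> carrier U \<Longrightarrow> y \<in> carrier U \<Longrightarrow> x + y \<in> carrier U"
    and scale_in: "x \<in> carrier U \<Longrightarrow> pm_scale c x \<in> carrier U"
begin

lemma minus_in: "x \<in> carrier U \<Longrightarrow> - x \<in> carrier U"
  using scale_in[of x "- 1"] by (simp add: pm_scale_minus_one)

lemma diff_in: "x \<in> carrier U \<Longrightarrow> y \<in> carrier U \<Longrightarrow> x - y \<in> carrier U"
  using add_in[OF _ minus_in, of x y] by simp

lemma sum_in: "(\<And>j. j \<in> J \<Longrightarrow> f j \<in> carrier U) \<Longrightarrow> sum f J \<in> carrier U"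
  by (induction J rule: infinite_finite_induct) (auto simp: zero_in add_in)

lemma vectorspace_record: "vectorspace class_ring U"
proof (rule vectorspaceI)
  show "abelian_group U"
    by (rule abelian_groupI)
      (auto simp: U_ops zero_in add_in add_ac intro: minus_in bexI[of _ "- _"] simp: add.left_inverse)
qed (auto simp: U_ops pm_scale_simps scale_in)

end

text \<open>Every vector space of this development is a quotient of a space \<open>U\<close> of finitely supported functions by
the common kernel \<open>W\<close> of coordinate functionals with dual vectors \<open>u\<close>. In this form the classes of \<open>u\<close>
are a basis, and traces and matrices are computed with representatives.\<close>

locale quotient_coordinates = subspace_record U
  for U :: "('k::field, 'b \<Rightarrow>\<^sub>0 'k) module" +
  fixes W :: "('b \<Rightarrow>\<^sub>0 'k) set" and I :: "'i set" and u :: "'i \<Rightarrow> ('b \<Rightarrow>\<^sub>0 'k)"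
    and \<phi> :: "('b \<Rightarrow>\<^sub>0 'k) \<Rightarrow> 'i \<Rightarrow> 'k"
  assumes finI: "finite I"
    and u_in: "i \<in> I \<Longrightarrow> u i \<in> carrier U"
    and \<phi>_add: "x \<in> carrier U \<Longrightarrow> y \<in> carrier U \<Longrightarrow> i \<in> I \<Longrightarrow> \<phi> (x + y) i = \<phi> x i + \<phi> y i"
    and \<phi>_scale: "x \<in> carrier U \<Longrightarrow> i \<in> I \<Longrightarrow> \<phi> (pm_scale c x) i = c * \<phi> x i"
    and \<phi>_u: "i \<in> I \<Longrightarrow> j \<in> I \<Longrightarrow> \<phi> (u j) i = (if i = j then 1 else 0)"
    and W_eq: "W = {x \<in> carrier U. \<forall>i\<in>I. \<phi> x i = 0}"
begin

definition cst :: "('b \<Rightarrow>\<^sub>0 'k) \<Rightarrow> ('b \<Rightarrow>\<^sub>0 'k) set" where "cst x = W +>\<^bsub>U\<^esub> x"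

lemma \<phi>_minus: "x \<in> carrier U \<Longrightarrow> i \<in> I \<Longrightarrow> \<phi> (- x) i = - \<phi> x i"
  using \<phi>_scale[of x i "- 1"] by (simp add: pm_scale_minus_one)

lemma \<phi>_diff: "x \<in> carrier U \<Longrightarrow> y \<in> carrier U \<Longrightarrow> i \<in> I \<Longrightarrow> \<phi> (x - y) i = \<phi> x i - \<phi> y i"
  using \<phi>_add[of x "- y" i] by (simp add: \<phi>_minus minus_in)

lemma \<phi>_zero: "i \<in> I \<Longrightarrow> \<phi> 0 i = 0"
  using \<phi>_scale[OF zero_in, of i 0] by (simp add: pm_scale_simps)

lemma zero_W: "0 \<in> W" using zero_in \<phi>_zero by (simp add: W_eq)

lemma cst_eq_image: "cst x = (\<lambda>w. w + x) ` W"
  by (auto simp: cst_def a_r_coset_def' U_ops)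

lemma mem_cst: "y \<in> cst x \<longleftrightarrow> y - x \<in> W"
  by (auto simp: cst_eq_image image_iff intro: bexI[of _ "y - x"])

lemma mem_cstD: assumes "x \<in> carrier U" "y \<in> cst x" shows "y \<in> carrier U" "i \<in> I \<Longrightarrow> \<phi> y i = \<phi> x i"
proof -
  have yx: "y - x \<in> W" using assms by (simp add: mem_cst)
  then have "(y - x) + x \<in> carrier U" using assms W_eq by (intro add_in) auto
  then show y: "y \<in> carrier U" by simp
  show "\<phi> y i = \<phi> x i" if "i \<in> I"
    using yx \<phi>_diff[OF y assms(1) that] that W_eq by auto
qed

lemma cst_eq_iff:
  assumes "x \<in> carrier U" "y \<in> carrier U"
  shows "cst x = cst y \<longleftrightarrow> (\<forall>i\<in>I. \<phi> x i = \<phi> y i)"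
proof
  assume "cst x = cst y"
  moreover have "x \<in> cst x" by (simp add: mem_cst zero_W)
  ultimately show "\<forall>i\<in>I. \<phi> x i = \<phi> y i" using mem_cstD(2)[OF assms(2), of x] by auto
next
  assume eq: "\<forall>i\<in>I. \<phi> x i = \<phi> y i"
  have sub: "z - y \<in> W" if "x \<in> carrier U" "y \<in> carrier U" "\<forall>i\<in>I. \<phi> x i = \<phi> y i" "z - x \<in> W" for x y z
  proof -
    have z: "z \<in> carrier U" "\<And>i. i \<in> I \<Longrightarrow> \<phi> z i = \<phi> x i"
      using mem_cstD[of x z] that(1,4) by (auto simp: mem_cst)
    then have "\<phi> (z - y) i = 0" if "i \<in> I" for i
      using \<phi>_diff[OF z(1) \<open>y \<in> carrier U\<close> that] that \<open>\<forall>i\<in>I. \<phi> x i = \<phi> y i\<close> by simp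
    then show ?thesis using diff_in[OF z(1) that(2)] by (simp add: W_eq)
  qed
  show "cst x = cst y"
  proof (rule Set.set_eqI)
    fix z show "z \<in> cst x \<longleftrightarrow> z \<in> cst y"
      unfolding mem_cst using sub[of x y z] sub[of y x z] assms eq by metis
  qed
qed

lemma cst_add: "x \<in> carrier U \<Longrightarrow> y \<in> carrier U \<Longrightarrow> cst x <+>\<^bsub>U\<^esub> cst y = cst (x + y)"
proof -
  assume xy: "x \<in> carrier U" "y \<in> carrier U"
  have W_add: "v + w \<in> W" if "v \<in> W" "w \<in> W" for v w
    using that by (auto simp: W_eq add_in \<phi>_add)
  have set_add: "cst x <+>\<^bsub>U\<^esub> cst y = {h + k |h k. h \<in> cst x \<and> k \<in> cst y}"
    unfolding set_add_def' U_ops by auto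
  show ?thesis
  proof (intro equalityI subsetI)
    fix z assume "z \<in> cst x <+>\<^bsub>U\<^esub> cst y"
    then obtain h k where hk: "z = h + k" "h - x \<in> W" "k - y \<in> W" by (auto simp: set_add mem_cst)
    have eq: "z - (x + y) = (h - x) + (k - y)" using hk(1) by (simp add: algebra_simps)
    show "z \<in> cst (x + y)" unfolding mem_cst eq by (rule W_add[OF hk(2,3)])
  next
    fix z assume z: "z \<in> cst (x + y)"
    have "z = (z - y) + y" "z - y \<in> cst x" "y \<in> cst y"
      using z by (simp_all add: mem_cst zero_W algebra_simps)
    then show "z \<in> cst x <+>\<^bsub>U\<^esub> cst y" unfolding set_add by blast
  qed
qed

abbreviation "Q \<equiv> quot_vs U W"

lemma carrier_Q: "carrier Q = cst ` carrier U"
  by (auto simp: quot_vs_def A_RCOSETS_def' cst_def)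

lemma ops_Q: "zero Q = cst 0" "add Q = (<+>\<^bsub>U\<^esub>)"
  by (auto simp: quot_vs_def cst_eq_image)

lemma smult_Q: "x \<in> carrier U \<Longrightarrow> c \<odot>\<^bsub>Q\<^esub> cst x = cst (pm_scale c x)"
proof -
  assume x: "x \<in> carrier U"
  have "c \<odot>\<^bsub>Q\<^esub> cst x = (\<Union>y\<in>cst x. cst (pm_scale c y))"
    by (simp add: quot_vs_def cst_def U_ops)
  also have "\<dots> = (\<Union>y\<in>cst x. cst (pm_scale c x))"
  proof (rule SUP_cong[OF refl])
    fix y assume "y \<in> cst x"
    then have "y \<in> carrier U" "\<And>i. i \<in> I \<Longrightarrow> \<phi> y i = \<phi> x i" using mem_cstD[OF x] by auto
    then show "cst (pm_scale c y) = cst (pm_scale c x)"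
      using x by (subst cst_eq_iff) (auto simp: scale_in \<phi>_scale)
  qed
  also have "\<dots> = cst (pm_scale c x)" using zero_W by (auto simp: cst_eq_image)
  finally show ?thesis .
qed

lemma vectorspace_Q: "vectorspace class_ring Q"
proof (rule vectorspaceI)
  show "abelian_group Q"
  proof (rule abelian_groupI)
    fix x assume "x \<in> carrier Q"
    then obtain x' where x': "x' \<in> carrier U" "x = cst x'" by (auto simp: carrier_Q)
    then show "\<exists>y\<in>carrier Q. y \<oplus>\<^bsub>Q\<^esub> x = \<zero>\<^bsub>Q\<^esub>"
      by (intro bexI[of _ "cst (- x')"]) (auto simp: carrier_Q ops_Q cst_add minus_in)
  qed (auto simp: carrier_Q ops_Q cst_add zero_in add_in add_ac)
qed (auto simp: carrier_Q ops_Q smult_Q cst_add add_in scale_in pm_scale_simps)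

lemma expand_functional:
  assumes L_add: "\<And>x y. x \<in> carrier U \<Longrightarrow> y \<in> carrier U \<Longrightarrow> L (x + y) = L x + (L y :: 'k)"
    and L_scale: "\<And>c x. x \<in> carrier U \<Longrightarrow> L (pm_scale c x) = c * L x"
    and L_W: "\<And>x. x \<in> W \<Longrightarrow> L x = 0" and x: "x \<in> carrier U"
  shows "L x = (\<Sum>i\<in>I. \<phi> x i * L (u i))"
proof -
  define y where "y = (\<Sum>i\<in>I. pm_scale (\<phi> x i) (u i))"
  have L0: "L 0 = 0" using L_W zero_W by simp
  have expand: "L' (\<Sum>i\<in>J. pm_scale (\<phi> x i) (u i)) = (\<Sum>i\<in>J. \<phi> x i * L' (u i))"
    if L': "\<And>x y. x \<in> carrier U \<Longrightarrow> y \<in> carrier U \<Longrightarrow> L' (x + y) = L' x + (L' y :: 'k)"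
     "\<And>c x. x \<in> carrier U \<Longrightarrow> L' (pm_scale c x) = c * L' x" "L' 0 = 0" "J \<subseteq> I" for L' J
  proof -
    have "finite J" using \<open>J \<subseteq> I\<close> finI finite_subset by blast
    then show ?thesis using \<open>J \<subseteq> I\<close>
    proof (induction J)
      case (insert j J)
      then have "L' (pm_scale (\<phi> x j) (u j) + (\<Sum>i\<in>J. pm_scale (\<phi> x i) (u i)))
          = L' (pm_scale (\<phi> x j) (u j)) + L' (\<Sum>i\<in>J. pm_scale (\<phi> x i) (u i))"
        by (intro L') (auto intro!: scale_in u_in sum_in)
      then show ?case using insert L' u_in by auto
    qed (simp add: L')
  qed
  have y: "y \<in> carrier U" by (auto simp: y_def intro!: sum_in scale_in u_in)
  have "\<phi> y i = \<phi> x i" if i: "i \<in> I" for i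
  proof -
    have "\<phi> y i = (\<Sum>j\<in>I. \<phi> x j * \<phi> (u j) i)"
      unfolding y_def by (rule expand) (auto simp: i \<phi>_add \<phi>_scale \<phi>_zero)
    also have "\<dots> = (\<Sum>j\<in>I. if i = j then \<phi> x j else 0)"
      by (intro sum.cong) (auto simp: i \<phi>_u)
    finally show ?thesis using i finI by simp
  qed
  then have "x - y \<in> W" using x y by (auto simp: W_eq diff_in \<phi>_diff)
  then have "L ((x - y) + y) = L y" using L_add[of "x - y" y] L_W[of "x - y"] x y diff_in by auto
  then have "L x = L y" by simp
  also have "L y = (\<Sum>i\<in>I. \<phi> x i * L (u i))"
    unfolding y_def by (rule expand) (auto simp: L_add L_scale L0)
  finally show ?thesis .
qed

lemma image_cst:
  assumes f: "\<And>x. x \<in> carrier U \<Longrightarrow> f x \<in> carrier U"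
    and f_add: "\<And>x y. x \<in> carrier U \<Longrightarrow> y \<in> carrier U \<Longrightarrow> f (x + y) = f x + f y"
    and f_W: "f ` W = W" and x: "x \<in> carrier U"
  shows "f ` cst x = cst (f x)"
proof -
  have "f ` cst x = (\<lambda>w. f (w + x)) ` W" by (simp add: cst_eq_image image_image)
  also have "\<dots> = (\<lambda>w. f w + f x) ` W" using x by (intro image_cong) (auto simp: W_eq f_add)
  also have "\<dots> = (\<lambda>w. w + f x) ` (f ` W)" by (simp add: image_image)
  finally show ?thesis by (simp add: f_W cst_eq_image)
qed

text \<open>The coordinate functionals vanish on \<open>W\<close>, so they descend to cosets, where they are dual to the classes
of \<open>u\<close> and separate points.\<close>

lemma lin_trace_quotient:
  assumes f: "\<And>x. x \<in> carrier U \<Longrightarrow> f x \<in> carrier U"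
    and f_add: "\<And>x y. x \<in> carrier U \<Longrightarrow> y \<in> carrier U \<Longrightarrow> f (x + y) = f x + f y"
    and f_scale: "\<And>c x. x \<in> carrier U \<Longrightarrow> f (pm_scale c x) = pm_scale c (f x)"
    and f_W: "f ` W = W"
  shows "lin_trace Q ((`) f) = (\<Sum>i\<in>I. \<phi> (f (u i)) i)"
proof -
  \<comment> \<open>The choice of the representative does not matter, since the functionals vanish on the subspace divided out.\<close>
  define \<kappa> where "\<kappa> X = \<phi> (SOME x. x \<in> X)" for X
  have \<kappa>: "\<kappa> (cst x) i = \<phi> x i" if "x \<in> carrier U" "i \<in> I" for x i
  proof -
    have "\<exists>y. y \<in> cst x" using zero_W by (auto simp: cst_eq_image)
    then have "(SOME y. y \<in> cst x) \<in> cst x" by (rule someI_ex)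
    then show ?thesis using mem_cstD(2)[OF that(1)] that(2) by (auto simp: \<kappa>_def)
  qed
  have img: "f ` cst x = cst (f x)" if "x \<in> carrier U" for x
    by (rule image_cst) (use f f_add f_W that in auto)
  have img_add: "f ` cst (x + y) = cst (f x) <+>\<^bsub>U\<^esub> cst (f y)" if "x \<in> carrier U" "y \<in> carrier U" for x y
    using that f by (simp add: img add_in f_add cst_add)
  have img_scale: "f ` cst (pm_scale c x) = c \<odot>\<^bsub>Q\<^esub> cst (f x)" if "x \<in> carrier U" for x c
    using that f by (simp add: img scale_in f_scale smult_Q)
  have "lin_trace Q ((`) f) = (\<Sum>i\<in>I. \<kappa> (f ` cst (u i)) i)"
  proof (rule lin_trace_eq_sum_coordinates[OF vectorspace_Q finI, of "\<lambda>i. cst (u i)" \<kappa> "(`) f"])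
    fix v w assume "v \<in> carrier Q" "w \<in> carrier Q" "\<And>i. i \<in> I \<Longrightarrow> \<kappa> v i = \<kappa> w i"
    then obtain x y where xy: "v = cst x" "w = cst y" "x \<in> carrier U" "y \<in> carrier U"
        "\<And>i. i \<in> I \<Longrightarrow> \<kappa> (cst x) i = \<kappa> (cst y) i" by (auto simp: carrier_Q)
    then show "v = w" by (simp add: \<kappa> cst_eq_iff)
  next
    fix v w assume "v \<in> carrier Q" "w \<in> carrier Q"
    then obtain x y where xy: "v = cst x" "w = cst y" "x \<in> carrier U" "y \<in> carrier U" by (auto simp: carrier_Q)
    then show "f ` (v \<oplus>\<^bsub>Q\<^esub> w) = f ` v \<oplus>\<^bsub>Q\<^esub> f ` w" "f ` (c \<odot>\<^bsub>Q\<^esub> v) = c \<odot>\<^bsub>Q\<^esub> f ` v" for c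
      by (simp_all add: ops_Q cst_add smult_Q img_add img_scale img)
    fix i assume i: "i \<in> I"
    show "\<kappa> (v \<oplus>\<^bsub>Q\<^esub> w) i = \<kappa> v i + \<kappa> w i" "\<kappa> (c \<odot>\<^bsub>Q\<^esub> v) i = c * \<kappa> v i" for c
      using xy i by (simp_all add: ops_Q cst_add smult_Q \<kappa> add_in scale_in \<phi>_add \<phi>_scale)
  next
    fix v assume "v \<in> carrier Q"
    then obtain x where "v = cst x" "x \<in> carrier U" by (auto simp: carrier_Q)
    then show "f ` v \<in> carrier Q" by (simp add: img carrier_Q f)
  next
    fix i j assume "i \<in> I" "j \<in> I"
    then show "\<kappa> (cst (u j)) i = (if i = j then 1 else 0)" by (simp add: \<kappa> u_in \<phi>_u)
  next
    show "i \<in> I \<Longrightarrow> cst (u i) \<in> carrier Q" for i by (simp add: carrier_Q u_in)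
  qed
  also have "\<dots> = (\<Sum>i\<in>I. \<phi> (f (u i)) i)"
    by (intro sum.cong) (auto simp: img u_in f \<kappa>)
  finally show ?thesis .
qed

end

text \<open>The matrices of the action in the basis of classes of \<open>u\<close> form the homomorphism; multiplicativity is the
expansion of a functional along the dual basis.\<close>

lemma rep_class_quotient_genuine:
  fixes U :: "(complex, 'b \<Rightarrow>\<^sub>0 complex) module" and \<Gamma> :: "'g monoid"
  assumes qc: "quotient_coordinates U W I u \<phi>"
    and f: "\<And>g x. g \<in> carrier \<Gamma> \<Longrightarrow> x \<in> carrier U \<Longrightarrow> f g x \<in> carrier U"
    and f_add: "\<And>g x y. g \<in> carrier \<Gamma> \<Longrightarrow> x \<in> carrier U \<Longrightarrow> y \<in> carrier U \<Longrightarrow> f g (x + y) = f g x + f g y"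
    and f_scale: "\<And>g c x. g \<in> carrier \<Gamma> \<Longrightarrow> x \<in> carrier U \<Longrightarrow> f g (pm_scale c x) = pm_scale c (f g x)"
    and f_W: "\<And>g. g \<in> carrier \<Gamma> \<Longrightarrow> f g ` W = W"
    and f_one: "\<one>\<^bsub>\<Gamma>\<^esub> \<in> carrier \<Gamma>" "\<And>x. x \<in> carrier U \<Longrightarrow> f \<one>\<^bsub>\<Gamma>\<^esub> x = x"
    and f_mult: "\<And>g h x. g \<in> carrier \<Gamma> \<Longrightarrow> h \<in> carrier \<Gamma> \<Longrightarrow> x \<in> carrier U \<Longrightarrow> f (g \<otimes>\<^bsub>\<Gamma>\<^esub> h) x = f g (f h x)"
  shows "rep_class \<Gamma> (quot_vs U W) (\<lambda>g. (`) (f g)) \<in> genuine_classes \<Gamma>"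
proof -
  interpret quotient_coordinates U W I u \<phi> by (rule qc)
  \<comment> \<open>Matrices are indexed by an initial segment of the natural numbers, coordinates by an arbitrary finite set.\<close>
  obtain e where e: "bij_betw e {..<card I} I"
    using ex_bij_betw_nat_finite[OF finI] by (auto simp: atLeast0LessThan)
  have eI: "e i \<in> I" if "i < card I" for i using e that by (auto simp: bij_betw_def)
  have e_eq: "e i = e j \<longleftrightarrow> i = j" if "i < card I" "j < card I" for i j
    using e that by (auto simp: bij_betw_def inj_on_def)
  define \<rho> where "\<rho> g = mat (card I) (card I) (\<lambda>(i, j). \<phi> (f g (u (e j))) (e i))" for g
  have \<rho>_dim: "\<rho> g \<in> carrier_mat (card I) (card I)" for g by (simp add: \<rho>_def)
  have \<rho>_index: "\<rho> g $$ (i, j) = \<phi> (f g (u (e j))) (e i)" if "i < card I" "j < card I" for g i j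
    using that by (simp add: \<rho>_def)
  have "\<rho> (g \<otimes>\<^bsub>\<Gamma>\<^esub> h) = \<rho> g * \<rho> h" if g: "g \<in> carrier \<Gamma>" and h: "h \<in> carrier \<Gamma>" for g h
  proof (rule eq_matI)
    fix i j assume "i < dim_row (\<rho> g * \<rho> h)" "j < dim_col (\<rho> g * \<rho> h)"
    then have i: "i < card I" and j: "j < card I" using \<rho>_dim[of g] \<rho>_dim[of h] by auto
    have "\<phi> (f g (f h (u (e j)))) (e i) = (\<Sum>k\<in>I. \<phi> (f h (u (e j))) k * \<phi> (f g (u k)) (e i))"
    proof (rule expand_functional[where L = "\<lambda>x. \<phi> (f g x) (e i)"])
      fix x assume x: "x \<in> W"
      then have "f g x \<in> W" using f_W[OF g] by auto
      then show "\<phi> (f g x) (e i) = 0" using eI[OF i] by (auto simp: W_eq)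
    next
      fix x y assume "x \<in> carrier U" "y \<in> carrier U"
      then show "\<phi> (f g (x + y)) (e i) = \<phi> (f g x) (e i) + \<phi> (f g y) (e i)"
        using g eI[OF i] by (simp add: f_add \<phi>_add f)
    next
      fix c x assume "x \<in> carrier U"
      then show "\<phi> (f g (pm_scale c x)) (e i) = c * \<phi> (f g x) (e i)"
        using g eI[OF i] by (simp add: f_scale \<phi>_scale f)
    next
      show "f h (u (e j)) \<in> carrier U" by (rule f[OF h u_in[OF eI[OF j]]])
    qed
    also have "\<dots> = (\<Sum>k<card I. \<phi> (f h (u (e j))) (e k) * \<phi> (f g (u (e k))) (e i))"
      by (rule sum.reindex_bij_betw[OF e, symmetric])
    finally show "\<rho> (g \<otimes>\<^bsub>\<Gamma>\<^esub> h) $$ (i, j) = (\<rho> g * \<rho> h) $$ (i, j)"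
      using i j \<rho>_dim[of g] \<rho>_dim[of h] \<rho>_index
      by (simp add: f_mult[OF g h u_in[OF eI[OF j]]] scalar_prod_def atLeast0LessThan mult.commute)
  next
    show "dim_row (\<rho> (g \<otimes>\<^bsub>\<Gamma>\<^esub> h)) = dim_row (\<rho> g * \<rho> h)" "dim_col (\<rho> (g \<otimes>\<^bsub>\<Gamma>\<^esub> h)) = dim_col (\<rho> g * \<rho> h)"
      using \<rho>_dim by (metis carrier_matD index_mult_mat(2,3))+
  qed
  moreover have "\<rho> \<one>\<^bsub>\<Gamma>\<^esub> = 1\<^sub>m (card I)"
  proof (rule eq_matI)
    fix i j assume "i < dim_row (1\<^sub>m (card I) :: complex mat)" "j < dim_col (1\<^sub>m (card I) :: complex mat)"
    then have i: "i < card I" and j: "j < card I" by auto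
    show "\<rho> \<one>\<^bsub>\<Gamma>\<^esub> $$ (i, j) = 1\<^sub>m (card I) $$ (i, j)"
      using i j by (simp add: \<rho>_index f_one(2)[OF u_in[OF eI[OF j]]] \<phi>_u[OF eI[OF i] eI[OF j]] e_eq)
  qed (use \<rho>_dim in auto)
  moreover have "lin_trace Q ((`) (f g)) = (\<Sum>i<card I. \<rho> g $$ (i, i))" if g: "g \<in> carrier \<Gamma>" for g
  proof -
    have "lin_trace Q ((`) (f g)) = (\<Sum>i\<in>I. \<phi> (f g (u i)) i)"
      by (rule lin_trace_quotient[OF f[OF g] f_add[OF g] f_scale[OF g] f_W[OF g]])
    also have "\<dots> = (\<Sum>i<card I. \<phi> (f g (u (e i))) (e i))"
      by (rule sum.reindex_bij_betw[OF e, symmetric])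
    finally show ?thesis by (simp add: \<rho>_index)
  qed
  moreover note \<rho>_dim
  moreover from calculation have "rep_class \<Gamma> Q (\<lambda>g. (`) (f g))
      = (\<lambda>g. if g \<in> carrier \<Gamma> then \<Sum>i<card I. \<rho> g $$ (i, i) else 0)"
    unfolding rep_class_def by (intro ext) simp
  ultimately show ?thesis
    unfolding genuine_classes_def
    by (intro CollectI exI[of _ "card I"] exI[of _ \<rho>] conjI ballI) assumption+
qed

section \<open>Extension of scalars\<close>

lemma free_vs_subspace_record: "subspace_record (free_vs S :: ('k::field, 'b \<Rightarrow>\<^sub>0 'k) module)"
proof (rule subspace_record.intro)
  show "0 \<in> carrier (free_vs S)" by (simp add: free_vs_def)
  show "x + y \<in> carrier (free_vs S)" if "x \<in> carrier (free_vs S)" "y \<in> carrier (free_vs S)" for x y :: "'b \<Rightarrow>\<^sub>0 'k"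
    using that Poly_Mapping.keys_add[of x y] by (auto simp: free_vs_def)
  show "pm_scale c x \<in> carrier (free_vs S)" if "x \<in> carrier (free_vs S)" for c and x :: "'b \<Rightarrow>\<^sub>0 'k"
    using that by (auto simp: free_vs_def in_keys_iff)
qed (auto simp: free_vs_def)

text \<open>The last clause is what shows that coordinate functionals factor through the quotient by a span of
relations: it suffices to test them on the relations.\<close>

lemma span_closed:
  fixes U :: "('k::field, 'b \<Rightarrow>\<^sub>0 'k) module"
  assumes "subspace_record U" and "R \<subseteq> carrier U"
  defines "W \<equiv> LinearCombinations.module.span class_ring U R"
  shows "W \<subseteq> carrier U" "R \<subseteq> W" "x \<in> W \<Longrightarrow> y \<in> W \<Longrightarrow> x + y \<in> W" "x \<in> W \<Longrightarrow> pm_scale c x \<in> W" "0 \<in> W"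
    and "x \<in> W \<Longrightarrow> (\<And>x y. L (x + y) = L x + L y) \<Longrightarrow> (\<And>c x. L (pm_scale c x) = c * L x) \<Longrightarrow>
      (\<And>r. r \<in> R \<Longrightarrow> L r = (0 :: 'k)) \<Longrightarrow> L x = 0"
proof -
  interpret U: subspace_record U by (rule assms(1))
  interpret vectorspace class_ring U by (rule U.vectorspace_record)
  have sub: "LinearCombinations.module.span class_ring U R \<subseteq> carrier U" 
    using span_is_subset2[OF assms(2)] by simp
  have subm: "submodule class_ring W U" unfolding W_def by (rule span_is_submodule[OF assms(2)])
  show "W \<subseteq> carrier U" using sub by (simp add: W_def)
  show "R \<subseteq> W" unfolding W_def by (rule in_own_span[OF assms(2)])
  show "x \<in> W \<Longrightarrow> y \<in> W \<Longrightarrow> x + y \<in> W" "x \<in> W \<Longrightarrow> pm_scale c x \<in> W" 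
    using submodule.m_closed[OF subm] submodule.smult_closed[OF subm] by (auto simp: U.U_ops)
  show "L x = 0" if "x \<in> W" "\<And>x y. L (x + y) = L x + L y" "\<And>c x. L (pm_scale c x) = c * L x"
    "\<And>r. r \<in> R \<Longrightarrow> L r = 0"
  proof -
    obtain a A where A: "finite A" "A \<subseteq> R" "x = lincomb a A"
      using \<open>x \<in> W\<close> by (auto simp: W_def span_def)
    then have "L x = (\<Sum>y\<in>A. a y * L y)"
      unfolding A(3) using that assms(2) by (intro functional_lincomb[OF U.vectorspace_record]) (auto simp: U.U_ops)
    then show ?thesis using A that(4) by (simp add: subset_iff)
  qed
  show "0 \<in> W" using submodule.zero_closed[OF subm] by (simp add: U.U_ops)
qed

definition lin_ext :: "('b \<Rightarrow> 'k::comm_ring_1) \<Rightarrow> ('b \<Rightarrow>\<^sub>0 'k) \<Rightarrow> 'k" where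
  "lin_ext g p = (\<Sum>b\<in>Poly_Mapping.keys p. Poly_Mapping.lookup p b * g b)"

lemma lin_ext_add: "lin_ext g (p + q) = lin_ext g p + lin_ext g q"
  unfolding lin_ext_def by (rule setsum_keys_plus_distrib) (auto simp: algebra_simps)

lemma lin_ext_single [simp]: "lin_ext g (Poly_Mapping.single b c) = c * g b"
  by (simp add: lin_ext_def)

lemma lin_ext_zero [simp]: "lin_ext g 0 = 0" by (simp add: lin_ext_def)

lemma lin_ext_sum: "lin_ext g (sum h J) = (\<Sum>j\<in>J. lin_ext g (h j))"
  by (induction J rule: infinite_finite_induct) (auto simp: lin_ext_add)

lemma sum_singles: "(\<Sum>b\<in>Poly_Mapping.keys p. Poly_Mapping.single b (Poly_Mapping.lookup p b)) = p"
  by (rule poly_mapping_eqI) (simp add: lookup_sum lookup_single when_def in_keys_iff)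

text \<open>Every element is a sum of multiples of basis vectors, so identities between additive maps, and by
iteration between biadditive ones, can be checked on monomials.\<close>

lemma pm_additive_eq:
  fixes L L' :: "('b \<Rightarrow>\<^sub>0 'k::comm_monoid_add) \<Rightarrow> 'c::cancel_comm_monoid_add"
  assumes "\<And>x y. L (x + y) = L x + L y" "\<And>x y. L' (x + y) = L' x + L' y"
    and single: "\<And>b c. b \<in> Poly_Mapping.keys p \<Longrightarrow> L (Poly_Mapping.single b c) = L' (Poly_Mapping.single b c)"
  shows "L p = L' p"
proof -
  have zero: "L 0 = 0" "L' 0 = 0" using assms(1)[of 0 0] assms(2)[of 0 0] by auto
  have "L (sum h J) = (\<Sum>j\<in>J. L (h j))" "L' (sum h J) = (\<Sum>j\<in>J. L' (h j))" for h and J :: "'b set"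
    by (induction J rule: infinite_finite_induct) (auto simp: assms zero)
  then have "L (\<Sum>b\<in>Poly_Mapping.keys p. Poly_Mapping.single b (Poly_Mapping.lookup p b))
      = L' (\<Sum>b\<in>Poly_Mapping.keys p. Poly_Mapping.single b (Poly_Mapping.lookup p b))"
    using single by simp
  then show ?thesis by (simp add: sum_singles)
qed

lemma pm_push_add: "pm_push f (p + q) = pm_push f p + pm_push f q"
  unfolding pm_push_def by (rule setsum_keys_plus_distrib) (auto simp: single_add)

lemma pm_push_single [simp]: "pm_push f (Poly_Mapping.single b c) = Poly_Mapping.single (f b) c"
  by (simp add: pm_push_def)

lemma pm_push_zero [simp]: "pm_push f 0 = 0" by (simp add: pm_push_def)

lemma pm_push_sum: "pm_push f (sum h J) = (\<Sum>j\<in>J. pm_push f (h j))"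
  by (induction J rule: infinite_finite_induct) (auto simp: pm_push_add)

lemma pm_push_minus: "pm_push f (- p) = - pm_push f (p :: _ \<Rightarrow>\<^sub>0 'k::ab_group_add)"
  using pm_push_add[of f p "- p"] by (simp add: eq_neg_iff_add_eq_0 add.commute)

lemma pm_push_diff: "pm_push f (p - q) = pm_push f p - pm_push f (q :: _ \<Rightarrow>\<^sub>0 'k::ab_group_add)"
  using pm_push_add[of f p "- q"] by (simp add: pm_push_minus)

lemma keys_pm_push: "Poly_Mapping.keys (pm_push f p) \<subseteq> f ` Poly_Mapping.keys p"
proof
  fix x assume "x \<in> Poly_Mapping.keys (pm_push f p)"
  then obtain b where "b \<in> Poly_Mapping.keys p" "x \<in> Poly_Mapping.keys (Poly_Mapping.single (f b) (Poly_Mapping.lookup p b))"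
    using Poly_Mapping.keys_sum unfolding pm_push_def by fast
  then show "x \<in> f ` Poly_Mapping.keys p" by (auto split: if_splits)
qed

lemma pm_push_scale: "pm_push f (pm_scale c p) = pm_scale c (pm_push f p)"
  by (rule pm_additive_eq) (auto simp: pm_push_add pm_scale_simps)

lemma pm_push_push: "pm_push f (pm_push g p) = pm_push (\<lambda>x. f (g x)) (p :: _ \<Rightarrow>\<^sub>0 'k::cancel_comm_monoid_add)"
  by (rule pm_additive_eq) (auto simp: pm_push_add)

lemma pm_push_ident: "(\<And>b. b \<in> Poly_Mapping.keys p \<Longrightarrow> f b = b) \<Longrightarrow> pm_push f p = (p :: _ \<Rightarrow>\<^sub>0 'k::cancel_comm_monoid_add)"
  by (rule pm_additive_eq) (auto simp: pm_push_add)

lemma lin_ext_scale: "lin_ext g (pm_scale c p) = c * lin_ext g p"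
  by (rule pm_additive_eq) (auto simp: lin_ext_add pm_scale_simps distrib_left mult.assoc)

lemma lin_ext_minus: "lin_ext g (- p) = - lin_ext g p"
  using lin_ext_add[of g p "- p"] by (simp add: eq_neg_iff_add_eq_0 add.commute)

lemma lin_ext_diff: "lin_ext g (p - q) = lin_ext g p - lin_ext g q"
  using lin_ext_add[of g p "- q"] by (simp add: lin_ext_minus)

text \<open>The relations that define \<open>\<complex> \<otimes>\<^sub>\<rat> V\<close> reduce the generator of any \<open>v\<close> to a combination of the generators of
the basis vectors. Hence the span of the relations is the common kernel of the complexified coordinate
functionals, and the trace is computed with the rational coordinates. Bijectivity of \<open>f\<close> is what makes
the elementwise image of a coset a full coset.\<close>

lemma lin_trace_complexify:
  fixes V :: "(rat, 'v) module" and b :: "'i \<Rightarrow> 'v" and \<kappa> :: "'v \<Rightarrow> 'i \<Rightarrow> rat"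
  assumes add_closed: "\<And>v w. v \<in> carrier V \<Longrightarrow> w \<in> carrier V \<Longrightarrow> v \<oplus>\<^bsub>V\<^esub> w \<in> carrier V"
    and smult_closed: "\<And>q v. v \<in> carrier V \<Longrightarrow> q \<odot>\<^bsub>V\<^esub> v \<in> carrier V"
    and finI: "finite I" and b: "\<And>i. i \<in> I \<Longrightarrow> b i \<in> carrier V"
    and \<kappa>_add: "\<And>v w i. v \<in> carrier V \<Longrightarrow> w \<in> carrier V \<Longrightarrow> i \<in> I \<Longrightarrow> \<kappa> (v \<oplus>\<^bsub>V\<^esub> w) i = \<kappa> v i + \<kappa> w i"
    and \<kappa>_smult: "\<And>q v i. v \<in> carrier V \<Longrightarrow> i \<in> I \<Longrightarrow> \<kappa> (q \<odot>\<^bsub>V\<^esub> v) i = q * \<kappa> v i"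
    and \<kappa>_b: "\<And>i j. i \<in> I \<Longrightarrow> j \<in> I \<Longrightarrow> \<kappa> (b j) i = (if i = j then 1 else 0)"
    and \<kappa>_inj: "\<And>v w. v \<in> carrier V \<Longrightarrow> w \<in> carrier V \<Longrightarrow> (\<And>i. i \<in> I \<Longrightarrow> \<kappa> v i = \<kappa> w i) \<Longrightarrow> v = w"
    and f: "bij_betw f (carrier V) (carrier V)"
    and f_add: "\<And>v w. v \<in> carrier V \<Longrightarrow> w \<in> carrier V \<Longrightarrow> f (v \<oplus>\<^bsub>V\<^esub> w) = f v \<oplus>\<^bsub>V\<^esub> f w"
    and f_smult: "\<And>q v. v \<in> carrier V \<Longrightarrow> f (q \<odot>\<^bsub>V\<^esub> v) = q \<odot>\<^bsub>V\<^esub> f v"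
  shows "lin_trace (complexify V) (complexify_map f) = (\<Sum>i\<in>I. of_rat (\<kappa> (f (b i)) i))"
proof -
  define U :: "(complex, 'v \<Rightarrow>\<^sub>0 complex) module" where "U = free_vs (carrier V)"
  define R where "R = complexify_rel V"
  define W where "W = LinearCombinations.module.span class_ring U R"
  define \<phi> :: "('v \<Rightarrow>\<^sub>0 complex) \<Rightarrow> 'i \<Rightarrow> complex" where "\<phi> p i = lin_ext (\<lambda>v. of_rat (\<kappa> v i)) p" for p i
  interpret U: subspace_record U unfolding U_def by (rule free_vs_subspace_record)
  have carrier_U: "p \<in> carrier U \<longleftrightarrow> Poly_Mapping.keys p \<subseteq> carrier V" for p
    by (simp add: U_def free_vs_def)
  have single_in: "Poly_Mapping.single v c \<in> carrier U" if "v \<in> carrier V" for v c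
    using that by (simp add: carrier_U)
  have R_cases: "(\<exists>v w. v \<in> carrier V \<and> w \<in> carrier V \<and> r = Poly_Mapping.single (v \<oplus>\<^bsub>V\<^esub> w) 1 - Poly_Mapping.single v 1 - Poly_Mapping.single w 1)
      \<or> (\<exists>q v. v \<in> carrier V \<and> r = Poly_Mapping.single (q \<odot>\<^bsub>V\<^esub> v) 1 - Poly_Mapping.single v (of_rat q))" if "r \<in> R" for r
    using that by (auto simp: R_def complexify_rel_def)
  have R_U: "R \<subseteq> carrier U"
    using R_cases by (blast intro: U.diff_in single_in add_closed smult_closed)
  note W = span_closed[OF U.subspace_record_axioms R_U, folded W_def]
  have W_diff: "x - y \<in> W" if "x \<in> W" "y \<in> W" for x y
    using W(3)[OF that(1) W(4)[OF that(2), of "- 1"]] by (simp add: pm_scale_minus_one)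
  have W_sum: "(\<And>j. j \<in> J \<Longrightarrow> h j \<in> W) \<Longrightarrow> sum h J \<in> W" for J :: "'v set" and h
    by (induction J rule: infinite_finite_induct) (auto simp: W)
  have W_\<phi>: "\<phi> (pm_push g x) i = 0"
    if x: "x \<in> W" and i: "i \<in> I" and g: "\<And>v. v \<in> carrier V \<Longrightarrow> g v \<in> carrier V"
      "\<And>v w. v \<in> carrier V \<Longrightarrow> w \<in> carrier V \<Longrightarrow> g (v \<oplus>\<^bsub>V\<^esub> w) = g v \<oplus>\<^bsub>V\<^esub> g w"
      "\<And>q v. v \<in> carrier V \<Longrightarrow> g (q \<odot>\<^bsub>V\<^esub> v) = q \<odot>\<^bsub>V\<^esub> g v" for g x i
  proof (rule W(6)[OF x])
    fix r assume "r \<in> R"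
    from R_cases[OF this] show "\<phi> (pm_push g r) i = 0"
      using i by (elim disjE exE conjE)
        (simp_all add: \<phi>_def pm_push_diff lin_ext_diff g \<kappa>_add \<kappa>_smult of_rat_add of_rat_mult)
  qed (auto simp: \<phi>_def lin_ext_add lin_ext_scale pm_push_add pm_push_scale)
  \<comment> \<open>Coordinates are added one at a time; the partial sums stay inside the space, so each addition is one of the relations.\<close>
  have expand: "\<exists>s\<in>carrier V. (\<forall>i\<in>I. \<kappa> s i = (if i \<in> J then \<kappa> v i else 0)) \<and>
      Poly_Mapping.single s 1 - (\<Sum>i\<in>J. Poly_Mapping.single (b i) (of_rat (\<kappa> v i))) \<in> W"
    if v: "v \<in> carrier V" and J: "J \<subseteq> I" for v J
  proof -
    have "finite J" using J finI finite_subset by blast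
    then show ?thesis using J
    proof (induction J)
      case empty
      have "Poly_Mapping.single (0 \<odot>\<^bsub>V\<^esub> v) 1 - Poly_Mapping.single v (of_rat 0) \<in> R"
        using v unfolding R_def complexify_rel_def by blast
      then show ?case using W(2) v by (intro bexI[of _ "0 \<odot>\<^bsub>V\<^esub> v"]) (auto simp: \<kappa>_smult smult_closed)
    next
      case (insert j J)
      then obtain s where s: "s \<in> carrier V" "\<forall>i\<in>I. \<kappa> s i = (if i \<in> J then \<kappa> v i else 0)"
        "Poly_Mapping.single s 1 - (\<Sum>i\<in>J. Poly_Mapping.single (b i) (of_rat (\<kappa> v i))) \<in> W" by auto
      have j: "j \<in> I" "b j \<in> carrier V" using insert b by auto
      let ?t = "\<kappa> v j \<odot>\<^bsub>V\<^esub> b j"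
      have "Poly_Mapping.single (s \<oplus>\<^bsub>V\<^esub> ?t) 1 - Poly_Mapping.single s 1 - Poly_Mapping.single ?t 1 \<in> R"
        using s j unfolding R_def complexify_rel_def by (blast intro: smult_closed)
      moreover have "Poly_Mapping.single ?t 1 - Poly_Mapping.single (b j) (of_rat (\<kappa> v j)) \<in> R"
        using s j unfolding R_def complexify_rel_def by blast
      ultimately have "(Poly_Mapping.single s 1 - (\<Sum>i\<in>J. Poly_Mapping.single (b i) (of_rat (\<kappa> v i)))) +
          (Poly_Mapping.single (s \<oplus>\<^bsub>V\<^esub> ?t) 1 - Poly_Mapping.single s 1 - Poly_Mapping.single ?t 1) +
          (Poly_Mapping.single ?t 1 - Poly_Mapping.single (b j) (of_rat (\<kappa> v j))) \<in> W"
        using W(2,3) s(3) by (meson subsetD)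
      then have "Poly_Mapping.single (s \<oplus>\<^bsub>V\<^esub> ?t) 1 - (\<Sum>i\<in>insert j J. Poly_Mapping.single (b i) (of_rat (\<kappa> v i))) \<in> W"
        using insert by (simp add: algebra_simps)
      then show ?case
        using s j insert by (intro bexI[of _ "s \<oplus>\<^bsub>V\<^esub> ?t"]) (auto simp: \<kappa>_add \<kappa>_smult \<kappa>_b smult_closed add_closed)
    qed
  qed
  have expand1: "Poly_Mapping.single v 1 - (\<Sum>i\<in>I. Poly_Mapping.single (b i) (of_rat (\<kappa> v i))) \<in> W"
    if v: "v \<in> carrier V" for v
  proof -
    obtain s where s: "s \<in> carrier V" "\<forall>i\<in>I. \<kappa> s i = (if i \<in> I then \<kappa> v i else 0)"
        "Poly_Mapping.single s 1 - (\<Sum>i\<in>I. Poly_Mapping.single (b i) (of_rat (\<kappa> v i))) \<in> W"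
      using expand[OF v order_refl] by auto
    then have "s = v" using v by (intro \<kappa>_inj) auto
    then show ?thesis using s by simp
  qed
  have W_eq: "W = {x \<in> carrier U. \<forall>i\<in>I. \<phi> x i = 0}"
  proof (intro equalityI subsetI CollectI conjI ballI)
    fix x assume x: "x \<in> W"
    then show "x \<in> carrier U" using W(1) by auto
    fix i assume i: "i \<in> I"
    have "\<phi> (pm_push (\<lambda>v. v) x) i = 0" using x i by (intro W_\<phi>) auto
    then show "\<phi> x i = 0" by (simp add: pm_push_ident)
  next
    fix x assume "x \<in> {x \<in> carrier U. \<forall>i\<in>I. \<phi> x i = 0}"
    then have x: "Poly_Mapping.keys x \<subseteq> carrier V" and \<phi>0: "\<And>i. i \<in> I \<Longrightarrow> \<phi> x i = 0" by (auto simp: carrier_U)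
    let ?d = "\<lambda>v. Poly_Mapping.single v 1 - (\<Sum>i\<in>I. Poly_Mapping.single (b i) (of_rat (\<kappa> v i) :: complex))"
    have "(\<Sum>v\<in>Poly_Mapping.keys x. pm_scale (Poly_Mapping.lookup x v) (?d v)) \<in> W"
      using x expand1 by (intro W_sum W(4)) auto
    also have "(\<Sum>v\<in>Poly_Mapping.keys x. pm_scale (Poly_Mapping.lookup x v) (?d v))
        = x - (\<Sum>i\<in>I. Poly_Mapping.single (b i) (\<phi> x i))"
    proof -
      have sc: "pm_scale c (\<Sum>i\<in>I. Poly_Mapping.single (b i) (h i)) = (\<Sum>i\<in>I. Poly_Mapping.single (b i) (c * h i))" for c :: complex and h
        using finI by (induction I rule: finite_induct) (auto simp: pm_scale_simps)
      have ss: "(\<Sum>v\<in>S. Poly_Mapping.single k (h v)) = Poly_Mapping.single k (sum h S)" for k :: 'v and h :: "'v \<Rightarrow> complex" and S :: "'v set"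
        by (induction S rule: infinite_finite_induct) (auto simp: single_add)
      have "(\<Sum>v\<in>Poly_Mapping.keys x. pm_scale (Poly_Mapping.lookup x v) (?d v))
         = (\<Sum>v\<in>Poly_Mapping.keys x. Poly_Mapping.single v (Poly_Mapping.lookup x v)
            - (\<Sum>i\<in>I. Poly_Mapping.single (b i) (Poly_Mapping.lookup x v * of_rat (\<kappa> v i))))"
        by (intro sum.cong refl) (simp only: pm_scale_simps sc mult_1_right)
      also have "\<dots> = x - (\<Sum>i\<in>I. \<Sum>v\<in>Poly_Mapping.keys x. Poly_Mapping.single (b i) (Poly_Mapping.lookup x v * of_rat (\<kappa> v i)))"
        by (simp add: sum_subtractf sum_singles sum.swap[of _ I])
      finally show ?thesis by (simp add: ss \<phi>_def lin_ext_def)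
    qed
    finally show "x \<in> W" using \<phi>0 by simp
  qed
  have qc: "quotient_coordinates U W I (\<lambda>i. Poly_Mapping.single (b i) 1) \<phi>"
    by (intro quotient_coordinates.intro U.subspace_record_axioms quotient_coordinates_axioms.intro)
      (auto simp: finI single_in b \<phi>_def lin_ext_add lin_ext_scale \<kappa>_b W_eq)
  interpret Q: quotient_coordinates U W I "\<lambda>i. Poly_Mapping.single (b i) 1" \<phi> by (rule qc)
  have f_in: "f v \<in> carrier V" if "v \<in> carrier V" for v using f that by (auto simp: bij_betw_def)
  define g where "g = the_inv_into (carrier V) f"
  have g_in: "g v \<in> carrier V" and fg: "f (g v) = v" if "v \<in> carrier V" for v
    using f that bij_betw_the_inv_into[OF f] by (auto simp: g_def bij_betw_def f_the_inv_into_f)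
  have gf: "g (f v) = v" if "v \<in> carrier V" for v
    using f that by (auto simp: g_def bij_betw_def the_inv_into_f_f)
  have push_in: "pm_push h x \<in> carrier U" if "x \<in> carrier U" "\<And>v. v \<in> carrier V \<Longrightarrow> h v \<in> carrier V" for h x
    using that keys_pm_push[of h x] unfolding carrier_U by blast
  have push_W: "pm_push h x \<in> W" if x: "x \<in> W" and h: "\<And>v. v \<in> carrier V \<Longrightarrow> h v \<in> carrier V"
      "\<And>v w. v \<in> carrier V \<Longrightarrow> w \<in> carrier V \<Longrightarrow> h (v \<oplus>\<^bsub>V\<^esub> w) = h v \<oplus>\<^bsub>V\<^esub> h w"
      "\<And>q v. v \<in> carrier V \<Longrightarrow> h (q \<odot>\<^bsub>V\<^esub> v) = q \<odot>\<^bsub>V\<^esub> h v" for h x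
    using W_\<phi>[OF x _ h] push_in[of x h] x h(1) W(1) by (auto simp: W_eq)
  have g_add: "g (v \<oplus>\<^bsub>V\<^esub> w) = g v \<oplus>\<^bsub>V\<^esub> g w" if "v \<in> carrier V" "w \<in> carrier V" for v w
    using gf[of "g v \<oplus>\<^bsub>V\<^esub> g w"] that by (simp add: f_add g_in fg add_closed)
  have g_smult: "g (q \<odot>\<^bsub>V\<^esub> v) = q \<odot>\<^bsub>V\<^esub> g v" if "v \<in> carrier V" for q v
    using gf[of "q \<odot>\<^bsub>V\<^esub> g v"] that by (simp add: f_smult g_in fg smult_closed)
  have f_W: "pm_push f ` W = W"
  proof (intro equalityI subsetI)
    fix x assume "x \<in> pm_push f ` W"
    then show "x \<in> W" using push_W f_in f_add f_smult by auto
  next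
    fix x assume x: "x \<in> W"
    then have "x \<in> carrier U" using W(1) by blast
    then have keys_x: "Poly_Mapping.keys x \<subseteq> carrier V" by (simp add: carrier_U)
    have "pm_push f (pm_push g x) = x"
      unfolding pm_push_push by (rule pm_push_ident) (use keys_x fg in blast)
    moreover have "pm_push g x \<in> W" using x g_in g_add g_smult by (rule push_W)
    ultimately show "x \<in> pm_push f ` W" by (metis imageI)
  qed
  have "lin_trace (quot_vs U W) ((`) (pm_push f)) = (\<Sum>i\<in>I. \<phi> (pm_push f (Poly_Mapping.single (b i) 1)) i)"
    by (rule Q.lin_trace_quotient) (auto simp: push_in f_in pm_push_add pm_push_scale f_W)
  then show ?thesis by (simp add: \<phi>_def complexify_def complexify_map_def U_def W_def R_def)
qed

section \<open>Matroids and their flats\<close>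

locale finite_matroid =
  fixes E :: "'a set" and rk :: "'a set \<Rightarrow> nat"
  assumes matroid: "matroid E rk" and loopless: "loopless E rk"
begin

lemma finite_E: "finite E" using matroid by (simp add: matroid_def)

lemma finite_sub: "A \<subseteq> E \<Longrightarrow> finite A" using finite_E finite_subset by blast

lemma rk_le_card: "A \<subseteq> E \<Longrightarrow> rk A \<le> card A" using matroid by (simp add: matroid_def)

lemma rk_mono: "A \<subseteq> B \<Longrightarrow> B \<subseteq> E \<Longrightarrow> rk A \<le> rk B" using matroid by (simp add: matroid_def)

lemma rk_submod: "A \<subseteq> E \<Longrightarrow> B \<subseteq> E \<Longrightarrow> rk (A \<union> B) + rk (A \<inter> B) \<le> rk A + rk B"
  using matroid by (simp add: matroid_def)

lemma rk_empty: "rk {} = 0" using rk_le_card[of "{}"] by simp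

lemma rk_insert_le: "insert i A \<subseteq> E \<Longrightarrow> rk (insert i A) \<le> Suc (rk A)"
  using rk_submod[of A "{i}"] rk_le_card[of "{i}"] by auto

lemma rk_pos: "A \<subseteq> E \<Longrightarrow> A \<noteq> {} \<Longrightarrow> 0 < rk A"
proof -
  assume A: "A \<subseteq> E" "A \<noteq> {}"
  then obtain i where "i \<in> A" "i \<in> E" by auto
  then have "0 < rk {i}" "rk {i} \<le> rk A" using A loopless rk_mono[of "{i}" A] by (auto simp: loopless_def)
  then show ?thesis by simp
qed

definition cl :: "'a set \<Rightarrow> 'a set" where "cl A = {i \<in> E. rk (insert i A) = rk A}"

abbreviation "flat F \<equiv> F \<in> flats E rk"

lemma flat_sub: "flat F \<Longrightarrow> F \<subseteq> E" by (simp add: flats_def)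

lemma finite_flats: "finite (flats E rk)"
  by (rule finite_subset[of _ "Pow E"]) (auto simp: flats_def finite_E)

lemma cl_sub: "cl A \<subseteq> E" by (auto simp: cl_def)

lemma sub_cl: "A \<subseteq> E \<Longrightarrow> A \<subseteq> cl A" by (auto simp: cl_def insert_absorb)

lemma rk_union_absorb:
  assumes "A \<subseteq> E" "S \<subseteq> cl A" shows "rk (A \<union> S) = rk A"
proof -
  have "finite S" using assms cl_sub finite_sub by blast
  then show ?thesis using assms(2)
  proof (induction S)
    case (insert i S)
    then have i: "i \<in> E" "rk (insert i A) = rk A" and S: "S \<subseteq> E" "rk (A \<union> S) = rk A"
      using cl_sub by (auto simp: cl_def)
    have sub: "A \<subseteq> E" "A \<union> S \<subseteq> E" "insert i A \<subseteq> E" using assms S i by auto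
    have "rk ((A \<union> S) \<union> insert i A) + rk ((A \<union> S) \<inter> insert i A) \<le> rk A + rk A"
      using rk_submod[OF sub(2,3)] S i by simp
    moreover have "rk A \<le> rk ((A \<union> S) \<inter> insert i A)" using sub by (intro rk_mono) auto
    moreover have "rk A \<le> rk (A \<union> insert i S)" using sub i by (intro rk_mono) auto
    moreover have "(A \<union> S) \<union> insert i A = A \<union> insert i S" by auto
    ultimately show ?case by simp
  qed simp
qed

lemma rk_cl: "A \<subseteq> E \<Longrightarrow> rk (cl A) = rk A"
  using rk_union_absorb[of A "cl A"] sub_cl[of A] by (simp add: Un_absorb1)

lemma flat_rk_less: "flat F \<Longrightarrow> F \<subset> A \<Longrightarrow> A \<subseteq> E \<Longrightarrow> rk F < rk A"
proof -
  assume F: "flat F" and FA: "F \<subset> A" and A: "A \<subseteq> E"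
  then obtain i where i: "i \<in> A" "i \<notin> F" by auto
  then have "rk F < rk (insert i F)" using F A by (auto simp: flats_def)
  also have "\<dots> \<le> rk A" using i FA A by (intro rk_mono) auto
  finally show ?thesis .
qed

lemma flat_eqI: "flat F \<Longrightarrow> F \<subseteq> A \<Longrightarrow> A \<subseteq> E \<Longrightarrow> rk A \<le> rk F \<Longrightarrow> A = F"
  using flat_rk_less[of F A] by (auto simp: psubset_eq)

lemma flat_cl: "A \<subseteq> E \<Longrightarrow> flat (cl A)"
proof -
  assume A: "A \<subseteq> E"
  have "rk (cl A) < rk (insert i (cl A))" if i: "i \<in> E - cl A" for i
  proof -
    have "rk (insert i A) \<noteq> rk A" using i by (auto simp: cl_def)
    moreover have "rk A \<le> rk (insert i A)" "rk (insert i A) \<le> rk (insert i (cl A))"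
      using A i sub_cl[OF A] cl_sub by (auto intro!: rk_mono)
    ultimately show ?thesis by (simp add: rk_cl A)
  qed
  then show ?thesis using cl_sub by (auto simp: flats_def)
qed

lemma cl_min: "A \<subseteq> F \<Longrightarrow> flat F \<Longrightarrow> cl A \<subseteq> F"
proof
  fix i assume AF: "A \<subseteq> F" "flat F" and i: "i \<in> cl A"
  have sub: "F \<subseteq> E" "A \<subseteq> E" "i \<in> E" using AF flat_sub i by (auto simp: cl_def)
  show "i \<in> F"
  proof (rule ccontr)
    assume "i \<notin> F"
    then have "F \<inter> insert i A = A" "F \<union> insert i A = insert i F" using AF by auto
    then have "rk (insert i F) + rk A \<le> rk F + rk (insert i A)" using rk_submod[of F "insert i A"] sub by simp
    moreover have "rk (insert i A) = rk A" using i by (simp add: cl_def)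
    moreover have "rk F < rk (insert i F)" using AF \<open>i \<notin> F\<close> sub by (auto simp: flats_def)
    ultimately show False by simp
  qed
qed

lemma flat_E: "flat E" by (auto simp: flats_def)

lemma flat_empty: "flat {}"
  using rk_pos by (auto simp: flats_def rk_empty)

lemma rk_flat_mono: "flat F \<Longrightarrow> flat G \<Longrightarrow> F \<subseteq> G \<Longrightarrow> rk F \<le> rk G"
  by (rule rk_mono) (auto dest: flat_sub)

text \<open>As long as the rank of \<open>A\<close> is smaller than \<open>s\<close>, its closure misses an element of \<open>Y\<close>, and adding that element
raises the rank by exactly one.\<close>

lemma flat_of_rank_between:
  assumes "A \<subseteq> Y" "flat Y" "rk A \<le> s" "s \<le> rk Y"
  shows "\<exists>z. flat z \<and> A \<subseteq> z \<and> z \<subseteq> Y \<and> rk z = s"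
  using assms
proof (induction "rk Y - rk A" arbitrary: A rule: less_induct)
  case less
  have YE: "Y \<subseteq> E" and AE: "A \<subseteq> E" using less.prems flat_sub by auto
  show ?case
  proof (cases "rk A = s")
    case True
    then show ?thesis using less.prems AE
      by (intro exI[of _ "cl A"]) (auto simp: rk_cl flat_cl intro: subsetD[OF sub_cl] subsetD[OF cl_min])
  next
    case False
    then have "rk (cl A) < rk Y" using less.prems by (simp add: rk_cl AE)
    then obtain i where i: "i \<in> Y" "i \<notin> cl A" using rk_mono[of Y "cl A"] cl_sub by (auto simp: not_le[symmetric])
    then have iE: "insert i A \<subseteq> E" "i \<in> E" using YE AE by auto
    then have "rk (insert i A) \<noteq> rk A" using i by (auto simp: cl_def)
    moreover have "rk A \<le> rk (insert i A)" using iE by (intro rk_mono) auto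
    ultimately have r: "rk (insert i A) = Suc (rk A)" using rk_insert_le[OF iE(1)] by simp
    have "\<exists>z. flat z \<and> insert i A \<subseteq> z \<and> z \<subseteq> Y \<and> rk z = s"
      by (rule less.hyps) (use less.prems i r False in auto)
    then show ?thesis by auto
  qed
qed

section \<open>The Hall--Rado condition\<close>

definition nbelow :: "'a set multiset \<Rightarrow> 'a set \<Rightarrow> nat" where
  "nbelow q K = size (filter_mset (\<lambda>G. G \<subseteq> K) q)"

text \<open>Rado's condition for the existence of an independent transversal of \<open>q\<close>. It plays the role of the
intersection theory of the ring: a product of \<open>rk E\<close> classes \<open>h\<close>, one for each member of \<open>q\<close>, will have
degree one or zero according to whether \<open>q\<close> satisfies it.\<close>

definition rado :: "'a set multiset \<Rightarrow> bool" where
  "rado q \<longleftrightarrow> (\<forall>K\<subseteq>E. nbelow q K \<le> rk K)"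

definition tight :: "'a set multiset \<Rightarrow> 'a set \<Rightarrow> bool" where
  "tight q K \<longleftrightarrow> K \<subseteq> E \<and> nbelow q K = rk K"

definition max_tight :: "'a set multiset \<Rightarrow> 'a set" where
  "max_tight q = \<Union>{K. tight q K}"

lemma nbelow_simps [simp]:
  "nbelow {#} K = 0" "nbelow (add_mset G q) K = (if G \<subseteq> K then Suc (nbelow q K) else nbelow q K)"
  "nbelow (p + q) K = nbelow p K + nbelow q K"
  by (auto simp: nbelow_def)

lemma nbelow_replicate [simp]: "nbelow (replicate_mset m G) K = (if G \<subseteq> K then m else 0)"
  by (induction m) auto

lemma nbelow_mono: "K \<subseteq> L \<Longrightarrow> nbelow q K \<le> nbelow q L"
  by (induction q) auto

lemma nbelow_supermod: "nbelow q K + nbelow q L \<le> nbelow q (K \<union> L) + nbelow q (K \<inter> L)"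
  by (induction q) auto

lemma nbelow_all: "(\<And>G. G \<in># q \<Longrightarrow> G \<subseteq> K) \<Longrightarrow> nbelow q K = size q"
  by (induction q) auto

lemma nbelow_filter: "nbelow (filter_mset (\<lambda>G. G \<subseteq> F) q) K = nbelow q (K \<inter> F)"
  by (induction q) auto

lemma radoD: "rado q \<Longrightarrow> K \<subseteq> E \<Longrightarrow> nbelow q K \<le> rk K" by (simp add: rado_def)

lemma rado_mono: "rado (p + q) \<Longrightarrow> rado q"
  unfolding rado_def by (auto intro: order_trans[rotated])

lemma rado_add_mset: "rado (add_mset G q) \<Longrightarrow> rado q"
  using rado_mono[of "{#G#}" q] by simp

text \<open>Uncrossing: the number of members contained in a set is supermodular, the rank is submodular.\<close>

lemma tight_Un:
  assumes q: "rado q" and K: "tight q K" and L: "tight q L"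
  shows "tight q (K \<union> L)"
proof -
  have sub: "K \<subseteq> E" "L \<subseteq> E" using K L by (auto simp: tight_def)
  have "rk (K \<union> L) + rk (K \<inter> L) \<le> nbelow q K + nbelow q L"
    using rk_submod[OF sub] K L by (simp add: tight_def)
  also have "\<dots> \<le> nbelow q (K \<union> L) + nbelow q (K \<inter> L)" by (rule nbelow_supermod)
  finally have "rk (K \<union> L) + rk (K \<inter> L) \<le> nbelow q (K \<union> L) + nbelow q (K \<inter> L)" .
  moreover have "nbelow q (K \<inter> L) \<le> rk (K \<inter> L)" using radoD[OF q, of "K \<inter> L"] sub by blast
  ultimately have "rk (K \<union> L) \<le> nbelow q (K \<union> L)" by linarith
  then show ?thesis using radoD[OF q, of "K \<union> L"] sub by (auto simp: tight_def)
qed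

lemma tight_empty: "rado q \<Longrightarrow> tight q {}"
  using radoD[of q "{}"] by (simp add: tight_def rk_empty)

lemma tight_max_tight: assumes q: "rado q" shows "tight q (max_tight q)"
proof -
  have fin: "finite {K. tight q K}"
    by (rule finite_subset[of _ "Pow E"]) (auto simp: tight_def finite_E)
  have "tight q (\<Union>S)" if "finite S" "S \<subseteq> {K. tight q K}" for S
    using that by (induction S) (auto simp: tight_empty q tight_Un)
  then show ?thesis using fin by (simp add: max_tight_def)
qed

lemma tight_sub_max: "tight q K \<Longrightarrow> K \<subseteq> max_tight q"
  by (auto simp: max_tight_def)

lemma max_tight_sub: "max_tight q \<subseteq> E" by (auto simp: max_tight_def tight_def)

lemma nbelow_max_tight: "rado q \<Longrightarrow> nbelow q (max_tight q) = rk (max_tight q)"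
  using tight_max_tight by (simp add: tight_def)

lemma flat_max_tight: assumes q: "rado q" shows "flat (max_tight q)"
proof -
  let ?N = "max_tight q"
  have "rk (cl ?N) \<le> nbelow q ?N" using tight_max_tight[OF q] by (simp add: tight_def rk_cl)
  also have "\<dots> \<le> nbelow q (cl ?N)" by (intro nbelow_mono sub_cl max_tight_sub)
  finally have "tight q (cl ?N)" using radoD[OF q cl_sub, of ?N] cl_sub by (simp add: tight_def)
  then have "cl ?N = ?N" using tight_sub_max sub_cl[OF max_tight_sub] by blast
  then show ?thesis using flat_cl[OF max_tight_sub, of q] by simp
qed

text \<open>Adding \<open>G\<close> raises the count of exactly the sets above \<open>G\<close>, and so violates the condition exactly if one of
them is already tight.\<close>

lemma rado_add_iff: "rado (add_mset G q) \<longleftrightarrow> rado q \<and> \<not> G \<subseteq> max_tight q"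
proof (cases "rado q")
  case q: True
  have "rado (add_mset G q) \<longleftrightarrow> \<not> G \<subseteq> max_tight q"
  proof
    assume r: "rado (add_mset G q)"
    show "\<not> G \<subseteq> max_tight q"
      using radoD[OF r max_tight_sub[of q]] nbelow_max_tight[OF q] by auto
  next
    assume G: "\<not> G \<subseteq> max_tight q"
    show "rado (add_mset G q)" unfolding rado_def
    proof (intro allI impI)
      fix K assume K: "K \<subseteq> E"
      show "nbelow (add_mset G q) K \<le> rk K"
      proof (cases "G \<subseteq> K")
        case True
        then have "\<not> tight q K" using G tight_sub_max by blast
        then show ?thesis using radoD[OF q K] K by (auto simp: tight_def)
      qed (use radoD[OF q K] in simp)
    qed
  qed
  then show ?thesis using q by simp
qed (use rado_add_mset in auto)

lemma max_tight_eqI: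
  assumes "rado q" "tight q F" "\<And>K. flat K \<Longrightarrow> F \<subset> K \<Longrightarrow> nbelow q K \<noteq> rk K"
  shows "max_tight q = F"
proof (rule ccontr)
  assume "max_tight q \<noteq> F"
  then have "F \<subset> max_tight q" using tight_sub_max[OF assms(2)] by auto
  then show False using assms(3) flat_max_tight nbelow_max_tight assms(1) by blast
qed

text \<open>Once a flat \<open>F\<close> is tight, the condition splits into one on the members inside \<open>F\<close> and one on the
remaining members above \<open>F\<close>. The degree of a product factors along \<open>F\<close> for this reason.\<close>

lemma max_tight_factor:
  assumes F: "flat F"
  shows "rado q \<and> max_tight q = F \<longleftrightarrow>
    nbelow q F = rk F \<and> rado (filter_mset (\<lambda>G. G \<subseteq> F) q) \<and>
    (\<forall>K. flat K \<and> F \<subset> K \<longrightarrow> rk F + nbelow (filter_mset (\<lambda>G. \<not> G \<subseteq> F) q) K < rk K)"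
proof -
  have split: "nbelow q K = rk F + nbelow (filter_mset (\<lambda>G. \<not> G \<subseteq> F) q) K"
    if "nbelow q F = rk F" "F \<subseteq> K" for K
  proof -
    have "nbelow q K = nbelow (filter_mset (\<lambda>G. G \<subseteq> F) q) K + nbelow (filter_mset (\<lambda>G. \<not> G \<subseteq> F) q) K"
      by (subst multiset_partition[of q "\<lambda>G. G \<subseteq> F"]) (rule nbelow_simps(3))
    then show ?thesis using that by (simp add: nbelow_filter Int_absorb1)
  qed
  have FE: "F \<subseteq> E" using F flat_sub by blast
  show ?thesis
  proof
    assume L: "rado q \<and> max_tight q = F"
    then have nF: "nbelow q F = rk F" using nbelow_max_tight by blast
    moreover have "rado (filter_mset (\<lambda>G. G \<subseteq> F) q)"
    proof (rule rado_mono)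
      have "filter_mset (\<lambda>G. \<not> G \<subseteq> F) q + filter_mset (\<lambda>G. G \<subseteq> F) q = q"
        by (subst add.commute) (rule multiset_partition[symmetric])
      then show "rado (filter_mset (\<lambda>G. \<not> G \<subseteq> F) q + filter_mset (\<lambda>G. G \<subseteq> F) q)" using L by simp
    qed
    moreover have "rk F + nbelow (filter_mset (\<lambda>G. \<not> G \<subseteq> F) q) K < rk K" if K: "flat K" "F \<subset> K" for K
    proof -
      have "\<not> tight q K" using tight_sub_max[of q K] L K by auto
      then have "nbelow q K < rk K" using radoD[of q K] L flat_sub[OF K(1)] by (auto simp: tight_def)
      then show ?thesis using split[OF nF, of K] K by auto
    qed
    ultimately show "nbelow q F = rk F \<and> rado (filter_mset (\<lambda>G. G \<subseteq> F) q) \<and>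
      (\<forall>K. flat K \<and> F \<subset> K \<longrightarrow> rk F + nbelow (filter_mset (\<lambda>G. \<not> G \<subseteq> F) q) K < rk K)" by blast
  next
    assume R: "nbelow q F = rk F \<and> rado (filter_mset (\<lambda>G. G \<subseteq> F) q) \<and>
      (\<forall>K. flat K \<and> F \<subset> K \<longrightarrow> rk F + nbelow (filter_mset (\<lambda>G. \<not> G \<subseteq> F) q) K < rk K)"
    have above: "nbelow q K < rk K" if "flat K" "F \<subset> K" for K
      using R split[of K] that by auto
    have above': "nbelow q K \<le> rk K" if K: "F \<subseteq> K" "K \<subseteq> E" for K
    proof -
      have "nbelow q K \<le> nbelow q (cl K)" by (intro nbelow_mono sub_cl K)
      moreover have "F \<subseteq> cl K" using K sub_cl by blast
      ultimately show ?thesis using above[OF flat_cl[OF K(2)]] R rk_cl[OF K(2)]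
        by (metis order.strict_implies_order order.trans psubsetI)
    qed
    have rado: "rado q" unfolding rado_def
    proof (intro allI impI)
      fix K assume K: "K \<subseteq> E"
      have "nbelow q K + nbelow q F \<le> nbelow q (K \<union> F) + nbelow q (K \<inter> F)" by (rule nbelow_supermod)
      moreover have "nbelow q (K \<union> F) \<le> rk (K \<union> F)" using above' K FE by auto
      moreover have "nbelow q (K \<inter> F) \<le> rk (K \<inter> F)"
        using R K radoD[of "filter_mset (\<lambda>G. G \<subseteq> F) q" "K \<inter> F"] by (auto simp: nbelow_filter)
      ultimately show "nbelow q K \<le> rk K" using rk_submod[OF K FE] R by linarith
    qed
    moreover have "max_tight q = F"
      by (rule max_tight_eqI[OF rado]) (use R above FE in \<open>auto simp: tight_def\<close>, fastforce)
    ultimately show "rado q \<and> max_tight q = F" by simp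
  qed
qed

text \<open>The combinatorial source of \<open>x\<^sub>F x\<^sub>F\<^sub>' = 0\<close> for incomparable flats: if adding \<open>G\<close> moves the maximal tight set,
then the new one contains \<open>G\<close>.\<close>

lemma max_tight_add_cases:
  assumes r: "rado (add_mset G q)" and N: "max_tight (add_mset G q) = F"
  shows "F = max_tight q \<and> \<not> G \<subseteq> F \<or> F \<noteq> max_tight q \<and> G \<subseteq> F"
proof -
  have q: "rado q" "\<not> G \<subseteq> max_tight q" using r rado_add_iff by auto
  have FE: "F \<subseteq> E" using N max_tight_sub by blast
  have nF: "nbelow (add_mset G q) F = rk F" using nbelow_max_tight[OF r] N by simp
  show ?thesis
  proof (cases "G \<subseteq> F")
    case True
    then show ?thesis using q by auto
  next
    case False
    then have "tight q F" using nF FE by (simp add: tight_def)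
    moreover have "tight (add_mset G q) (max_tight q)"
      using tight_max_tight[OF q(1)] q(2) by (simp add: tight_def)
    ultimately have "F = max_tight q" using tight_sub_max N by blast
    then show ?thesis using False by simp
  qed
qed

text \<open>The combinatorial source of \<open>y\<^sub>i x\<^sub>F = 0\<close> for \<open>i \<notin> F\<close>: joining \<open>i\<close> to the maximal tight set raises the rank by
at most one, while the number of members inside goes up by one.\<close>

lemma element_in_max_tight_add:
  assumes r: "rado (add_mset (cl {i}) q)" and i: "i \<in> E"
  shows "i \<in> max_tight (add_mset (cl {i}) q)"
proof -
  let ?q = "add_mset (cl {i}) q" and ?K = "cl (insert i (max_tight q))"
  have q: "rado q" "\<not> cl {i} \<subseteq> max_tight q" using r rado_add_iff by auto
  have sub: "insert i (max_tight q) \<subseteq> E" using i max_tight_sub by auto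
  have iK: "i \<in> ?K" using sub_cl[OF sub] by auto
  then have "cl {i} \<subseteq> ?K" by (intro cl_min flat_cl sub) auto
  moreover have "nbelow q (max_tight q) \<le> nbelow q ?K" using sub_cl[OF sub] by (intro nbelow_mono) auto
  ultimately have "Suc (rk (max_tight q)) \<le> nbelow ?q ?K" using nbelow_max_tight[OF q(1)] by simp
  moreover have "rk ?K \<le> Suc (rk (max_tight q))" using rk_insert_le[OF sub] by (simp add: rk_cl[OF sub])
  ultimately have "nbelow ?q ?K = rk ?K" using radoD[OF r cl_sub, of "insert i (max_tight q)"] by linarith
  then have "tight ?q ?K" using cl_sub unfolding tight_def by blast
  then show ?thesis using tight_sub_max iK by blast
qed

end

lemma lin_ext_mult:
  "lin_ext g (v * w) = lin_ext (\<lambda>s. lin_ext (\<lambda>t. g (s + t)) w) (v :: 'b::comm_monoid_add \<Rightarrow>\<^sub>0 'k::comm_ring_1)"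
proof (rule pm_additive_eq[of "\<lambda>v. lin_ext g (v * w)" "\<lambda>v. lin_ext (\<lambda>s. lin_ext (\<lambda>t. g (s + t)) w) v"])
  fix b :: 'b and c :: 'k
  have "lin_ext g (Poly_Mapping.single b c * w) = c * lin_ext (\<lambda>t. g (b + t)) w"
    by (rule pm_additive_eq) (auto simp: lin_ext_add distrib_left mult_single mult.assoc)
  then show "lin_ext g (Poly_Mapping.single b c * w) = lin_ext (\<lambda>s. lin_ext (\<lambda>t. g (s + t)) w) (Poly_Mapping.single b c)"
    by simp
qed (auto simp: lin_ext_add distrib_right)

lemma lin_ext_cong: "(\<And>b. b \<in> Poly_Mapping.keys v \<Longrightarrow> g b = h b) \<Longrightarrow> lin_ext g v = lin_ext h v"
  by (auto simp: lin_ext_def intro!: sum.cong)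

lemma lin_ext_cmult: "lin_ext (\<lambda>b. c * g b) v = c * lin_ext g v"
  by (simp add: lin_ext_def sum_distrib_left mult_ac)

section \<open>Moebius inversion\<close>

lemma finite_has_max_value:
  fixes m :: "'s \<Rightarrow> nat"
  assumes "finite S" "S \<noteq> {}"
  obtains M where "M \<in> S" "\<And>N. N \<in> S \<Longrightarrow> m N \<le> m M"
proof -
  have "Max (m ` S) \<in> m ` S" using assms by (intro Max_in) auto
  then obtain M where "M \<in> S" "m M = Max (m ` S)" by auto
  then show ?thesis using assms by (intro that[of M]) auto
qed

text \<open>The relation \<open>R\<close> is triangular with respect to the height \<open>m\<close>, so the values are determined by peeling off
elements of maximal height.\<close>

lemma moebius_inverse_exists:
  fixes g :: "'s \<Rightarrow> 'c::ab_group_add" and m :: "'s \<Rightarrow> nat"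
  assumes "finite \<F>" and refl: "\<And>N. R N N" and less: "\<And>G N. G \<in> \<F> \<Longrightarrow> N \<in> \<F> \<Longrightarrow> R G N \<Longrightarrow> G \<noteq> N \<Longrightarrow> m G < m N"
  shows "\<exists>\<xi>. \<forall>N\<in>\<F>. (\<Sum>G\<in>{G \<in> \<F>. R G N}. \<xi> G) = g N"
  using assms(1) less
proof (induction "card \<F>" arbitrary: \<F>)
  case 0
  then show ?case by auto
next
  case (Suc k)
  then have "\<F> \<noteq> {}" by auto
  obtain M where M: "M \<in> \<F>" "\<And>N. N \<in> \<F> \<Longrightarrow> m N \<le> m M"
    using finite_has_max_value[OF Suc.prems(1) \<open>\<F> \<noteq> {}\<close>, of m] by blast
  have "k = card (\<F> - {M})" using Suc.hyps(2) M by simp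
  then have "\<exists>\<xi>. \<forall>N\<in>\<F> - {M}. (\<Sum>G\<in>{G \<in> \<F> - {M}. R G N}. \<xi> G) = g N"
    by (rule Suc.hyps(1)) (simp_all add: Suc.prems)
  then obtain \<xi> where \<xi>: "\<forall>N\<in>\<F> - {M}. (\<Sum>G\<in>{G \<in> \<F> - {M}. R G N}. \<xi> G) = g N" by blast
  define \<xi>' where "\<xi>' = \<xi>(M := g M - (\<Sum>G\<in>{G \<in> \<F> - {M}. R G M}. \<xi> G))"
  have "(\<Sum>G\<in>{G \<in> \<F>. R G N}. \<xi>' G) = g N" if N: "N \<in> \<F>" for N
  proof (cases "N = M")
    case True
    have "{G \<in> \<F>. R G N} = insert M {G \<in> \<F> - {M}. R G M}"
      using True M(1) refl[of M] by blast
    moreover have "(\<Sum>G\<in>{G \<in> \<F> - {M}. R G M}. \<xi>' G) = (\<Sum>G\<in>{G \<in> \<F> - {M}. R G M}. \<xi> G)"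
      by (intro sum.cong) (auto simp: \<xi>'_def)
    ultimately show ?thesis using Suc.prems(1) True by (simp add: \<xi>'_def)
  next
    case False
    have "\<not> R M N" using Suc.prems(2)[OF M(1) N] M(2)[OF N] False by auto
    then have "{G \<in> \<F>. R G N} = {G \<in> \<F> - {M}. R G N}" by blast
    moreover have "(\<Sum>G\<in>{G \<in> \<F> - {M}. R G N}. \<xi>' G) = (\<Sum>G\<in>{G \<in> \<F> - {M}. R G N}. \<xi> G)"
      by (intro sum.cong) (auto simp: \<xi>'_def)
    ultimately show ?thesis using \<xi> N False by simp
  qed
  then show ?case by blast
qed

lemma moebius_inverse_unique:
  fixes \<xi> :: "'s \<Rightarrow> 'c::ab_group_add" and m :: "'s \<Rightarrow> nat"
  assumes fin: "finite \<F>" and refl: "\<And>N. R N N" and less: "\<And>G N. G \<in> \<F> \<Longrightarrow> N \<in> \<F> \<Longrightarrow> R G N \<Longrightarrow> G \<noteq> N \<Longrightarrow> m G < m N"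
    and eq: "\<And>N. N \<in> \<F> \<Longrightarrow> (\<Sum>G\<in>{G \<in> \<F>. R G N}. \<xi> G) = (\<Sum>G\<in>{G \<in> \<F>. R G N}. \<xi>' G)"
  shows "N \<in> \<F> \<Longrightarrow> \<xi> N = \<xi>' N"
proof (induction "m N" arbitrary: N rule: less_induct)
  case less': less
  have split: "{G \<in> \<F>. R G N} = insert N {G \<in> \<F>. R G N \<and> G \<noteq> N}" using less' refl by auto
  have "(\<Sum>G\<in>{G \<in> \<F>. R G N \<and> G \<noteq> N}. \<xi> G) = (\<Sum>G\<in>{G \<in> \<F>. R G N \<and> G \<noteq> N}. \<xi>' G)"
    using less less' by (intro sum.cong) auto
  then show ?case using eq[OF less'(2)] fin by (simp add: split)
qed

context finite_matroid begin

section \<open>Feichtner--Yuzvinsky multisets and their separating functionals\<close>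

text \<open>The exponents of the monomials in the basis of Feichtner and Yuzvinsky, in the version for the augmented
ring: a chain of nonempty flats in which the multiplicity of \<open>G\<close> stays below the rank gap to its
predecessor, or is at most \<open>rk G\<close> for the first flat, where the empty flat carries no variable.\<close>

definition fy :: "'a set multiset \<Rightarrow> bool" where
  "fy u \<longleftrightarrow> (\<forall>G\<in>#u. flat G \<and> G \<noteq> {}) \<and> (\<forall>F\<in>#u. \<forall>G\<in>#u. F \<subseteq> G \<or> G \<subseteq> F) \<and>
     (\<forall>G\<in>#u. count u G \<le> rk G \<and> (\<forall>F\<in>#u. F \<subset> G \<longrightarrow> count u G < rk G - rk F))"

definition deg :: "'a set \<Rightarrow> 'a set multiset \<Rightarrow> rat" where
  "deg T q = (if (\<forall>G\<in>#q. G \<subseteq> T) \<and> size q = rk T \<and> rado q then 1 else 0)"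

definition wt :: "'a set multiset \<Rightarrow> nat" where "wt q = (\<Sum>G\<in>#q. rk G)"

lemma wt_simps [simp]: "wt {#} = 0" "wt (add_mset G q) = rk G + wt q" "wt (p + q) = wt p + wt q"
  by (auto simp: wt_def)

lemma wt_replicate [simp]: "wt (replicate_mset m T) = m * rk T"
  by (induction m) auto

lemma wt_bound:
  assumes "\<forall>G\<in>#q. flat G \<and> G \<subseteq> T" "flat T"
  shows "q = replicate_mset (size q) T \<or> wt q < size q * rk T"
  using assms(1)
proof (induction q)
  case (add G q)
  then have G: "rk G \<le> rk T" "G = T \<or> rk G < rk T"
    using rk_flat_mono[of G T] flat_rk_less[of G T] assms(2) flat_sub by (auto simp: psubset_eq)
  have "q = replicate_mset (size q) T \<or> wt q < size q * rk T" using add by auto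
  then have "wt q \<le> size q * rk T" by (metis wt_replicate order.strict_implies_order order_refl)
  then show ?case using add G by (auto simp: less_le_trans add_less_le_mono add_le_less_mono)
qed simp

text \<open>As a function of \<open>G\<close>, the degree of \<open>add_mset G p\<close> is the indicator of \<open>G\<close> not lying below the maximal tight
flat of \<open>p\<close>; summation against the Moebius-type coefficients \<open>\<xi>\<close> turns it into the indicator of that flat
being \<open>F\<close>.\<close>

lemma moebius_deg:
  assumes T: "flat T" and F: "flat F" "F \<subset> T" and p: "\<forall>G\<in>#p. G \<subseteq> T" "Suc (size p) = rk T"
    and \<xi>: "\<And>N. flat N \<Longrightarrow> N \<subseteq> T \<Longrightarrow> (\<Sum>G\<in>{G \<in> {G \<in> flats E rk. G \<subseteq> T}. G \<subseteq> N}. \<xi> G) = (if N = F then - 1 else 0)"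
  shows "(\<Sum>G\<in>{G \<in> flats E rk. G \<subseteq> T}. \<xi> G * deg T (add_mset G p)) = (if rado p \<and> max_tight p = F then 1 else 0)"
proof (cases "rado p")
  case False
  then have "\<not> rado (add_mset G p)" for G using rado_add_mset by blast
  then show ?thesis using False by (simp add: deg_def)
next
  case True
  let ?N = "max_tight p"
  let ?L = "{G \<in> flats E rk. G \<subseteq> T}"
  have TE: "T \<subseteq> E" using T flat_sub by blast
  have "nbelow p ?N = nbelow p (?N \<inter> T)"
  proof -
    have "filter_mset (\<lambda>G. G \<subseteq> ?N) p = filter_mset (\<lambda>G. G \<subseteq> ?N \<inter> T) p"
      using p(1) by (intro filter_mset_cong) auto
    then show ?thesis by (simp add: nbelow_def)
  qed
  then have "rk ?N \<le> rk (?N \<inter> T)"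
    using radoD[OF True, of "?N \<inter> T"] TE nbelow_max_tight[OF True] by auto
  moreover have sub: "?N \<inter> T \<subseteq> E" using TE by auto
  ultimately have "cl (?N \<inter> T) = ?N"
    by (intro antisym cl_min flat_max_tight True)
      (auto intro: flat_eqI[symmetric, THEN equalityD1] simp: rk_cl dest: subsetD[OF max_tight_sub],
       metis IntD1 Int_lower1 cl_min cl_sub flat_cl flat_eqI flat_max_tight max_tight_sub rk_cl True)
  then have NT: "?N \<subseteq> T" using cl_min[of "?N \<inter> T" T] T by auto
  have "nbelow p T = size p" using p by (intro nbelow_all) auto
  then have "?N \<noteq> T" using nbelow_max_tight[OF True] p(2) by auto
  have fin: "finite ?L" using finite_flats by auto
  have "(\<Sum>G\<in>?L. \<xi> G * deg T (add_mset G p)) = (\<Sum>G\<in>?L. if G \<subseteq> ?N then 0 else \<xi> G)"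
    using p True by (intro sum.cong) (auto simp: deg_def rado_add_iff)
  also have "\<dots> = (\<Sum>G\<in>?L. \<xi> G) - (\<Sum>G\<in>{G\<in>?L. G \<subseteq> ?N}. \<xi> G)"
  proof -
    have "(\<Sum>G\<in>?L. if G \<subseteq> ?N then 0 else \<xi> G) = (\<Sum>G\<in>?L. \<xi> G - (if G \<subseteq> ?N then \<xi> G else 0))"
      by (intro sum.cong) auto
    then show ?thesis by (simp only: sum_subtractf sum.inter_filter[OF fin])
  qed
  also have "(\<Sum>G\<in>?L. \<xi> G) = 0"
  proof -
    have "{G\<in>?L. G \<subseteq> T} = ?L" by auto
    then show ?thesis using \<xi>[OF T] F by auto
  qed
  also have "(\<Sum>G\<in>{G\<in>?L. G \<subseteq> ?N}. \<xi> G) = (if ?N = F then - 1 else 0)"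
    by (rule \<xi>[OF flat_max_tight[OF True] NT])
  finally show ?thesis using True by simp
qed

lemma fy_filter: "fy u \<Longrightarrow> fy (filter_mset P u)"
  unfolding fy_def by auto

text \<open>The degree pairing is triangular on the Feichtner--Yuzvinsky monomials: for each \<open>u\<close> there is a
combination \<open>v\<close> of complementary degree that pairs nontrivially with \<open>u\<close> but, among the other multisets of
the same size, only with those of smaller weight.

The combination is built by induction along the chain of \<open>u\<close>. Let \<open>F\<close> be the largest member below \<open>T\<close>. The
combination for the part of \<open>u\<close> inside \<open>F\<close> is multiplied by a power of \<open>T\<close> that makes up the missing degree
and by the Moebius combination that enforces \<open>F\<close> as the maximal tight flat. The pairing then factors
into the pairing inside \<open>F\<close> and an indicator, and the weight of the part of a competitor outside \<open>F\<close> is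
largest when it consists of copies of \<open>T\<close> only.\<close>

lemma test_functional_exists:
  assumes "flat T" "fy u" "\<forall>G\<in>#u. G \<subseteq> T"
  shows "size u \<le> rk T \<and> (\<exists>v :: 'a set multiset \<Rightarrow>\<^sub>0 rat.
    (\<forall>s\<in>Poly_Mapping.keys v. size s + size u = rk T \<and> (\<forall>G\<in>#s. flat G \<and> G \<subseteq> T)) \<and>
    lin_ext (\<lambda>s. deg T (s + u)) v \<noteq> 0 \<and>
    (\<forall>q. (\<forall>G\<in>#q. flat G \<and> G \<subseteq> T) \<and> size q = size u \<and> lin_ext (\<lambda>s. deg T (s + q)) v \<noteq> 0 \<longrightarrow>
      q = u \<or> wt q < wt u))"
  using assms
proof (induction "rk T" arbitrary: T u rule: less_induct)
  case less
  define m where "m = count u T"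
  have TE: "T \<subseteq> E" using less.prems flat_sub by blast
  show ?case
  proof (cases "\<forall>G\<in>#u. G = T")
    case True
    have u: "u = replicate_mset m T"
    proof (rule multiset_eqI)
      fix x show "count u x = count (replicate_mset m T) x"
        using True by (cases "x = T") (auto simp: m_def count_eq_zero_iff)
    qed
    have m: "m \<le> rk T" using less.prems(2) u by (cases "m = 0") (auto simp: fy_def)
    define v :: "'a set multiset \<Rightarrow>\<^sub>0 rat" where "v = Poly_Mapping.single (replicate_mset (rk T - m) T) 1"
    have val: "lin_ext (\<lambda>s. deg T (s + q)) v = deg T (replicate_mset (rk T - m) T + q)" for q
      by (simp add: v_def)
    have "rado (replicate_mset (rk T) T)" using rk_mono by (auto simp: rado_def)
    moreover have "replicate_mset (rk T - m) T + u = replicate_mset (rk T) T"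
      unfolding u by (rule multiset_eqI) (use m in auto)
    ultimately have "lin_ext (\<lambda>s. deg T (s + u)) v \<noteq> 0" unfolding val by (simp add: deg_def)
    moreover have "q = u \<or> wt q < wt u" if "\<forall>G\<in>#q. flat G \<and> G \<subseteq> T" "size q = size u" for q
      using wt_bound[OF that(1) less.prems(1)] that(2) by (auto simp: u)
    ultimately show ?thesis using m less.prems(1)
      by (intro conjI exI[of _ v]) (auto simp: u v_def dest: in_replicate_mset[THEN iffD1])
  next
    case False
    define S where "S = {G. G \<in># u \<and> G \<noteq> T}"
    have S: "finite S" "S \<noteq> {}" using False by (auto simp: S_def)
    obtain F where F: "F \<in> S" "\<And>G. G \<in> S \<Longrightarrow> rk G \<le> rk F"
      using finite_has_max_value[OF S, of rk] by blast
    have uG: "flat G" "G \<noteq> {}" if "G \<in># u" for G using less.prems that by (auto simp: fy_def)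
    have Fu: "F \<in># u" "F \<noteq> T" "flat F" "F \<subset> T" "F \<subseteq> E"
      using F(1) uG less.prems flat_sub by (auto simp: S_def)
    have below: "G \<subseteq> F" if G: "G \<in> S" for G
    proof -
      have "G \<subseteq> F \<or> F \<subseteq> G" using G F(1) less.prems(2) by (auto simp: S_def fy_def)
      then show ?thesis using F(2)[OF G] flat_eqI[OF Fu(3), of G] G uG flat_sub by (auto simp: S_def)
    qed
    define uF where "uF = filter_mset (\<lambda>G. G \<subseteq> F) u"
    have notF: "filter_mset (\<lambda>G. \<not> G \<subseteq> F) u = replicate_mset m T"
    proof -
      have "filter_mset (\<lambda>G. \<not> G \<subseteq> F) u = filter_mset (\<lambda>G. G = T) u"
        using below Fu(4) by (intro filter_mset_cong) (auto simp: S_def)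
      then show ?thesis by (simp add: m_def filter_eq_replicate_mset)
    qed
    have u_split: "u = uF + replicate_mset m T"
      using multiset_partition[of u "\<lambda>G. G \<subseteq> F"] by (simp add: uF_def notF)
    have rFT: "rk F < rk T" using flat_rk_less Fu TE by blast
    have m: "m < rk T - rk F"
    proof (cases "m = 0")
      case False
      then have "T \<in># u" by (simp add: m_def count_eq_zero_iff)
      moreover have "\<forall>G\<in>#u. \<forall>F\<in>#u. F \<subset> G \<longrightarrow> count u G < rk G - rk F"
        using less.prems(2) by (simp add: fy_def)
      ultimately show ?thesis unfolding m_def using Fu(1,4) by simp
    qed (use rFT in simp)
    \<comment> \<open>One further factor is used by the Moebius combination; this is where the strict inequality on multiplicities is needed.\<close>
    define a where "a = rk T - rk F - 1 - m"
    have IH: "size uF \<le> rk F \<and> (\<exists>v :: 'a set multiset \<Rightarrow>\<^sub>0 rat.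
      (\<forall>s\<in>Poly_Mapping.keys v. size s + size uF = rk F \<and> (\<forall>G\<in>#s. flat G \<and> G \<subseteq> F)) \<and>
      lin_ext (\<lambda>s. deg F (s + uF)) v \<noteq> 0 \<and>
      (\<forall>q. (\<forall>G\<in>#q. flat G \<and> G \<subseteq> F) \<and> size q = size uF \<and> lin_ext (\<lambda>s. deg F (s + q)) v \<noteq> 0 \<longrightarrow>
        q = uF \<or> wt q < wt uF))"
      by (rule less.hyps[OF rFT Fu(3)]) (simp_all add: uF_def fy_filter less.prems(2))
    then obtain v :: "'a set multiset \<Rightarrow>\<^sub>0 rat" where
      v_keys': "\<forall>s\<in>Poly_Mapping.keys v. size s + size uF = rk F \<and> (\<forall>G\<in>#s. flat G \<and> G \<subseteq> F)"
      and v_u: "lin_ext (\<lambda>s. deg F (s + uF)) v \<noteq> 0"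
      and v_q': "\<forall>q. (\<forall>G\<in>#q. flat G \<and> G \<subseteq> F) \<and> size q = size uF \<and> lin_ext (\<lambda>s. deg F (s + q)) v \<noteq> 0 \<longrightarrow>
        q = uF \<or> wt q < wt uF" by (elim conjE exE)
    note v_keys = v_keys'[rule_format]
    have v_q: "q = uF \<or> wt q < wt uF" if "\<forall>G\<in>#q. flat G \<and> G \<subseteq> F" "size q = size uF" "lin_ext (\<lambda>s. deg F (s + q)) v \<noteq> 0" for q
      by (rule v_q'[rule_format], intro conjI that)
    let ?L = "{G \<in> flats E rk. G \<subseteq> T}"
    have finL: "finite ?L" using finite_flats by auto
    have "\<exists>\<xi> :: _ \<Rightarrow> rat. \<forall>N\<in>?L. (\<Sum>G\<in>{G \<in> ?L. G \<subseteq> N}. \<xi> G) = (if N = F then - 1 else 0)"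
      by (rule moebius_inverse_exists[OF finL, of "\<lambda>G N. G \<subseteq> N" card])
        (auto intro!: psubset_card_mono finite_sub dest: flat_sub)
    then obtain \<xi> :: "_ \<Rightarrow> rat" where \<xi>: "\<And>N. N \<in> ?L \<Longrightarrow> (\<Sum>G\<in>{G \<in> ?L. G \<subseteq> N}. \<xi> G) = (if N = F then - 1 else 0)"
      by blast
    define X where "X = (\<Sum>G\<in>?L. Poly_Mapping.single {#G#} (\<xi> G))"
    define w where "w = v * (Poly_Mapping.single (replicate_mset a T) 1 * X)"
    define \<epsilon> :: "'a set multiset \<Rightarrow> rat" where "\<epsilon> q = (if \<forall>K. flat K \<and> F \<subset> K \<longrightarrow>
        rk F + nbelow (replicate_mset a T + filter_mset (\<lambda>G. \<not> G \<subseteq> F) q) K < rk K then 1 else 0)" for q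
    have val: "lin_ext (\<lambda>s. deg T (s + q)) w = \<epsilon> q * lin_ext (\<lambda>s. deg F (s + filter_mset (\<lambda>G. G \<subseteq> F) q)) v"
      if q: "\<forall>G\<in>#q. flat G \<and> G \<subseteq> T" "size q = size u" for q
    proof -
      have "lin_ext (\<lambda>s. deg T (s + q)) w = lin_ext (\<lambda>s. \<Sum>G\<in>?L. \<xi> G * deg T (s + (replicate_mset a T + {#G#}) + q)) v"
        by (simp add: w_def lin_ext_mult X_def lin_ext_sum)
      also have "\<dots> = lin_ext (\<lambda>s. \<epsilon> q * deg F (s + filter_mset (\<lambda>G. G \<subseteq> F) q)) v"
      proof (rule lin_ext_cong)
        fix s assume s: "s \<in> Poly_Mapping.keys v"
        let ?p = "s + replicate_mset a T + q"
        have sF: "\<And>G. G \<in># s \<Longrightarrow> G \<subseteq> F" using v_keys[OF s] by auto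
        have pT: "\<forall>G\<in>#?p. G \<subseteq> T" using v_keys[OF s] q Fu(4) by auto
        have sz: "Suc (size ?p) = rk T"
        proof -
          have "size u = size uF + m" using arg_cong[OF u_split, of size] by simp
          then have "Suc (size s + a + size q) = rk T"
            using conjunct1[OF v_keys[OF s]] q(2) m unfolding a_def by arith
          then show ?thesis by simp
        qed
        have sF': "filter_mset (\<lambda>G. G \<subseteq> F) s = s" "filter_mset (\<lambda>G. \<not> G \<subseteq> F) s = {#}"
          using sF by (induction s) auto
        have aF: "filter_mset (\<lambda>G. G \<subseteq> F) (replicate_mset k T) = {#}"
          "filter_mset (\<lambda>G. \<not> G \<subseteq> F) (replicate_mset k T) = replicate_mset k T" for k
          using Fu(4) by (induction k) auto
        have "(\<Sum>G\<in>?L. \<xi> G * deg T (s + (replicate_mset a T + {#G#}) + q)) = (\<Sum>G\<in>?L. \<xi> G * deg T (add_mset G ?p))"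
          by (simp add: add_ac)
        also have "\<dots> = (if rado ?p \<and> max_tight ?p = F then 1 else 0)"
          by (rule moebius_deg[OF less.prems(1) Fu(3,4) pT sz]) (use \<xi> in auto)
        also have "\<dots> = \<epsilon> q * deg F (s + filter_mset (\<lambda>G. G \<subseteq> F) q)"
        proof -
          let ?qF = "filter_mset (\<lambda>G. G \<subseteq> F) q" and ?qT = "filter_mset (\<lambda>G. \<not> G \<subseteq> F) q"
          have ind: "(if A \<and> B \<and> C then 1 else 0) = (if C then 1 else 0) * (if A \<and> B then 1 else (0::rat))" for A B C
            by simp
          have "\<not> T \<subseteq> F" using Fu(4) by auto
          then have n: "nbelow ?p F = size s + size ?qF"
            using nbelow_all[of s F] sF by (simp add: nbelow_def[of q])
          have f: "filter_mset (\<lambda>G. G \<subseteq> F) ?p = s + ?qF"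
            "filter_mset (\<lambda>G. \<not> G \<subseteq> F) ?p = replicate_mset a T + ?qT"
            by (simp_all add: sF' aF)
          have d: "deg F (s + ?qF) = (if size s + size ?qF = rk F \<and> rado (s + ?qF) then 1 else 0)"
          proof -
            have all: "\<forall>G\<in>#s + ?qF. G \<subseteq> F"
            proof
              fix G assume "G \<in># s + ?qF"
              then have "G \<in># s \<or> G \<subseteq> F" by auto
              then show "G \<subseteq> F" using sF[of G] by blast
            qed
            show ?thesis by (simp only: deg_def size_union eqTrueI[OF all] simp_thms)
          qed
          show ?thesis
            unfolding max_tight_factor[OF Fu(3), of ?p] n f d \<epsilon>_def
            by (rule ind)
        qed
        finally show "(\<Sum>G\<in>?L. \<xi> G * deg T (s + (replicate_mset a T + {#G#}) + q)) = \<epsilon> q * deg F (s + filter_mset (\<lambda>G. G \<subseteq> F) q)" .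
      qed
      finally show ?thesis by (simp only: lin_ext_cmult)
    qed
    have w_keys: "size s + size u = rk T \<and> (\<forall>G\<in>#s. flat G \<and> G \<subseteq> T)" if s: "s \<in> Poly_Mapping.keys w" for s
    proof -
      obtain s1 s2 where s12: "s = s1 + s2" "s1 \<in> Poly_Mapping.keys v" "s2 \<in> Poly_Mapping.keys (Poly_Mapping.single (replicate_mset a T) 1 * X)"
        using s keys_mult[of v] unfolding w_def by blast
      obtain s3 where s3: "s2 = replicate_mset a T + s3" "s3 \<in> Poly_Mapping.keys X"
        using s12(3) keys_mult[of "Poly_Mapping.single (replicate_mset a T) (1::rat)" X] by (auto split: if_splits)
      obtain G where G: "s3 = {#G#}" "G \<in> ?L"
      proof -
        have "s3 \<in> (\<Union>G\<in>?L. Poly_Mapping.keys (Poly_Mapping.single {#G#} (\<xi> G)))"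
          by (rule subsetD[OF Poly_Mapping.keys_sum s3(2)[unfolded X_def]])
        then obtain G where G: "G \<in> ?L" "s3 \<in> Poly_Mapping.keys (Poly_Mapping.single {#G#} (\<xi> G))" by (elim UN_E)
        then have "s3 = {#G#}" by (simp split: if_splits)
        then show ?thesis using G(1) by (rule that)
      qed
      have "size u = size uF + m" using arg_cong[OF u_split, of size] by simp
      then have "size s + size u = rk T"
      proof -
        have "size s1 + (a + 1) + size u = rk T"
          using conjunct1[OF v_keys[OF s12(2)]] m \<open>size u = _\<close> unfolding a_def by arith
        then show ?thesis by (simp add: s12(1) s3(1) G(1))
      qed
      moreover have "flat H \<and> H \<subseteq> T" if "H \<in># s" for H
      proof -
        have "H \<in># s1 \<or> H = T \<or> H = G" using that by (auto simp: s12(1) s3(1) G(1) split: if_splits)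
        then show ?thesis using v_keys[OF s12(2)] Fu(4) G(2) less.prems(1) by auto
      qed
      ultimately show ?thesis by blast
    qed
    have "\<epsilon> u = 1"
    proof -
      have "rk F + nbelow (replicate_mset a T + replicate_mset m T) K < rk K" if K: "flat K" "F \<subset> K" for K
        using flat_rk_less[OF Fu(3) K(2)] flat_sub[OF K(1)] rk_mono[of T K] m by (auto simp: a_def)
      then show ?thesis unfolding \<epsilon>_def notF by simp
    qed
    then have w_u: "lin_ext (\<lambda>s. deg T (s + u)) w \<noteq> 0"
      using val[of u] less.prems(3) uG v_u by (simp add: uF_def)
    have w_q: "q = u \<or> wt q < wt u"
      if q: "\<forall>G\<in>#q. flat G \<and> G \<subseteq> T" "size q = size u" "lin_ext (\<lambda>s. deg T (s + q)) w \<noteq> 0" for q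
    proof -
      let ?qF = "filter_mset (\<lambda>G. G \<subseteq> F) q" and ?qT = "filter_mset (\<lambda>G. \<not> G \<subseteq> F) q"
      have ne: "lin_ext (\<lambda>s. deg F (s + ?qF)) v \<noteq> 0" using q val by auto
      have sz: "size ?qF = size uF"
      proof (rule ccontr)
        assume "size ?qF \<noteq> size uF"
        have "lin_ext (\<lambda>s. deg F (s + ?qF)) v = lin_ext (\<lambda>s. 0) v"
        proof (rule lin_ext_cong)
          fix s assume "s \<in> Poly_Mapping.keys v"
          then have "size s + size uF = rk F" using v_keys by blast
          then have "size (s + ?qF) \<noteq> rk F" using \<open>size ?qF \<noteq> size uF\<close> by (simp only: size_union)
          then show "deg F (s + ?qF) = 0" by (simp only: deg_def simp_thms if_False)
        qed
        then show False using ne by (simp add: lin_ext_def)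
      qed
      have 1: "?qF = uF \<or> wt ?qF < wt uF" by (rule v_q) (use q ne sz in auto)
      have q_split: "q = ?qF + ?qT" by (rule multiset_partition)
      have "size q = size ?qF + size ?qT" by (rule trans[OF arg_cong[OF q_split, of size] size_union])
      moreover have "size u = size uF + m"
        using trans[OF arg_cong[OF u_split, of size] size_union] by (simp only: size_replicate_mset)
      ultimately have sT: "size ?qT = m" using sz q(2) by linarith
      have "\<forall>G\<in>#?qT. flat G \<and> G \<subseteq> T" using q(1) by simp
      from wt_bound[OF this less.prems(1)] have 2: "?qT = replicate_mset m T \<or> wt ?qT < m * rk T"
        by (simp only: sT)
      have "wt q = wt ?qF + wt ?qT" by (rule trans[OF arg_cong[OF q_split, of wt] wt_simps(3)])
      moreover have "wt u = wt uF + m * rk T"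
        using trans[OF arg_cong[OF u_split, of wt] wt_simps(3)] by (simp only: wt_replicate)
      ultimately show ?thesis
      proof (cases "?qF = uF \<and> ?qT = replicate_mset m T")
        case True
        then have "q = uF + replicate_mset m T" using q_split by (simp only:)
        then show ?thesis using u_split by (simp only: simp_thms)
      next
        case False
        have "wt ?qT \<le> m * rk T" using 2 by (elim disjE) (simp_all only: wt_replicate less_imp_le order_refl)
        moreover have "wt ?qF \<le> wt uF" using 1 by (elim disjE) (simp_all only: less_imp_le order_refl)
        ultimately have "wt ?qF + wt ?qT < wt uF + m * rk T" using 1 2 False by linarith
        then show ?thesis using \<open>wt q = _\<close> \<open>wt u = _\<close> by simp
      qed
    qed
    have "size u = size uF + m"
      using trans[OF arg_cong[OF u_split, of size] size_union] by (simp only: size_replicate_mset)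
    then have "size u \<le> rk T" using conjunct1[OF IH] m by arith
    then show ?thesis
      by (intro conjI exI[of _ w] ballI allI impI) (assumption, use w_keys in blast, use w_keys in blast, use w_keys in blast,
          rule w_u, rule w_q, blast+)
  qed
qed

end

section \<open>The simplicial boundary and cones\<close>

definition pos_sign :: "'p::order \<Rightarrow> 'p set \<Rightarrow> complex" where
  "pos_sign x c = (- 1) ^ card {y \<in> c. y < x}"

lemma pos_sign_square: "pos_sign x c * pos_sign x c = 1"
  by (simp add: pos_sign_def power_add[symmetric] mult_2[symmetric])

lemma pos_sign_insert:
  assumes "finite c" "v \<notin> c"
  shows "pos_sign x (insert v c) = (if v < x then - pos_sign x c else pos_sign x c)"
proof -
  have "{y \<in> insert v c. y < x} = (if v < x then insert v {y \<in> c. y < x} else {y \<in> c. y < x})" by auto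
  then show ?thesis using assms by (simp add: pos_sign_def)
qed

lemma pos_sign_remove:
  assumes "finite c" "v \<in> c"
  shows "pos_sign x (c - {v}) = (if v < x then - pos_sign x c else pos_sign x c)"
  using pos_sign_insert[of "c - {v}" v x] assms by (simp add: insert_absorb split: if_splits)

lemma boundary_eq: "simplicial_boundary z = (\<Sum>c\<in>Poly_Mapping.keys z. \<Sum>x\<in>c.
     Poly_Mapping.single (c - {x}) (pos_sign x c * Poly_Mapping.lookup z c))"
  by (simp add: simplicial_boundary_def pos_sign_def)

lemma boundary_add: "simplicial_boundary (z + w) = simplicial_boundary z + simplicial_boundary w"
  unfolding boundary_eq
  by (rule setsum_keys_plus_distrib) (simp_all add: distrib_left single_add sum.distrib)

lemma boundary_single: "simplicial_boundary (Poly_Mapping.single c a) =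
    (\<Sum>x\<in>c. Poly_Mapping.single (c - {x}) (pos_sign x c * a))"
  by (simp add: boundary_eq)

lemma boundary_zero [simp]: "simplicial_boundary 0 = 0" by (simp add: boundary_eq)

lemma boundary_minus: "simplicial_boundary (- z) = - simplicial_boundary z"
  using boundary_add[of z "- z"] by (simp add: eq_neg_iff_add_eq_0 add.commute)

lemma boundary_diff: "simplicial_boundary (z - w) = simplicial_boundary z - simplicial_boundary w"
  using boundary_add[of z "- w"] by (simp add: boundary_minus)

lemma boundary_sum: "simplicial_boundary (sum h J) = (\<Sum>j\<in>J. simplicial_boundary (h j))"
  by (induction J rule: infinite_finite_induct) (simp_all add: boundary_add)

lemma pm_scale_sum: "pm_scale a (sum h J) = (\<Sum>j\<in>J. pm_scale a (h j))"
  by (induction J rule: infinite_finite_induct) (simp_all add: pm_scale_simps)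

lemma boundary_scale: "simplicial_boundary (pm_scale a z) = pm_scale a (simplicial_boundary z)"
proof (rule pm_additive_eq[of "\<lambda>z. simplicial_boundary (pm_scale a z)" "\<lambda>z. pm_scale a (simplicial_boundary z)"])
  fix c b
  show "simplicial_boundary (pm_scale a (Poly_Mapping.single c b)) = pm_scale a (simplicial_boundary (Poly_Mapping.single c b))"
    by (simp only: pm_scale_simps boundary_single pm_scale_sum mult.left_commute)
qed (simp_all only: boundary_add pm_scale_simps)

lemma keys_boundary: "c' \<in> Poly_Mapping.keys (simplicial_boundary z) \<Longrightarrow>
    \<exists>c\<in>Poly_Mapping.keys z. \<exists>x\<in>c. c' = c - {x}"
proof -
  assume "c' \<in> Poly_Mapping.keys (simplicial_boundary z)"
  then have "c' \<in> (\<Union>c\<in>Poly_Mapping.keys z. Poly_Mapping.keys (\<Sum>x\<in>c. Poly_Mapping.single (c - {x}) (pos_sign x c * Poly_Mapping.lookup z c)))"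
    unfolding boundary_eq by (rule subsetD[OF Poly_Mapping.keys_sum])
  then obtain c where c: "c \<in> Poly_Mapping.keys z"
    "c' \<in> Poly_Mapping.keys (\<Sum>x\<in>c. Poly_Mapping.single (c - {x}) (pos_sign x c * Poly_Mapping.lookup z c))" by (elim UN_E)
  have "c' \<in> (\<Union>x\<in>c. Poly_Mapping.keys (Poly_Mapping.single (c - {x}) (pos_sign x c * Poly_Mapping.lookup z c)))"
    by (rule subsetD[OF Poly_Mapping.keys_sum c(2)])
  then obtain x where "x \<in> c" "c' \<in> Poly_Mapping.keys (Poly_Mapping.single (c - {x}) (pos_sign x c * Poly_Mapping.lookup z c))" by (elim UN_E)
  then show ?thesis using c(1) by (intro bexI[of _ c] bexI[of _ x]) (simp_all split: if_splits)
qed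

definition pchain :: "'p::order set \<Rightarrow> bool" where
  "pchain c \<longleftrightarrow> finite c \<and> (\<forall>x\<in>c. \<forall>y\<in>c. x \<le> y \<or> y \<le> x)"

lemma pchain_subset: "pchain c \<Longrightarrow> c' \<subseteq> c \<Longrightarrow> pchain c'"
  unfolding pchain_def using finite_subset by blast

lemma pchain_cases: "pchain c \<Longrightarrow> x \<in> c \<Longrightarrow> y \<in> c \<Longrightarrow> x \<noteq> y \<Longrightarrow> (x < y \<and> \<not> y < x) \<or> (y < x \<and> \<not> x < y)"
  unfolding pchain_def order.strict_iff_order using order.antisym[of x y] by blast

lemma boundary_boundary_single:
  fixes c :: "'p::order set"
  assumes c: "pchain c"
  shows "simplicial_boundary (simplicial_boundary (Poly_Mapping.single c a)) = 0"
proof -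
  have fin: "finite c" using c by (simp add: pchain_def)
  define t :: "'p \<Rightarrow> 'p \<Rightarrow> 'p set \<Rightarrow>\<^sub>0 complex"
    where "t x y = Poly_Mapping.single (c - {x} - {y}) (pos_sign y (c - {x}) * (pos_sign x c * a))" for x y
  have eq: "simplicial_boundary (simplicial_boundary (Poly_Mapping.single c a)) = (\<Sum>x\<in>c. \<Sum>y\<in>c - {x}. t x y)"
    by (simp add: boundary_single boundary_sum t_def)
  have anti: "t x y = - t y x" if "x \<in> c" "y \<in> c" "x \<noteq> y" for x y
  proof -
    have set: "c - {x} - {y} = c - {y} - {x}" by blast
    have "pos_sign y (c - {x}) * (pos_sign x c * a) = - (pos_sign x (c - {y}) * (pos_sign y c * a))"
      using pchain_cases[OF c that] by (auto simp: pos_sign_remove[OF fin that(1)] pos_sign_remove[OF fin that(2)])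
    then show ?thesis unfolding t_def set by (simp add: single_uminus)
  qed
  have inner: "(\<Sum>y\<in>c - {x}. f x y) = (\<Sum>y\<in>c. if x = y then 0 else f x y)" for f :: "'p \<Rightarrow> 'p \<Rightarrow> 'p set \<Rightarrow>\<^sub>0 complex" and x
    by (rule sum.mono_neutral_cong_left) (use fin in auto)
  have "(\<Sum>x\<in>c. \<Sum>y\<in>c - {x}. t x y) = (\<Sum>x\<in>c. \<Sum>y\<in>c. if x = y then 0 else t x y)"
    by (simp only: inner)
  also have "\<dots> = (\<Sum>x\<in>c. \<Sum>y\<in>c. - (if y = x then 0 else t y x))"
  proof (intro sum.cong refl)
    fix x y assume x: "x \<in> c" and y: "y \<in> c"
    show "(if x = y then 0 else t x y) = - (if y = x then 0 else t y x)"
    proof (cases "x = y")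
      case False
      then have ne: "y \<noteq> x" by blast
      show ?thesis unfolding if_not_P[OF False] if_not_P[OF ne] by (rule anti[OF x y False])
    qed simp
  qed
  also have "\<dots> = - (\<Sum>x\<in>c. \<Sum>y\<in>c. if y = x then 0 else t y x)" by (simp only: sum_negf)
  also have "(\<Sum>x\<in>c. \<Sum>y\<in>c. if y = x then 0 else t y x) = (\<Sum>y\<in>c. \<Sum>x\<in>c. if y = x then 0 else t y x)"
    by (rule sum.swap)
  also have "\<dots> = (\<Sum>x\<in>c. \<Sum>y\<in>c - {x}. t x y)" by (simp only: inner)
  finally have neg: "(\<Sum>x\<in>c. \<Sum>y\<in>c - {x}. t x y) = - (\<Sum>x\<in>c. \<Sum>y\<in>c - {x}. t x y)" .
  have "s = 0" if "s = - s" for s :: "'p set \<Rightarrow>\<^sub>0 complex"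
  proof (rule poly_mapping_eqI)
    fix k
    have "Poly_Mapping.lookup s k = - Poly_Mapping.lookup s k" using arg_cong[OF that, of "\<lambda>s. Poly_Mapping.lookup s k"] by simp
    then show "Poly_Mapping.lookup s k = Poly_Mapping.lookup 0 k" by simp
  qed
  then show ?thesis using neg eq by simp
qed

lemma boundary_boundary:
  assumes "\<And>c. c \<in> Poly_Mapping.keys z \<Longrightarrow> pchain c"
  shows "simplicial_boundary (simplicial_boundary z) = 0"
  by (rule pm_additive_eq[of "\<lambda>z. simplicial_boundary (simplicial_boundary z)" "\<lambda>z. 0"])
    (simp_all add: boundary_add boundary_boundary_single assms)

definition cone :: "'p::order \<Rightarrow> ('p set \<Rightarrow>\<^sub>0 complex) \<Rightarrow> ('p set \<Rightarrow>\<^sub>0 complex)" where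
  "cone v z = (\<Sum>c\<in>Poly_Mapping.keys z. if v \<in> c then 0 else
     Poly_Mapping.single (insert v c) (pos_sign v c * Poly_Mapping.lookup z c))"

lemma cone_add: "cone v (z + w) = cone v z + cone v w"
  unfolding cone_def by (rule setsum_keys_plus_distrib) (simp_all add: distrib_left single_add)

lemma cone_zero [simp]: "cone v 0 = 0" by (simp add: cone_def)

lemma cone_single: "cone v (Poly_Mapping.single c a) = (if v \<in> c then 0 else Poly_Mapping.single (insert v c) (pos_sign v c * a))"
  by (simp add: cone_def)

lemma cone_sum: "cone v (sum h J) = (\<Sum>j\<in>J. cone v (h j))"
  by (induction J rule: infinite_finite_induct) (simp_all add: cone_add)

lemma keys_cone: "c' \<in> Poly_Mapping.keys (cone v z) \<Longrightarrow> \<exists>c\<in>Poly_Mapping.keys z. v \<notin> c \<and> c' = insert v c"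
proof -
  assume "c' \<in> Poly_Mapping.keys (cone v z)"
  then have "c' \<in> (\<Union>c\<in>Poly_Mapping.keys z. Poly_Mapping.keys (if v \<in> c then 0 else
     Poly_Mapping.single (insert v c) (pos_sign v c * Poly_Mapping.lookup z c)))"
    unfolding cone_def by (rule subsetD[OF Poly_Mapping.keys_sum])
  then obtain c where c: "c \<in> Poly_Mapping.keys z"
    "c' \<in> Poly_Mapping.keys (if v \<in> c then 0 else Poly_Mapping.single (insert v c) (pos_sign v c * Poly_Mapping.lookup z c))" by (elim UN_E)
  then show ?thesis by (intro bexI[of _ c]) (simp_all split: if_splits)
qed

lemma cone_homotopy_single:
  fixes c :: "'p::order set"
  assumes c: "pchain (insert v c)"
  shows "simplicial_boundary (cone v (Poly_Mapping.single c a)) + cone v (simplicial_boundary (Poly_Mapping.single c a)) = Poly_Mapping.single c a"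
proof (cases "v \<in> c")
  case True
  have fin: "finite c" using c by (simp add: pchain_def)
  have "cone v (simplicial_boundary (Poly_Mapping.single c a)) = (\<Sum>x\<in>c. cone v (Poly_Mapping.single (c - {x}) (pos_sign x c * a)))"
    by (simp only: boundary_single cone_sum)
  also have "\<dots> = (\<Sum>x\<in>c. if x = v then Poly_Mapping.single c a else 0)"
  proof (rule sum.cong[OF refl])
    fix x assume x: "x \<in> c"
    show "cone v (Poly_Mapping.single (c - {x}) (pos_sign x c * a)) = (if x = v then Poly_Mapping.single c a else 0)"
    proof (cases "x = v")
      case True
      have sq: "pos_sign v c * (pos_sign v c * a) = a" by (simp only: mult.assoc[symmetric] pos_sign_square mult_1_left)
      show ?thesis using True x by (simp add: cone_single pos_sign_remove[OF fin] insert_absorb sq)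
    qed (simp add: cone_single True)
  qed
  also have "\<dots> = Poly_Mapping.single c a" using True fin by simp
  finally show ?thesis using True by (simp add: cone_single)
next
  case False
  have fin: "finite c" using c by (simp add: pchain_def)
  have "simplicial_boundary (cone v (Poly_Mapping.single c a)) =
    (\<Sum>x\<in>insert v c. Poly_Mapping.single (insert v c - {x}) (pos_sign x (insert v c) * (pos_sign v c * a)))"
    using False by (simp only: cone_single boundary_single if_False)
  also have "\<dots> = Poly_Mapping.single c (pos_sign v (insert v c) * (pos_sign v c * a)) +
      (\<Sum>x\<in>c. Poly_Mapping.single (insert v c - {x}) (pos_sign x (insert v c) * (pos_sign v c * a)))"
    using fin False by (simp add: sum.insert)
  also have "pos_sign v (insert v c) * (pos_sign v c * a) = a"
    using pos_sign_insert[OF fin False, of v] by (simp only: less_irrefl if_False mult.assoc[symmetric] pos_sign_square mult_1_left)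
  finally have 1: "simplicial_boundary (cone v (Poly_Mapping.single c a)) = Poly_Mapping.single c a +
      (\<Sum>x\<in>c. Poly_Mapping.single (insert v c - {x}) (pos_sign x (insert v c) * (pos_sign v c * a)))" .
  have "cone v (simplicial_boundary (Poly_Mapping.single c a)) = (\<Sum>x\<in>c. cone v (Poly_Mapping.single (c - {x}) (pos_sign x c * a)))"
    by (simp only: boundary_single cone_sum)
  also have "\<dots> = (\<Sum>x\<in>c. - Poly_Mapping.single (insert v c - {x}) (pos_sign x (insert v c) * (pos_sign v c * a)))"
  proof (rule sum.cong[OF refl])
    fix x assume x: "x \<in> c"
    then have ne: "x \<noteq> v" using False by auto
    have set: "insert v (c - {x}) = insert v c - {x}" using ne by auto
    have "pos_sign v (c - {x}) * (pos_sign x c * a) = - (pos_sign x (insert v c) * (pos_sign v c * a))"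
      using pchain_cases[OF c, of x v] x ne
      by (auto simp: pos_sign_remove[OF fin x] pos_sign_insert[OF fin False])
    then show "cone v (Poly_Mapping.single (c - {x}) (pos_sign x c * a)) = - Poly_Mapping.single (insert v c - {x}) (pos_sign x (insert v c) * (pos_sign v c * a))"
      using False by (simp add: cone_single set single_uminus)
  qed
  finally show ?thesis unfolding 1 by (simp add: sum_negf)
qed

text \<open>Joining a vertex is a contracting homotopy: the faces that contain the vertex arise once from the boundary
of the cone and once from the cone over the boundary, with opposite signs.\<close>

lemma cone_homotopy:
  assumes "\<And>c. c \<in> Poly_Mapping.keys z \<Longrightarrow> pchain (insert v c)"
  shows "simplicial_boundary (cone v z) + cone v (simplicial_boundary z) = z"
  by (rule pm_additive_eq[of "\<lambda>z. simplicial_boundary (cone v z) + cone v (simplicial_boundary z)" "\<lambda>z. z"])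
    (simp_all add: boundary_add cone_add cone_homotopy_single assms add_ac)

section \<open>Acyclicity of partitioned complexes\<close>

text \<open>The homological content of a shelling. The complex is partitioned into the intervals from \<open>R f\<close> to \<open>f\<close>, one
for each facet \<open>f = top c\<close>, and \<open>\<nu>\<close> orders the facets so that passing to a subface never moves to a later
interval. A cycle of less than top dimension is pushed towards earlier intervals. Coning its part in the
last interval that it meets with a vertex \<open>v\<close> of \<open>f\<close> outside \<open>R f\<close> changes the cycle by a boundary and replaces
that part by the cone over its boundary. The faces of this boundary also bound the earlier parts of the
cycle, so they miss a vertex of \<open>R f\<close>, and so do their joins with \<open>v\<close>.\<close>

lemma partitioned_complex_acyclic:
  fixes \<Delta> :: "'p::order set set" and top :: "'p set \<Rightarrow> 'p set" and R :: "'p set \<Rightarrow> 'p set" and \<nu> :: "'p set \<Rightarrow> nat"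
  assumes chain: "\<And>c. c \<in> \<Delta> \<Longrightarrow> pchain c"
    and down: "\<And>c c'. c \<in> \<Delta> \<Longrightarrow> c' \<subseteq> c \<Longrightarrow> c' \<in> \<Delta>"
    and top: "\<And>c. c \<in> \<Delta> \<Longrightarrow> top c \<in> \<Delta>" "\<And>c. c \<in> \<Delta> \<Longrightarrow> c \<subseteq> top c" "\<And>c. c \<in> \<Delta> \<Longrightarrow> card (top c) = K"
    and R: "\<And>c c'. c \<in> \<Delta> \<Longrightarrow> c' \<subseteq> top c \<Longrightarrow> top c' = top c \<longleftrightarrow> R (top c) \<subseteq> c'"
    and \<nu>_mono: "\<And>c c'. c \<in> \<Delta> \<Longrightarrow> c' \<subseteq> c \<Longrightarrow> \<nu> (top c') \<le> \<nu> (top c)"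
    and \<nu>_inj: "\<And>c c'. c \<in> \<Delta> \<Longrightarrow> c' \<in> \<Delta> \<Longrightarrow> \<nu> (top c) = \<nu> (top c') \<Longrightarrow> top c = top c'"
    and k: "k < K"
    and z: "\<And>c. c \<in> Poly_Mapping.keys z \<Longrightarrow> c \<in> \<Delta>" "\<And>c. c \<in> Poly_Mapping.keys z \<Longrightarrow> card c = k"
    and cycle: "simplicial_boundary z = 0"
  shows "\<exists>w. (\<forall>c\<in>Poly_Mapping.keys w. c \<in> \<Delta> \<and> card c = Suc k) \<and> simplicial_boundary w = z"
proof -
  have main: "\<exists>w. (\<forall>c\<in>Poly_Mapping.keys w. c \<in> \<Delta> \<and> card c = Suc k) \<and> simplicial_boundary w = z"
    if "\<And>c. c \<in> Poly_Mapping.keys z \<Longrightarrow> c \<in> \<Delta>" "\<And>c. c \<in> Poly_Mapping.keys z \<Longrightarrow> card c = k"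
      "simplicial_boundary z = 0" "\<And>c. c \<in> Poly_Mapping.keys z \<Longrightarrow> \<nu> (top c) < N" for N z
    using that
  proof (induction N arbitrary: z)
    case 0
    then have "z = 0" by (metis all_not_in_conv keys_eq_empty not_less_zero)
    then show ?case by (intro exI[of _ 0]) simp
  next
    case (Suc N)
    define z1 where "z1 = (\<Sum>c\<in>{c \<in> Poly_Mapping.keys z. \<nu> (top c) = N}. Poly_Mapping.single c (Poly_Mapping.lookup z c))"
    define z0 where "z0 = z - z1"
    have l1: "Poly_Mapping.lookup z1 c = (if \<nu> (top c) = N then Poly_Mapping.lookup z c else 0)" for c
      by (simp add: z1_def lookup_sum lookup_single when_def in_keys_iff)
    have k1: "c \<in> Poly_Mapping.keys z1 \<longleftrightarrow> c \<in> Poly_Mapping.keys z \<and> \<nu> (top c) = N" for c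
      by (simp add: in_keys_iff l1)
    have k0: "c \<in> Poly_Mapping.keys z0 \<longleftrightarrow> c \<in> Poly_Mapping.keys z \<and> \<nu> (top c) \<noteq> N" for c
      by (simp add: in_keys_iff z0_def lookup_minus l1)
    show ?case
    proof (cases "Poly_Mapping.keys z1 = {}")
      case True
      have "\<nu> (top c) < N" if "c \<in> Poly_Mapping.keys z" for c
      proof -
        have "\<nu> (top c) \<noteq> N" using True k1[of c] that by blast
        then show ?thesis using Suc.prems(4)[OF that] by simp
      qed
      then show ?thesis using Suc.IH Suc.prems(1-3) by blast
    next
      case False
      then obtain c0 where c0: "c0 \<in> Poly_Mapping.keys z" "\<nu> (top c0) = N" using k1 by blast
      have c0': "c0 \<in> \<Delta>" "card c0 = k" using Suc.prems(1,2)[OF c0(1)] by simp_all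
      let ?f = "top c0"
      have f: "?f \<in> \<Delta>" "c0 \<subseteq> ?f" "card ?f = K" by (rule top(1)[OF c0'(1)], rule top(2)[OF c0'(1)], rule top(3)[OF c0'(1)])
      have Rc0: "R ?f \<subseteq> c0" using R[OF c0'(1) f(2)] by simp
      have topf: "top ?f = ?f" using R[OF c0'(1) order_refl] Rc0 f(2) by blast
      have "c0 \<noteq> ?f" using c0'(2) f(3) k by auto
      \<comment> \<open>A face with fewer vertices than the facet leaves out a vertex, and by the interval structure that vertex lies outside the restriction.\<close>
      then obtain v where v: "v \<in> ?f" "v \<notin> c0" using f(2) by blast
      have vR: "v \<notin> R ?f" using v(2) Rc0 by blast
      have new: "c \<in> \<Delta>" "card c = k" "top c = ?f" "c \<subseteq> ?f" if "c \<in> Poly_Mapping.keys z1" for c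
      proof -
        have c: "c \<in> Poly_Mapping.keys z" "\<nu> (top c) = N" using that k1 by simp_all
        show "c \<in> \<Delta>" "card c = k" using Suc.prems(1,2)[OF c(1)] by simp_all
        then show "top c = ?f" using \<nu>_inj[OF _ c0'(1)] c(2) c0(2) by simp
        then show "c \<subseteq> ?f" using top(2)[OF \<open>c \<in> \<Delta>\<close>] by simp
      qed
      have fin: "finite c" if "c \<in> \<Delta>" for c using chain[OF that] by (simp add: pchain_def)
      define w1 where "w1 = cone v z1"
      have w1: "c \<in> \<Delta> \<and> card c = Suc k" if c: "c \<in> Poly_Mapping.keys w1" for c
      proof -
        obtain c' where c': "c' \<in> Poly_Mapping.keys z1" "v \<notin> c'" "c = insert v c'"
          using keys_cone c unfolding w1_def by blast
        have "c \<in> \<Delta>" by (rule down[OF f(1)]) (use c'(3) new(4)[OF c'(1)] v(1) in blast)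
        moreover have "card c = Suc k" using c'(2,3) new(1,2)[OF c'(1)] fin by simp
        ultimately show ?thesis by simp
      qed
      define z' where "z' = z0 + cone v (simplicial_boundary z1)"
      have hom: "simplicial_boundary w1 + cone v (simplicial_boundary z1) = z1" unfolding w1_def
      proof (rule cone_homotopy)
        fix c assume c: "c \<in> Poly_Mapping.keys z1"
        show "pchain (insert v c)" by (rule pchain_subset[OF chain[OF f(1)]]) (use new(4)[OF c] v(1) in blast)
      qed
      have z': "z = z' + simplicial_boundary w1" 
      proof -
        have "z = z0 + z1" by (simp add: z0_def)
        then show ?thesis unfolding z'_def using hom by (metis add.assoc add.commute)
      qed
      have z'keys: "c \<in> \<Delta> \<and> card c = k \<and> \<nu> (top c) < N" if c: "c \<in> Poly_Mapping.keys z'" for c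
      proof -
        have "c \<in> Poly_Mapping.keys z0 \<or> c \<in> Poly_Mapping.keys (cone v (simplicial_boundary z1))"
          using subsetD[OF Poly_Mapping.keys_add c[unfolded z'_def]] by blast
        then show ?thesis
        proof
          assume "c \<in> Poly_Mapping.keys z0"
          then have "c \<in> Poly_Mapping.keys z" "\<nu> (top c) \<noteq> N" using k0 by simp_all
          then show ?thesis using Suc.prems(1,2,4)[of c] by simp
        next
          assume "c \<in> Poly_Mapping.keys (cone v (simplicial_boundary z1))"
          then obtain c' where c': "c' \<in> Poly_Mapping.keys (simplicial_boundary z1)" "v \<notin> c'" "c = insert v c'"
            using keys_cone by blast
          obtain d x where d: "d \<in> Poly_Mapping.keys z1" "x \<in> d" "c' = d - {x}" using keys_boundary[OF c'(1)] by blast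
          \<comment> \<open>A face of the boundary of the last part also bounds an earlier part, hence lies in an earlier interval.\<close>
          have "simplicial_boundary z1 = - simplicial_boundary z0"
            using Suc.prems(3) by (simp add: z0_def boundary_diff)
          then have "c' \<in> Poly_Mapping.keys (simplicial_boundary z0)" using c'(1) by simp
          then obtain d0 x0 where d0: "d0 \<in> Poly_Mapping.keys z0" "x0 \<in> d0" "c' = d0 - {x0}" using keys_boundary by blast
          have d0z: "d0 \<in> Poly_Mapping.keys z" "\<nu> (top d0) \<noteq> N" using d0(1) k0 by simp_all
          then have "\<nu> (top d0) < N" using Suc.prems(4)[of d0] by simp
          moreover have "\<nu> (top c') \<le> \<nu> (top d0)" by (rule \<nu>_mono[OF Suc.prems(1)[OF d0z(1)]]) (use d0(3) in blast)
          ultimately have "top c' \<noteq> ?f" using c0(2) by auto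
          have c'f: "c' \<subseteq> ?f" using new(4)[OF d(1)] d(3) by blast
          have cf: "c \<subseteq> ?f" using c'f c'(3) v(1) by blast
          have "\<not> R ?f \<subseteq> c'" using R[OF c0'(1) c'f] \<open>top c' \<noteq> ?f\<close> by simp
          then have "\<not> R ?f \<subseteq> c" using vR c'(3) by blast
          then have ne: "top c \<noteq> ?f" using R[OF c0'(1) cf] by simp
          have c\<Delta>: "c \<in> \<Delta>" by (rule down[OF f(1) cf])
          have "\<nu> (top c) \<le> \<nu> (top ?f)" by (rule \<nu>_mono[OF f(1) cf])
          moreover have "\<nu> (top c) \<noteq> \<nu> (top ?f)" using \<nu>_inj[OF c\<Delta> f(1)] ne topf by auto
          ultimately have "\<nu> (top c) < N" using topf c0(2) by simp
          moreover have "card c = k"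
            using c'(2,3) d(2,3) new(1,2)[OF d(1)] fin[OF new(1)[OF d(1)]] by (simp add: card.insert_remove)
              (metis card_gt_0_iff Suc_pred equals0D)
          ultimately show ?thesis using c\<Delta> by simp
        qed
      qed
      have "simplicial_boundary z' = simplicial_boundary z - simplicial_boundary (simplicial_boundary w1)"
        by (subst z') (simp add: boundary_add)
      also have "simplicial_boundary (simplicial_boundary w1) = 0"
        by (rule boundary_boundary) (use w1 chain in blast)
      finally have "simplicial_boundary z' = 0" using Suc.prems(3) by simp
      then obtain w2 where w2: "\<forall>c\<in>Poly_Mapping.keys w2. c \<in> \<Delta> \<and> card c = Suc k" "simplicial_boundary w2 = z'"
        using Suc.IH[of z'] z'keys by blast
      have "\<forall>c\<in>Poly_Mapping.keys (w1 + w2). c \<in> \<Delta> \<and> card c = Suc k"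
        using w1 w2(1) Poly_Mapping.keys_add[of w1 w2] by blast
      moreover have "simplicial_boundary (w1 + w2) = z" using w2(2) by (subst z') (simp add: boundary_add add.commute)
      ultimately show ?thesis by blast
    qed
  qed
  have bound: "\<nu> (top c) < Suc (Max ((\<lambda>c. \<nu> (top c)) ` Poly_Mapping.keys z))" if "c \<in> Poly_Mapping.keys z" for c
    using that by (simp add: less_Suc_eq_le)
  show ?thesis by (rule main[OF z cycle bound])
qed

section \<open>Traces of subspaces\<close>

interpretation pm: vector_space "pm_scale :: 'k::field \<Rightarrow> ('b \<Rightarrow>\<^sub>0 'k) \<Rightarrow> ('b \<Rightarrow>\<^sub>0 'k)"
  by unfold_locales (simp_all only: pm_scale_simps)

definition sub_vs :: "('b \<Rightarrow>\<^sub>0 'k::field) set \<Rightarrow> ('k, 'b \<Rightarrow>\<^sub>0 'k) module" where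
  "sub_vs U = (free_vs UNIV)\<lparr>carrier := U\<rparr>"

definition sub_trace :: "('b \<Rightarrow>\<^sub>0 'k::field) set \<Rightarrow> (('b \<Rightarrow>\<^sub>0 'k) \<Rightarrow> ('b \<Rightarrow>\<^sub>0 'k)) \<Rightarrow> 'k" where
  "sub_trace U f = lin_trace (quot_vs (sub_vs U) {0}) ((`) f)"

lemma carrier_sub_vs [simp]: "carrier (sub_vs U) = U" by (simp add: sub_vs_def)

lemma subspace_record_sub_vs: "pm.subspace U \<Longrightarrow> subspace_record (sub_vs U)"
  by (rule subspace_record.intro) (simp_all add: sub_vs_def free_vs_def pm.subspace_0 pm.subspace_add pm.subspace_scale)

lemma coordinates_of_basis:
  fixes B :: "('b \<Rightarrow>\<^sub>0 'k::field) set"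
  assumes "finite B" "pm.independent B"
  shows "quotient_coordinates (sub_vs (pm.span B)) {0} B (\<lambda>b. b) (pm.representation B)"
proof (intro quotient_coordinates.intro quotient_coordinates_axioms.intro)
  show "subspace_record (sub_vs (pm.span B))" by (rule subspace_record_sub_vs[OF pm.subspace_span])
  show "{0} = {x \<in> carrier (sub_vs (pm.span B)). \<forall>i\<in>B. pm.representation B x i = 0}"
  proof (intro equalityI subsetI)
    fix x assume x: "x \<in> {x \<in> carrier (sub_vs (pm.span B)). \<forall>i\<in>B. pm.representation B x i = 0}"
    then have "(\<Sum>b\<in>B. pm_scale (pm.representation B x b) b) = x"
      using assms by (intro pm.sum_representation_eq) simp_all
    moreover have "(\<Sum>b\<in>B. pm_scale (pm.representation B x b) b) = 0"
      using x by (intro sum.neutral) (simp add: pm_scale_simps)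
    ultimately show "x \<in> {0}" by simp
  qed (simp add: pm.representation_zero pm.span_zero)
  fix i j assume "i \<in> B" "j \<in> B"
  then show "pm.representation B j i = (if i = j then 1 else 0)" using assms by (simp add: pm.representation_basis)
qed (simp_all add: assms pm.span_base pm.representation_add pm.representation_scale)

locale linear_map_pm =
  fixes f :: "('b \<Rightarrow>\<^sub>0 'k::field) \<Rightarrow> ('b \<Rightarrow>\<^sub>0 'k)"
  assumes add: "f (x + y) = f x + f y" and scale: "f (pm_scale c x) = pm_scale c (f x)"
begin

lemma linear: "Vector_Spaces.linear pm_scale pm_scale f"
  by unfold_locales (simp_all only: pm_scale_simps add scale)

lemma zero: "f 0 = 0" using scale[of 0 0] by (simp add: pm_scale_simps)

end

lemma sub_trace_eq:
  assumes qc: "quotient_coordinates (sub_vs U) {0} I u \<phi>" and "linear_map_pm f" "\<And>x. x \<in> U \<Longrightarrow> f x \<in> U"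
  shows "sub_trace U f = (\<Sum>i\<in>I. \<phi> (f (u i)) i)"
  unfolding sub_trace_def
  by (rule quotient_coordinates.lin_trace_quotient[OF qc])
    (use assms(3) in \<open>simp_all add: linear_map_pm.add[OF assms(2)] linear_map_pm.scale[OF assms(2)] linear_map_pm.zero[OF assms(2)]\<close>)

text \<open>A basis of the kernel of \<open>d\<close> is extended by preimages of a basis of its image. In this basis the matrix of
\<open>f\<close> is block triangular, with the two restrictions of \<open>f\<close> as diagonal blocks.\<close>

lemma sub_trace_kernel_image:
  fixes f d :: "('b \<Rightarrow>\<^sub>0 'k::field) \<Rightarrow> ('b \<Rightarrow>\<^sub>0 'k)"
  assumes f: "linear_map_pm f" and d: "linear_map_pm d"
    and U: "pm.subspace U" "finite S" "U \<subseteq> pm.span S"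
    and fU: "\<And>x. x \<in> U \<Longrightarrow> f x \<in> U" and comm: "\<And>x. x \<in> U \<Longrightarrow> d (f x) = f (d x)"
  shows "sub_trace U f = sub_trace {x \<in> U. d x = 0} f + sub_trace (d ` U) f"
proof -
  interpret f: linear_map_pm f by (rule f)
  interpret d: linear_map_pm d by (rule d)
  interpret dl: Vector_Spaces.linear pm_scale pm_scale d by (rule d.linear)
  let ?Z = "{x \<in> U. d x = 0}"
  have subZ: "pm.subspace ?Z" 
    by (rule pm.subspaceI)
      (simp_all add: d.zero d.add d.scale pm.subspace_0[OF U(1)] pm.subspace_add[OF U(1)] pm.subspace_scale[OF U(1)] pm_scale_simps)
  obtain BZ where BZ: "BZ \<subseteq> ?Z" "pm.independent BZ" "?Z \<subseteq> pm.span BZ"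
    by (rule pm.maximal_independent_subset[of ?Z])
  have spanZ: "pm.span BZ = ?Z" using pm.span_minimal[OF BZ(1) subZ] BZ(3) by blast
  have "BZ \<subseteq> U" using BZ(1) by blast
  then obtain B where B: "BZ \<subseteq> B" "B \<subseteq> U" "pm.independent B" "U \<subseteq> pm.span B"
    by (rule pm.maximal_independent_subset_extend[OF _ BZ(2)])
  have spanB: "pm.span B = U" using pm.span_minimal[OF B(2) U(1)] B(4) by blast
  have finB: "finite B" using pm.independent_span_bound[OF U(2) B(3)] B(2) U(3) by blast
  have finBZ: "finite BZ" using finite_subset[OF B(1) finB] .
  define D where "D = B - BZ"
  have DB: "D \<subseteq> B" "BZ \<inter> D = {}" "B = BZ \<union> D" using B(1) by (auto simp: D_def)
  have indD: "pm.independent D" using pm.independent_mono[OF B(3) DB(1)] .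
  have finD: "finite D" using finite_subset[OF DB(1) finB] .
  have inj: "inj_on d (pm.span D)"
  proof (rule dl.inj_on_iff_eq_0[OF pm.subspace_span, THEN iffD2], intro ballI impI)
    fix x assume x: "x \<in> pm.span D" "d x = 0"
    have xB: "x \<in> pm.span B" using pm.span_mono[OF DB(1)] x(1) by blast
    then have xZ: "x \<in> pm.span BZ" using x(2) by (simp add: spanZ spanB)
    have "pm.representation B x = pm.representation D x" by (rule pm.representation_extend[OF B(3) x(1) DB(1)])
    moreover have "pm.representation B x = pm.representation BZ x" by (rule pm.representation_extend[OF B(3) xZ B(1)])
    ultimately have "pm.representation B x b = 0" for b
      using pm.representation_ne_zero[of D x b] pm.representation_ne_zero[of BZ x b] DB(2) by (metis disjoint_iff)
    then have "(\<Sum>b\<in>B. pm_scale (pm.representation B x b) b) = 0" by (simp add: pm_scale_simps)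
    then show "x = 0" using pm.sum_representation_eq[OF B(3) xB finB order_refl] by simp
  qed
  have inj': "inj_on d D" using inj pm.span_superset[of D] inj_on_subset by blast
  have inddD: "pm.independent (d ` D)" by (rule dl.independent_injective_image[OF indD inj])
  have spandD: "pm.span (d ` D) = d ` U"
  proof -
    have "d ` U = pm.span (d ` B)" by (simp only: dl.span_image spanB)
    also have "d ` B = d ` BZ \<union> d ` D" by (simp only: DB(3) image_Un)
    also have "pm.span (d ` BZ \<union> d ` D) = pm.span (d ` D)"
    proof (rule antisym)
      have "d ` BZ \<subseteq> pm.span (d ` D)"
      proof (rule image_subsetI)
        fix b assume "b \<in> BZ"
        then have "b \<in> ?Z" by (rule subsetD[OF BZ(1)])
        then have "d b = 0" by simp
        then show "d b \<in> pm.span (d ` D)" by (simp only: pm.span_zero)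
      qed
      then have "d ` BZ \<union> d ` D \<subseteq> pm.span (d ` D)" by (rule Un_least[OF _ pm.span_superset])
      then show "pm.span (d ` BZ \<union> d ` D) \<subseteq> pm.span (d ` D)" by (rule pm.span_minimal[OF _ pm.subspace_span])
      show "pm.span (d ` D) \<subseteq> pm.span (d ` BZ \<union> d ` D)" by (rule pm.span_mono) blast
    qed
    finally show ?thesis by simp
  qed
  have qB: "quotient_coordinates (sub_vs U) {0} B (\<lambda>b. b) (pm.representation B)"
    using coordinates_of_basis[OF finB B(3)] by (simp only: spanB)
  have qZ: "quotient_coordinates (sub_vs ?Z) {0} BZ (\<lambda>b. b) (pm.representation BZ)"
    using coordinates_of_basis[OF finBZ BZ(2)] by (simp only: spanZ)
  have qD: "quotient_coordinates (sub_vs (d ` U)) {0} (d ` D) (\<lambda>b. b) (pm.representation (d ` D))"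
    using coordinates_of_basis[OF finite_imageI[OF finD] inddD] by (simp only: spandD)
  interpret qB: quotient_coordinates "sub_vs U" "{0}" B "\<lambda>b. b" "pm.representation B" by (rule qB)
  have tU: "sub_trace U f = (\<Sum>b\<in>B. pm.representation B (f b) b)" by (rule sub_trace_eq[OF qB f fU])
  have fZ: "f x \<in> ?Z" if "x \<in> ?Z" for x using that fU comm f.zero by simp
  have tZ: "sub_trace ?Z f = (\<Sum>b\<in>BZ. pm.representation BZ (f b) b)" by (rule sub_trace_eq[OF qZ f fZ])
  have fD: "f x \<in> d ` U" if "x \<in> d ` U" for x using that fU comm by (metis (no_types, lifting) imageE imageI)
  have tD: "sub_trace (d ` U) f = (\<Sum>b\<in>D. pm.representation (d ` D) (f (d b)) (d b))"
    by (subst sub_trace_eq[OF qD f fD]) (simp_all add: sum.reindex[OF inj'])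
  have 1: "pm.representation B (f b) b = pm.representation BZ (f b) b" if "b \<in> BZ" for b
  proof -
    have "f b \<in> pm.span BZ" unfolding spanZ by (rule fZ) (use that BZ(1) in blast)
    then show ?thesis by (simp only: pm.representation_extend[OF B(3) _ B(1)])
  qed
  have 2: "pm.representation (d ` D) (f (d b)) (d b) = pm.representation B (f b) b" if b: "b \<in> D" for b
  proof -
    have bU: "b \<in> U" using b DB(1) B(2) by blast
    have dU: "d x \<in> pm.span (d ` D)" if "x \<in> U" for x unfolding spandD using that by blast
    have "pm.representation (d ` D) (d (f b)) (d b) = (\<Sum>c\<in>B. pm.representation B (f b) c * pm.representation (d ` D) (d c) (d b))"
    proof (rule qB.expand_functional[where L = "\<lambda>x. pm.representation (d ` D) (d x) (d b)"])
      fix x y assume "x \<in> carrier (sub_vs U)" "y \<in> carrier (sub_vs U)"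
      then show "pm.representation (d ` D) (d (x + y)) (d b) = pm.representation (d ` D) (d x) (d b) + pm.representation (d ` D) (d y) (d b)"
        by (simp add: d.add pm.representation_add[OF inddD] dU)
    next
      fix c x assume "x \<in> carrier (sub_vs U)"
      then show "pm.representation (d ` D) (d (pm_scale c x)) (d b) = c * pm.representation (d ` D) (d x) (d b)"
        by (simp add: d.scale pm.representation_scale[OF inddD] dU)
    next
      fix x :: "'b \<Rightarrow>\<^sub>0 'k" assume "x \<in> {0}"
      then show "pm.representation (d ` D) (d x) (d b) = 0" by (simp add: d.zero pm.representation_zero)
    next
      show "f b \<in> carrier (sub_vs U)" using fU[OF bU] by simp
    qed
    also have "\<dots> = (\<Sum>c\<in>B. if c = b then pm.representation B (f b) c else 0)"
    proof (rule sum.cong[OF refl])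
      fix c assume "c \<in> B"
      then consider "c \<in> BZ" "c \<noteq> b" | "c \<in> D" using DB b by blast
      then show "pm.representation B (f b) c * pm.representation (d ` D) (d c) (d b) = (if c = b then pm.representation B (f b) c else 0)"
      proof cases
        case 1
        then have "d c = 0" using BZ(1) by blast
        then show ?thesis using 1(2) by (simp add: pm.representation_zero)
      next
        case 2
        then have "d c \<in> d ` D" by blast
        then have "pm.representation (d ` D) (d c) (d b) = (if d b = d c then 1 else 0)"
          by (simp add: pm.representation_basis[OF inddD])
        moreover have "d b = d c \<longleftrightarrow> c = b" using inj_on_eq_iff[OF inj' b 2] by auto
        ultimately show ?thesis by simp
      qed
    qed
    also have "\<dots> = pm.representation B (f b) b" using finB b DB(1) by (simp add: subsetD)
    finally show ?thesis by (simp only: comm[OF bU])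
  qed
  have "(\<Sum>b\<in>B. pm.representation B (f b) b) = (\<Sum>b\<in>BZ. pm.representation B (f b) b) + (\<Sum>b\<in>D. pm.representation B (f b) b)"
    unfolding DB(3) by (rule sum.union_disjoint[OF finBZ finD DB(2)])
  then show ?thesis unfolding tU tZ tD using 1 2 by simp
qed

section \<open>The Hopf trace formula\<close>

definition faces :: "'p set set \<Rightarrow> nat \<Rightarrow> 'p set set" where "faces \<Delta> k = {c \<in> \<Delta>. card c = k}"

definition chain_space :: "'p set set \<Rightarrow> nat \<Rightarrow> ('p set \<Rightarrow>\<^sub>0 complex) set" where
  "chain_space \<Delta> k = {z. Poly_Mapping.keys z \<subseteq> faces \<Delta> k}"

definition cycles :: "'p::order set set \<Rightarrow> nat \<Rightarrow> ('p set \<Rightarrow>\<^sub>0 complex) set" where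
  "cycles \<Delta> k = {z \<in> chain_space \<Delta> k. simplicial_boundary z = 0}"

lemma simplicial_chains_eq: "simplicial_chains \<Delta> (int k - 1) = sub_vs (chain_space \<Delta> k)"
  by (simp add: simplicial_chains_def sub_vs_def free_vs_def chain_space_def faces_def)

lemma chain_space_iff: "z \<in> chain_space \<Delta> k \<longleftrightarrow> (\<forall>c. c \<notin> faces \<Delta> k \<longrightarrow> Poly_Mapping.lookup z c = 0)"
  unfolding chain_space_def subset_iff in_keys_iff by blast

lemma subspace_chains: "pm.subspace (chain_space \<Delta> k)"
  by (rule pm.subspaceI) (simp_all add: chain_space_iff lookup_add)

lemma pm_push_linear: "linear_map_pm (pm_push g)"
  by (rule linear_map_pm.intro) (simp_all add: pm_push_add pm_push_scale)

lemma boundary_linear: "linear_map_pm simplicial_boundary"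
  by (rule linear_map_pm.intro) (simp_all only: boundary_add boundary_scale)

lemma chains_span: "chain_space \<Delta> k \<subseteq> pm.span ((\<lambda>c. Poly_Mapping.single c 1) ` faces \<Delta> k)"
proof
  fix z assume z: "z \<in> chain_space \<Delta> k"
  have "(\<Sum>c\<in>Poly_Mapping.keys z. pm_scale (Poly_Mapping.lookup z c) (Poly_Mapping.single c 1)) \<in> pm.span ((\<lambda>c. Poly_Mapping.single c 1) ` faces \<Delta> k)"
    by (intro pm.span_sum pm.span_scale pm.span_base) (use z in \<open>auto simp: chain_space_def\<close>)
  then show "z \<in> pm.span ((\<lambda>c. Poly_Mapping.single c 1) ` faces \<Delta> k)"
    by (simp add: pm_scale_simps sum_singles)
qed

locale complex_automorphism =
  fixes \<Delta> :: "'p::order set set" and \<sigma> :: "'p \<Rightarrow> 'p"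
  assumes finite_complex: "finite \<Delta>"
    and chain: "c \<in> \<Delta> \<Longrightarrow> pchain c"
    and down: "c \<in> \<Delta> \<Longrightarrow> c' \<subseteq> c \<Longrightarrow> c' \<in> \<Delta>"
    and inj: "inj \<sigma>" and order: "\<sigma> x < \<sigma> y \<longleftrightarrow> x < y"
    and image: "c \<in> \<Delta> \<Longrightarrow> \<sigma> ` c \<in> \<Delta>"
begin

abbreviation "push \<equiv> pm_push (image \<sigma>) :: ('p set \<Rightarrow>\<^sub>0 complex) \<Rightarrow> _"

lemma finite_faces: "finite (faces \<Delta> k)" using finite_complex by (simp add: faces_def)

lemma image_faces: "c \<in> faces \<Delta> k \<Longrightarrow> \<sigma> ` c \<in> faces \<Delta> k"
  using image card_image[OF inj_on_subset[OF inj subset_UNIV]] by (simp add: faces_def)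

lemma push_chains: "z \<in> chain_space \<Delta> k \<Longrightarrow> push z \<in> chain_space \<Delta> k"
proof -
  assume z: "z \<in> chain_space \<Delta> k"
  show ?thesis unfolding chain_space_def
  proof (intro CollectI subsetI)
    fix c assume "c \<in> Poly_Mapping.keys (push z)"
    then obtain c' where "c' \<in> Poly_Mapping.keys z" "c = \<sigma> ` c'" using keys_pm_push[of "image \<sigma>" z] by blast
    then show "c \<in> faces \<Delta> k" using z image_faces by (auto simp: chain_space_def)
  qed
qed

lemma push_boundary: "simplicial_boundary (push z) = push (simplicial_boundary z)"
proof (rule pm_additive_eq[of "\<lambda>z. simplicial_boundary (push z)" "\<lambda>z. push (simplicial_boundary z)"])
  fix c a
  have s: "pos_sign (\<sigma> x) (\<sigma> ` c) = pos_sign x c" for x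
  proof -
    have "{y \<in> \<sigma> ` c. y < \<sigma> x} = \<sigma> ` {y \<in> c. y < x}" using order by auto
    then show ?thesis by (simp add: pos_sign_def card_image[OF inj_on_subset[OF inj subset_UNIV]])
  qed
  have "\<sigma> ` c - {\<sigma> x} = \<sigma> ` (c - {x})" for x using inj by (auto simp: inj_eq)
  then show "simplicial_boundary (push (Poly_Mapping.single c a)) = push (simplicial_boundary (Poly_Mapping.single c a))"
    by (simp add: boundary_single pm_push_sum sum.reindex[OF inj_on_subset[OF inj subset_UNIV]] s)
qed (simp_all add: boundary_add pm_push_add)

lemma push_cycles: "z \<in> cycles \<Delta> k \<Longrightarrow> push z \<in> cycles \<Delta> k"
  by (simp add: cycles_def push_chains push_boundary)

lemma subspace_cycles: "pm.subspace (cycles \<Delta> k)"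
  unfolding cycles_def
  by (rule pm.subspaceI) (simp_all add: boundary_add boundary_scale pm.subspace_0[OF subspace_chains]
      pm.subspace_add[OF subspace_chains] pm.subspace_scale[OF subspace_chains] pm_scale_simps)

text \<open>The induced map permutes the faces without signs, because it preserves the order of the vertices.\<close>

lemma trace_chains: "sub_trace (chain_space \<Delta> k) push = of_nat (card {c \<in> faces \<Delta> k. \<sigma> ` c = c})"
proof -
  have qc: "quotient_coordinates (sub_vs (chain_space \<Delta> k)) {0} (faces \<Delta> k) (\<lambda>c. Poly_Mapping.single c 1) Poly_Mapping.lookup"
  proof (intro quotient_coordinates.intro quotient_coordinates_axioms.intro)
    show "subspace_record (sub_vs (chain_space \<Delta> k))" by (rule subspace_record_sub_vs[OF subspace_chains])
    show "{0} = {x \<in> carrier (sub_vs (chain_space \<Delta> k)). \<forall>i\<in>faces \<Delta> k. Poly_Mapping.lookup x i = 0}"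
    proof (intro equalityI subsetI)
      fix x assume x: "x \<in> {x \<in> carrier (sub_vs (chain_space \<Delta> k)). \<forall>i\<in>faces \<Delta> k. Poly_Mapping.lookup x i = 0}"
      have "x = 0"
      proof (rule poly_mapping_eqI)
        fix c
        show "Poly_Mapping.lookup x c = Poly_Mapping.lookup 0 c"
          using x by (cases "c \<in> faces \<Delta> k") (simp_all add: chain_space_iff)
      qed
      then show "x \<in> {0}" by simp
    qed (simp add: chain_space_iff)
  qed (simp_all add: finite_faces chain_space_iff lookup_add lookup_single when_def)
  have "sub_trace (chain_space \<Delta> k) push = (\<Sum>c\<in>faces \<Delta> k. Poly_Mapping.lookup (push (Poly_Mapping.single c 1)) c)"
    by (rule sub_trace_eq[OF qc pm_push_linear push_chains])
  also have "\<dots> = (\<Sum>c\<in>faces \<Delta> k. if \<sigma> ` c = c then 1 else 0)"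
    by (intro sum.cong refl) (simp add: lookup_single when_def)
  also have "\<dots> = of_nat (card {c \<in> faces \<Delta> k. \<sigma> ` c = c})"
    using finite_faces by (simp add: sum.If_cases Int_def)
  finally show ?thesis .
qed

lemma trace_chains_split:
  "sub_trace (chain_space \<Delta> k) push = sub_trace (cycles \<Delta> k) push + sub_trace (simplicial_boundary ` chain_space \<Delta> k) push"
  unfolding cycles_def
  by (rule sub_trace_kernel_image[OF pm_push_linear boundary_linear subspace_chains
      finite_imageI[OF finite_faces] chains_span push_chains push_boundary])

text \<open>The Hopf trace formula for a complex whose homology is concentrated in top degree: cycles equal boundaries
below the top, so additivity of the trace along the boundary map telescopes.\<close>

lemma hopf_trace:
  assumes acyclic: "\<And>k. k < K \<Longrightarrow> cycles \<Delta> k = simplicial_boundary ` chain_space \<Delta> (Suc k)"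
    and empty: "\<And>z. z \<in> chain_space \<Delta> 0 \<Longrightarrow> simplicial_boundary z = 0"
  shows "sub_trace (cycles \<Delta> K) push = (\<Sum>k\<le>K. (- 1) ^ (K - k) * of_nat (card {c \<in> faces \<Delta> k. \<sigma> ` c = c}))"
  using acyclic
proof (induction K)
  case 0
  have "cycles \<Delta> 0 = chain_space \<Delta> 0" using empty by (auto simp: cycles_def)
  then show ?case by (simp add: trace_chains)
next
  case (Suc K)
  have "sub_trace (chain_space \<Delta> (Suc K)) push = sub_trace (cycles \<Delta> (Suc K)) push + sub_trace (cycles \<Delta> K) push"
    using trace_chains_split[of "Suc K"] Suc.prems[of K] by simp
  then have "sub_trace (cycles \<Delta> (Suc K)) push = of_nat (card {c \<in> faces \<Delta> (Suc K). \<sigma> ` c = c}) - sub_trace (cycles \<Delta> K) push"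
    by (simp add: trace_chains)
  also have "sub_trace (cycles \<Delta> K) push = (\<Sum>k\<le>K. (- 1) ^ (K - k) * of_nat (card {c \<in> faces \<Delta> k. \<sigma> ` c = c}))"
    by (rule Suc.IH) (simp add: Suc.prems)
  finally show ?case by (simp add: sum_negf[symmetric] Suc_diff_le)
qed

end

text \<open>Without faces of higher dimension there is nothing to divide out: the top homology is the space of cycles.\<close>

lemma reduced_homology_top:
  assumes "faces \<Delta> (Suc K) = {}"
  shows "reduced_homology \<Delta> (int K - 1) = quot_vs (sub_vs (cycles \<Delta> K)) {0}"
proof -
  have 1: "simplicial_chains \<Delta> (int K - 1 + 1) = sub_vs (chain_space \<Delta> (Suc K))"
    using simplicial_chains_eq[of \<Delta> "Suc K"] by simp
  have "chain_space \<Delta> (Suc K) = {0}" using assms by (simp add: chain_space_def)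
  then have 2: "simplicial_boundary ` carrier (simplicial_chains \<Delta> (int K - 1 + 1)) = {0}" unfolding 1 by simp
  have "(simplicial_chains \<Delta> (int K - 1))\<lparr>carrier := {z \<in> carrier (simplicial_chains \<Delta> (int K - 1)). simplicial_boundary z = 0}\<rparr>
      = sub_vs (cycles \<Delta> K)"
    unfolding simplicial_chains_eq cycles_def by (simp add: sub_vs_def)
  then show ?thesis unfolding reduced_homology_def 2 by simp
qed

section \<open>Lexicographic order through positional numerals\<close>

primrec digits_val :: "nat \<Rightarrow> (nat \<Rightarrow> nat) \<Rightarrow> nat \<Rightarrow> nat" where
  "digits_val b d 0 = d 0"
| "digits_val b d (Suc N) = b * digits_val b d N + d (Suc N)"

lemma digits_val_cong: "(\<And>i. i \<le> N \<Longrightarrow> d i = d' i) \<Longrightarrow> digits_val b d N = digits_val b d' N"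
  by (induction N) simp_all

lemma digits_val_bound: "(\<And>i. i \<le> N \<Longrightarrow> d i < b) \<Longrightarrow> digits_val b d N < b ^ Suc N"
proof (induction N)
  case (Suc N)
  then have "digits_val b d N + 1 \<le> b ^ Suc N" by simp
  then have "b * (digits_val b d N + 1) \<le> b * b ^ Suc N" by (rule mult_le_mono2)
  moreover have "d (Suc N) < b" using Suc.prems by simp
  ultimately show ?case by (simp add: distrib_left)
qed simp

text \<open>The first differing digit decides: the later ones contribute less than one unit of its place.\<close>

lemma digits_val_less:
  assumes "\<And>i. i \<le> N \<Longrightarrow> d i < b" "k \<le> N" "\<And>i. i < k \<Longrightarrow> d i = d' i" "d k < d' k"
  shows "digits_val b d N < digits_val b d' N"
  using assms(1,2)
proof (induction N)
  case 0
  then show ?case using assms(4) by simp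
next
  case (Suc N)
  show ?case
  proof (cases "k = Suc N")
    case True
    have "digits_val b d N = digits_val b d' N" by (rule digits_val_cong) (use assms(3) True in simp)
    then show ?thesis using assms(4) True by simp
  next
    case False
    then have "digits_val b d N < digits_val b d' N" using Suc by simp
    then have "digits_val b d N + 1 \<le> digits_val b d' N" by simp
    then have "b * (digits_val b d N + 1) \<le> b * digits_val b d' N" by (rule mult_le_mono2)
    moreover have "d (Suc N) < b" using Suc.prems by simp
    ultimately show ?thesis by (simp add: distrib_left)
  qed
qed

text \<open>The shelling needs a linear order on the ground set; natural numbers bring one along. The bound \<open>n\<close>
allows subsets of the ground set, and then facets, to be encoded as numerals with a fixed number of
digits. A set \<open>S\<close> of ranks strictly between those of the empty flat and of \<open>E\<close> is selected.\<close>

locale nat_matroid = finite_matroid E rk for E :: "nat set" and rk :: "nat set \<Rightarrow> nat" +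
  fixes n :: nat and S :: "nat set"
  assumes E_bound: "E \<subseteq> {..n}" and S: "S \<subseteq> {1..<rk E}"
begin

section \<open>A shelling of the rank-selected order complex\<close>

text \<open>A digit is zero for an element that is present, so that sets with smaller elements come first.\<close>

definition code :: "nat set \<Rightarrow> nat" where "code A = digits_val 2 (\<lambda>i. if i \<in> A then 0 else 1) n"

lemma code_bound: "code A < 2 ^ Suc n"
  unfolding code_def by (rule digits_val_bound) simp

definition precedes :: "nat set \<Rightarrow> nat set \<Rightarrow> bool" where
  "precedes A B \<longleftrightarrow> (\<exists>k. k \<in> A \<and> k \<notin> B \<and> (\<forall>j<k. j \<in> A \<longleftrightarrow> j \<in> B))"

lemma code_less: assumes "precedes A B" "A \<subseteq> E" shows "code A < code B"
proof -
  obtain k where k: "k \<in> A" "k \<notin> B" "\<forall>j<k. j \<in> A \<longleftrightarrow> j \<in> B" using assms(1) unfolding precedes_def by blast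
  have "k \<le> n" using subsetD[OF E_bound subsetD[OF assms(2) k(1)]] by simp
  then show ?thesis unfolding code_def by (rule digits_val_less[rotated]) (use k in simp_all)
qed

lemma precedes_total: assumes "A \<noteq> B" shows "precedes A B \<or> precedes B A"
proof -
  define k where "k = (LEAST k. \<not> (k \<in> A \<longleftrightarrow> k \<in> B))"
  have ex: "\<exists>k. \<not> (k \<in> A \<longleftrightarrow> k \<in> B)" using assms by blast
  have k: "\<not> (k \<in> A \<longleftrightarrow> k \<in> B)" unfolding k_def by (rule LeastI_ex[OF ex])
  have less: "j \<in> A \<longleftrightarrow> j \<in> B" if "j < k" for j using not_less_Least[OF that[unfolded k_def]] by blast
  show ?thesis
  proof (cases "k \<in> A")
    case True
    then show ?thesis unfolding precedes_def using k less by blast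
  next
    case False
    then have "k \<in> B" using k by blast
    then show ?thesis unfolding precedes_def using False less by blast
  qed
qed

abbreviation "P \<equiv> {F \<in> flats E rk. rk F \<in> S}"
abbreviation "\<Delta> \<equiv> order_complex P"

lemma \<Delta>_iff: "c \<in> \<Delta> \<longleftrightarrow> c \<subseteq> P \<and> (\<forall>x\<in>c. \<forall>y\<in>c. x \<subseteq> y \<or> y \<subseteq> x)"
proof -
  have "finite c" if "c \<subseteq> P" by (rule finite_subset[OF that]) (simp add: finite_flats)
  then show ?thesis unfolding order_complex_def by blast
qed

lemma finite_P: "finite P" by (simp add: finite_flats)

lemma finite_\<Delta>: "finite \<Delta>"
  by (rule finite_subset[of _ "Pow P"]) (use finite_P in \<open>simp_all add: order_complex_def subset_iff\<close>)

lemma \<Delta>D: assumes "c \<in> \<Delta>" shows "finite c" "c \<subseteq> P" "x \<in> c \<Longrightarrow> flat x" "x \<in> c \<Longrightarrow> rk x \<in> S"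
  using assms by (auto simp: order_complex_def)

lemma \<Delta>_down: "c \<in> \<Delta> \<Longrightarrow> c' \<subseteq> c \<Longrightarrow> c' \<in> \<Delta>"
  unfolding \<Delta>_iff by (meson subsetD subset_trans)

lemma pchain_\<Delta>: "c \<in> \<Delta> \<Longrightarrow> pchain c" by (simp add: order_complex_def pchain_def)

abbreviation "bounded c \<equiv> insert {} (insert E c)"

lemma bounded_flat: "c \<in> \<Delta> \<Longrightarrow> x \<in> bounded c \<Longrightarrow> flat x"
  using \<Delta>D(3)[of c x] flat_empty flat_E by auto

lemma bounded_le:
  assumes c: "c \<in> \<Delta>" and x: "x \<in> bounded c" and y: "y \<in> bounded c" and r: "rk x \<le> rk y"
  shows "x \<subseteq> y"
proof -
  have fl: "flat x" "flat y" using bounded_flat[OF c] x y by blast+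
  have sub: "x \<subseteq> E" "y \<subseteq> E" using flat_sub fl by blast+
  have "x \<subseteq> y \<or> y \<subseteq> x"
    using x y sub c unfolding \<Delta>_iff by (metis empty_subsetI insert_iff)
  then show ?thesis
  proof
    assume "y \<subseteq> x"
    then have "x = y" by (rule flat_eqI[OF fl(2) _ sub(1) r])
    then show ?thesis by simp
  qed
qed

lemma bounded_eq: "c \<in> \<Delta> \<Longrightarrow> x \<in> bounded c \<Longrightarrow> y \<in> bounded c \<Longrightarrow> rk x = rk y \<Longrightarrow> x = y"
  using bounded_le[of c x y] bounded_le[of c y x] by simp

lemma inj_on_rk: "c \<in> \<Delta> \<Longrightarrow> inj_on rk c"
  by (rule inj_onI) (rule bounded_eq[of c], simp_all)

text \<open>The members of a chain next to a rank \<open>s\<close>. The empty flat and \<open>E\<close> serve as sentinels.\<close>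

lemma neighbours:
  assumes c: "c \<in> \<Delta>" and s: "s < rk E" "0 < s"
  obtains A B where "A \<in> bounded c" "B \<in> bounded c" "rk A < s" "s < rk B"
    "\<And>x. x \<in> bounded c \<Longrightarrow> rk x < s \<Longrightarrow> x \<subseteq> A" "\<And>x. x \<in> bounded c \<Longrightarrow> s < rk x \<Longrightarrow> B \<subseteq> x"
proof -
  let ?L = "{x \<in> bounded c. rk x < s}" and ?U = "{x \<in> bounded c. s < rk x}"
  have fin: "finite (bounded c)" using \<Delta>D(1)[OF c] by simp
  have finL: "finite ?L" and finU: "finite ?U" by (simp_all only: finite_Collect_conjI[OF disjI1] fin Collect_mem_eq)
  have "{} \<in> ?L" using s by (simp add: rk_empty)
  then have neL: "?L \<noteq> {}" by blast
  obtain A where A: "A \<in> ?L" "\<And>x. x \<in> ?L \<Longrightarrow> rk x \<le> rk A"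
    using finite_has_max_value[OF finL neL, of rk] by blast
  have "E \<in> ?U" using s by simp
  then have neU: "?U \<noteq> {}" by blast
  obtain B where B: "B \<in> ?U" "\<And>x. x \<in> ?U \<Longrightarrow> rk E - rk x \<le> rk E - rk B"
    using finite_has_max_value[OF finU neU, of "\<lambda>x. rk E - rk x"] by blast
  have leE: "rk x \<le> rk E" if "x \<in> bounded c" for x
    by (rule rk_mono[OF flat_sub[OF bounded_flat[OF c that]] order_refl])
  show ?thesis
  proof (rule that[of A B])
    show "x \<subseteq> A" if "x \<in> bounded c" "rk x < s" for x
      by (rule bounded_le[OF c that(1)]) (use A that in simp_all)
    show "B \<subseteq> x" if x: "x \<in> bounded c" "s < rk x" for x
    proof (rule bounded_le[OF c _ x(1)])
      show "rk B \<le> rk x" using B(2)[of x] leE[of x] leE[of B] x B(1) by auto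
    qed (use B(1) in simp)
  qed (use A(1) B(1) in simp_all)
qed

definition facet :: "nat set set \<Rightarrow> bool" where "facet f \<longleftrightarrow> f \<in> \<Delta> \<and> rk ` f = S"

lemma insert_between:
  assumes c: "c \<in> \<Delta>" and z: "flat z" "rk z \<in> S"
    and cmp: "\<And>x. x \<in> c \<Longrightarrow> x \<subseteq> z \<or> z \<subseteq> x"
  shows "insert z c \<in> \<Delta>"
  using c z cmp unfolding \<Delta>_iff by blast

lemma facet_above: "c \<in> \<Delta> \<Longrightarrow> \<exists>f. facet f \<and> c \<subseteq> f"
proof (induction "card (S - rk ` c)" arbitrary: c rule: less_induct)
  case less
  have finS: "finite S" using S finite_subset by blast
  have sub: "rk ` c \<subseteq> S" using \<Delta>D(4)[OF less.prems] by blast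
  show ?case
  proof (cases "rk ` c = S")
    case True
    then show ?thesis using less.prems unfolding facet_def by blast
  next
    case False
    then obtain s where s: "s \<in> S" "s \<notin> rk ` c" using sub by blast
    have sE: "s < rk E" "0 < s" using S s(1) by auto
    obtain A B where AB: "A \<in> bounded c" "B \<in> bounded c" "rk A < s" "s < rk B"
      "\<And>x. x \<in> bounded c \<Longrightarrow> rk x < s \<Longrightarrow> x \<subseteq> A" "\<And>x. x \<in> bounded c \<Longrightarrow> s < rk x \<Longrightarrow> B \<subseteq> x"
      using neighbours[OF less.prems sE] by blast
    have "A \<subseteq> B" using bounded_le[OF less.prems AB(1,2)] AB(3,4) by simp
    then obtain z where z: "flat z" "A \<subseteq> z" "z \<subseteq> B" "rk z = s"
      using flat_of_rank_between[of A B s] bounded_flat[OF less.prems AB(2)] AB(3,4) by auto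
    have c': "insert z c \<in> \<Delta>"
    proof (rule insert_between[OF less.prems z(1)])
      fix x assume x: "x \<in> c"
      then have "rk x \<noteq> s" using s(2) by blast
      then show "x \<subseteq> z \<or> z \<subseteq> x" using AB(5,6)[of x] x z(2,3) by (meson insertCI linorder_neqE_nat subset_trans)
    qed (simp add: z s)
    have "S - rk ` insert z c \<subset> S - rk ` c" using s z(4) by blast
    then have "card (S - rk ` insert z c) < card (S - rk ` c)" using finS by (intro psubset_card_mono) simp_all
    then obtain f where "facet f" "insert z c \<subseteq> f" using less.hyps c' by blast
    then show ?thesis by blast
  qed
qed

definition elt :: "nat set set \<Rightarrow> nat \<Rightarrow> nat set" where "elt f s = (THE x. x \<in> f \<and> rk x = s)"

lemma elt_eq: "f \<in> \<Delta> \<Longrightarrow> x \<in> f \<Longrightarrow> elt f (rk x) = x"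
proof -
  assume f: "f \<in> \<Delta>" and x: "x \<in> f"
  show ?thesis unfolding elt_def
  proof (rule the_equality)
    fix y assume "y \<in> f \<and> rk y = rk x"
    then show "y = x" using bounded_eq[OF f, of y x] x by simp
  qed (simp add: x)
qed

lemma elt: assumes "facet f" "s \<in> S" shows "elt f s \<in> f" "rk (elt f s) = s"
proof -
  obtain x where "x \<in> f" "rk x = s" using assms unfolding facet_def by blast
  then show "elt f s \<in> f" "rk (elt f s) = s" using elt_eq[of f x] assms unfolding facet_def by auto
qed

lemma facet_\<Delta>: "facet f \<Longrightarrow> f \<in> \<Delta>" by (simp add: facet_def)

lemma elt_sub: assumes "facet f" "s \<in> S" shows "elt f s \<subseteq> E"
  by (rule flat_sub[OF \<Delta>D(3)[OF facet_\<Delta>[OF assms(1)] elt(1)[OF assms]]])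

lemma facet_eq: assumes "facet f" "facet g" "\<And>s. s \<in> S \<Longrightarrow> elt f s = elt g s" shows "f = g"
proof -
  have "f \<subseteq> g" if "facet f" "facet g" "\<And>s. s \<in> S \<Longrightarrow> elt f s = elt g s" for f g
  proof
    fix x assume x: "x \<in> f"
    then have "rk x \<in> S" using that(1) unfolding facet_def by blast
    then show "x \<in> g" using elt_eq[OF facet_\<Delta>[OF that(1)] x] elt(1)[OF that(2)] that(3) by metis
  qed
  then show ?thesis using assms by (metis subset_antisym)
qed

text \<open>Facets are compared lexicographically by their flats of increasing rank; ranks outside \<open>S\<close> contribute
the constant digit zero.\<close>

definition index :: "nat set set \<Rightarrow> nat" where
  "index f = digits_val (2 ^ Suc n) (\<lambda>s. if s \<in> S then code (elt f s) else 0) (rk E)"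

lemma index_less:
  assumes "facet f" "facet g" "s \<in> S" "\<And>t. t \<in> S \<Longrightarrow> t < s \<Longrightarrow> elt f t = elt g t" "precedes (elt f s) (elt g s)"
  shows "index f < index g"
  unfolding index_def
proof (rule digits_val_less)
  show "s \<le> rk E" using S assms(3) by auto
  show "(if i \<in> S then code (elt f i) else 0) < 2 ^ Suc n" for i using code_bound[of "elt f i"] by simp
  show "(if i \<in> S then code (elt f i) else 0) = (if i \<in> S then code (elt g i) else 0)" if "i < s" for i
    using assms(4) that by simp
  show "(if s \<in> S then code (elt f s) else 0) < (if s \<in> S then code (elt g s) else 0)"
    using assms(3) code_less[OF assms(5) elt_sub[OF assms(1,3)]] by simp
qed

lemma facet_compare:
  assumes "facet f" "facet g" "f \<noteq> g"
  shows "\<exists>s\<in>S. (\<forall>t\<in>S. t < s \<longrightarrow> elt f t = elt g t) \<and> (precedes (elt f s) (elt g s) \<or> precedes (elt g s) (elt f s))"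
proof -
  define s where "s = (LEAST s. s \<in> S \<and> elt f s \<noteq> elt g s)"
  have ex: "\<exists>s. s \<in> S \<and> elt f s \<noteq> elt g s" using facet_eq[OF assms(1,2)] assms(3) by blast
  have s: "s \<in> S \<and> elt f s \<noteq> elt g s" unfolding s_def by (rule LeastI_ex[OF ex])
  have "elt f t = elt g t" if "t \<in> S" "t < s" for t using not_less_Least[OF that(2)[unfolded s_def]] that(1) by blast
  then show ?thesis using s precedes_total by blast
qed

lemma index_inj: "facet f \<Longrightarrow> facet g \<Longrightarrow> index f = index g \<Longrightarrow> f = g"
  using facet_compare[of f g] index_less[of f g] index_less[of g f] by (metis less_irrefl)

lemma index_less_witness:
  assumes "facet f" "facet g" "index g < index f"
  obtains s where "s \<in> S" "\<And>t. t \<in> S \<Longrightarrow> t < s \<Longrightarrow> elt f t = elt g t" "precedes (elt g s) (elt f s)"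
proof -
  have "f \<noteq> g" using assms(3) by auto
  then obtain s where s: "s \<in> S" "\<And>t. t \<in> S \<Longrightarrow> t < s \<Longrightarrow> elt f t = elt g t"
    "precedes (elt f s) (elt g s) \<or> precedes (elt g s) (elt f s)"
    using facet_compare[OF assms(1,2)] by blast
  have "\<not> precedes (elt f s) (elt g s)" using index_less[OF assms(1,2) s(1,2)] assms(3) by auto
  then show ?thesis using that[OF s(1,2)] s(3) by blast
qed

text \<open>The exchange property of a shelling. Let \<open>s\<close> be the first rank at which \<open>f\<close> and the earlier facet \<open>g\<close> differ,
and \<open>Y\<close> their next common flat. With \<open>e\<close> the least element of \<open>Y\<close> outside the flat of \<open>f\<close> of rank \<open>s\<close>,
let \<open>x\<close> be the last flat of \<open>f\<close> below \<open>Y\<close> that misses \<open>e\<close>; it is not in \<open>g\<close>. Between the neighbours \<open>A\<close> and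
\<open>B\<close> of \<open>x\<close> in \<open>f\<close> there is another flat \<open>z\<close> of the same rank that contains \<open>e\<close> and every element of \<open>x\<close> smaller
than \<open>e\<close>, and \<open>z\<close> precedes \<open>x\<close>. Such a \<open>z\<close> exists because \<open>A\<close> together with the elements of \<open>x\<close> smaller than \<open>e\<close>
does not yet span \<open>x\<close>.\<close>

lemma shelling:
  assumes f: "facet f" and g: "facet g" and less: "index g < index f"
  shows "\<exists>x\<in>f - g. \<exists>g'. facet g' \<and> f - {x} \<subseteq> g' \<and> index g' < index f"
proof -
  note f\<Delta> = facet_\<Delta>[OF f] and g\<Delta> = facet_\<Delta>[OF g]
  obtain s where s: "s \<in> S" "\<And>t. t \<in> S \<Longrightarrow> t < s \<Longrightarrow> elt f t = elt g t" "precedes (elt g s) (elt f s)"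
    using index_less_witness[OF f g less] by blast
  obtain m where m: "m \<in> elt g s" "m \<notin> elt f s" "\<And>j. j < m \<Longrightarrow> j \<in> elt g s \<longleftrightarrow> j \<in> elt f s"
    using s(3) unfolding precedes_def by blast
  have Sr: "t < rk E" "0 < t" if "t \<in> S" for t using S that by auto
  \<comment> \<open>Ranks above the first difference at which the two facets agree again; the rank of the ground set always qualifies.\<close>
  define T where "T = {t. s < t \<and> (t = rk E \<or> (t \<in> S \<and> elt f t = elt g t))}"
  define j where "j = (LEAST t. t \<in> T)"
  have "rk E \<in> T" using Sr[OF s(1)] by (simp add: T_def)
  then have jT: "j \<in> T" and jmin: "\<And>t. t \<in> T \<Longrightarrow> j \<le> t" unfolding j_def by (auto intro: LeastI Least_le)
  have jE: "j \<le> rk E" by (rule jmin[OF \<open>rk E \<in> T\<close>])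
  have sj: "s < j" using jT by (simp add: T_def)
  define Y where "Y = (if j = rk E then E else elt f j)"
  have Y: "Y \<in> bounded f" "rk Y = j" using jT elt[OF f, of j] by (auto simp: Y_def T_def)
  have fY: "x \<subseteq> Y" if "x \<in> f" "rk x \<le> j" for x using bounded_le[OF f\<Delta> _ Y(1), of x] that Y(2) by simp
  have "elt g s \<subseteq> Y"
  proof (cases "j = rk E")
    case True
    then show ?thesis using elt_sub[OF g s(1)] by (simp add: Y_def)
  next
    case False
    then have "j \<in> S" "Y = elt g j" using jT by (auto simp: Y_def T_def)
    then show ?thesis using bounded_le[OF g\<Delta>, of "elt g s" "elt g j"] elt[OF g] s(1) sj by simp
  qed
  then have mY: "m \<in> Y - elt f s" using m by blast
  define e where "e = (LEAST e. e \<in> Y - elt f s)"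
  have e: "e \<in> Y - elt f s" unfolding e_def by (rule LeastI[where P = "\<lambda>e. e \<in> Y - elt f s", OF mY])
  have emin: "e \<le> i" if "i \<in> Y - elt f s" for i unfolding e_def by (rule Least_le[where P = "\<lambda>e. e \<in> Y - elt f s", OF that])
  let ?Q = "{x \<in> f. s \<le> rk x \<and> rk x < j \<and> e \<notin> x}"
  have "elt f s \<in> ?Q" using elt[OF f s(1)] sj e by simp
  moreover have "finite ?Q" using \<Delta>D(1)[OF f\<Delta>] by simp
  ultimately obtain x where x: "x \<in> ?Q" "\<And>x'. x' \<in> ?Q \<Longrightarrow> rk x' \<le> rk x"
    using finite_has_max_value[of ?Q rk] by blast
  define l where "l = rk x"
  have xf: "x \<in> f" "s \<le> l" "l < j" "e \<notin> x" using x(1) by (simp_all add: l_def)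
  have lS: "l \<in> S" unfolding l_def by (rule \<Delta>D(4)[OF f\<Delta> xf(1)])
  have xfl: "flat x" by (rule \<Delta>D(3)[OF f\<Delta> xf(1)])
  have xl: "elt f l = x" unfolding l_def by (rule elt_eq[OF f\<Delta> xf(1)])
  have xg: "x \<notin> g"
  proof
    assume "x \<in> g"
    then have eq: "elt g l = x" unfolding l_def by (rule elt_eq[OF g\<Delta>])
    show False
    proof (cases "l = s")
      case True
      then show False using eq xl m by blast
    next
      case False
      then have "l \<in> T" using xf(2) lS eq xl by (simp add: T_def)
      then show False using jmin[of l] xf(3) by simp
    qed
  qed
  obtain A B where AB: "A \<in> bounded f" "B \<in> bounded f" "rk A < l" "l < rk B"
      "\<And>y. y \<in> bounded f \<Longrightarrow> rk y < l \<Longrightarrow> y \<subseteq> A" "\<And>y. y \<in> bounded f \<Longrightarrow> l < rk y \<Longrightarrow> B \<subseteq> y"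
    using neighbours[OF f\<Delta> Sr[OF lS]] by blast
  have Ax: "A \<subseteq> x" using bounded_le[OF f\<Delta> AB(1), of x] xf(1) AB(3) by (simp add: l_def)
  have xB: "x \<subseteq> B" using bounded_le[OF f\<Delta> _ AB(2), of x] xf(1) AB(4) by (simp add: l_def)
  have BY: "B \<subseteq> Y" using AB(6)[OF Y(1)] Y(2) xf(3) by simp
  have eB: "e \<in> B"
  proof (cases "B = Y")
    case False
    then have "rk B \<noteq> j" using bounded_eq[OF f\<Delta> AB(2) Y(1)] Y(2) by auto
    moreover have "rk B \<le> rk Y" by (rule rk_flat_mono[OF bounded_flat[OF f\<Delta> AB(2)] bounded_flat[OF f\<Delta> Y(1)] BY])
    ultimately have Bj: "rk B < j" using Y(2) by simp
    have "B \<noteq> {}" using AB(4) rk_empty by auto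
    moreover have "B \<noteq> E" using Bj jE by auto
    ultimately have "B \<in> f" using AB(2) by blast
    show ?thesis
    proof (rule ccontr)
      assume "e \<notin> B"
      then have "B \<in> ?Q" using \<open>B \<in> f\<close> Bj AB(4) xf(2) by simp
      then show False using x(2)[of B] AB(4) by (simp add: l_def)
    qed
  qed (use e in blast)
  define Z where "Z = A \<union> {i \<in> x. i < e}"
  have Zx: "Z \<subseteq> x" using Ax by (auto simp: Z_def)
  have xE: "x \<subseteq> E" by (rule flat_sub[OF xfl])
  \<comment> \<open>If these elements spanned the flat, then at rank s the facet g would contain the flat, and above rank s a smaller choice of e would exist.\<close>
  have rZ: "rk Z < l"
  proof (rule ccontr)
    assume "\<not> rk Z < l"
    then have rkZ: "rk x \<le> rk Z" by (simp add: l_def)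
    have ZE: "Z \<subseteq> E" using Zx xE by blast
    have clZ: "cl Z \<subseteq> x" by (rule cl_min[OF Zx xfl])
    have "x = cl Z" by (rule flat_eqI[OF flat_cl[OF ZE] clZ xE]) (simp add: rk_cl[OF ZE] rkZ)
    show False
    proof (cases "l = s")
      case True
      have "A \<subseteq> elt g s"
      proof (cases "A \<in> f")
        case True
        have "rk A \<in> S" by (rule \<Delta>D(4)[OF f\<Delta> True])
        moreover have "rk A < s" using AB(3) \<open>l = s\<close> by simp
        ultimately have "elt g (rk A) = A" using s(2)[of "rk A"] elt_eq[OF f\<Delta> True] by simp
        then have "A \<in> g" using elt(1)[OF g \<open>rk A \<in> S\<close>] by simp
        then show ?thesis using bounded_le[OF g\<Delta>, of A "elt g s"] elt[OF g s(1)] \<open>rk A < s\<close> by simp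
      next
        case False
        have "A \<noteq> E" using AB(3) Sr[OF lS] by auto
        then show ?thesis using False AB(1) by blast
      qed
      moreover have "i \<in> elt g s" if "i \<in> x" "i < e" for i
        using m(3)[of i] emin[OF mY] that xl True by simp
      ultimately have "Z \<subseteq> elt g s" by (auto simp: Z_def)
      then have "x \<subseteq> elt g s"
        using cl_min[of Z "elt g s"] \<Delta>D(3)[OF g\<Delta> elt(1)[OF g s(1)]] \<open>x = cl Z\<close> by simp
      then have "elt g s = x"
        by (rule flat_eqI[OF xfl _ elt_sub[OF g s(1)]]) (use elt(2)[OF g s(1)] True in \<open>simp add: l_def\<close>)
      then show False using elt(1)[OF g s(1)] xg by simp
    next
      case False
      then have "s < l" using xf(2) by simp
      then have sA: "elt f s \<subseteq> A" using AB(5)[of "elt f s"] elt[OF f s(1)] by simp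
      have "\<not> {i \<in> x. i < e} \<subseteq> A"
      proof
        assume "{i \<in> x. i < e} \<subseteq> A"
        then have "Z = A" by (auto simp: Z_def)
        then show False using rkZ AB(3) by (simp add: l_def)
      qed
      then obtain i where i: "i \<in> x" "i < e" "i \<notin> A" by blast
      then have "i \<in> Y - elt f s" using sA xB BY by blast
      then show False using emin i(2) by fastforce
    qed
  qed
  have eE: "e \<in> E" using e flat_sub[OF bounded_flat[OF f\<Delta> Y(1)]] by blast
  have ZE: "insert e Z \<subseteq> E" using Zx xE eE by blast
  have r: "rk (insert e Z) \<le> l" using rk_insert_le[OF ZE] rZ by simp
  have "insert e Z \<subseteq> B" using eB Zx xB by blast
  then obtain z where z: "flat z" "insert e Z \<subseteq> z" "z \<subseteq> B" "rk z = l"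
    using flat_of_rank_between[OF _ bounded_flat[OF f\<Delta> AB(2)] r] AB(4) by auto
  define g' where "g' = insert z (f - {x})"
  have Az: "A \<subseteq> z" using z(2) by (auto simp: Z_def)
  have g'\<Delta>: "g' \<in> \<Delta>" unfolding g'_def
  proof (rule insert_between[OF \<Delta>_down[OF f\<Delta>] z(1)])
    fix y assume y: "y \<in> f - {x}"
    have "rk y \<noteq> l" using bounded_eq[OF f\<Delta>, of y x] y xf(1) by (auto simp: l_def)
    then consider "rk y < l" | "l < rk y" by linarith
    then show "y \<subseteq> z \<or> z \<subseteq> y"
    proof cases
      case 1
      then have "y \<subseteq> A" using AB(5)[of y] y by simp
      then show ?thesis using Az by blast
    next
      case 2
      then have "B \<subseteq> y" using AB(6)[of y] y by simp
      then show ?thesis using z(3) by blast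
    qed
  qed (use z(4) lS in auto)
  have "rk ` g' = S"
  proof -
    have "rk ` f = S" using f by (simp add: facet_def)
    then have "S = insert l (rk ` (f - {x}))"
      using image_insert[of rk x "f - {x}"] unfolding insert_Diff[OF xf(1)] l_def by simp
    then show ?thesis by (simp add: g'_def z(4))
  qed
  then have g': "facet g'" using g'\<Delta> by (simp add: facet_def)
  have elt_z: "elt g' l = z" using elt_eq[OF g'\<Delta>, of z] z(4) by (simp add: g'_def)
  have "index g' < index f"
  proof (rule index_less[OF g' f lS])
    fix t assume t: "t \<in> S" "t < l"
    have "elt f t \<noteq> x"
    proof
      assume "elt f t = x"
      then have "t = l" using elt(2)[OF f t(1)] by (simp only: l_def)
      then show False using t(2) by simp
    qed
    then have "elt f t \<in> g'" unfolding g'_def by (intro insertI2 DiffI elt(1)[OF f t(1)]) simp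
    then have "elt g' (rk (elt f t)) = elt f t" by (rule elt_eq[OF g'\<Delta>])
    then show "elt g' t = elt f t" by (simp only: elt(2)[OF f t(1)])
  next
    have ez: "e \<in> z" by (rule subsetD[OF z(2) insertI1])
    have "\<not> precedes x z"
    proof
      assume "precedes x z"
      then obtain k where k: "k \<in> x" "k \<notin> z" "\<forall>j<k. j \<in> x \<longleftrightarrow> j \<in> z" unfolding precedes_def by blast
      have "\<not> e < k"
      proof
        assume "e < k"
        then have "e \<in> x \<longleftrightarrow> e \<in> z" using k(3) by simp
        then show False using ez xf(4) by simp
      qed
      moreover have "k \<noteq> e"
      proof
        assume "k = e"
        then show False using k(1) xf(4) by simp
      qed
      ultimately have "k \<in> Z" using k(1) by (simp add: Z_def)
      then have "k \<in> z" using subsetD[OF z(2)] by simp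
      then show False using k(2) by simp
    qed
    moreover have "x \<noteq> z"
    proof
      assume "x = z"
      then show False using ez xf(4) by simp
    qed
    ultimately show "precedes (elt g' l) (elt f l)" using precedes_total[of x z] by (simp add: elt_z xl)
  qed
  moreover have "f - {x} \<subseteq> g'" unfolding g'_def by (rule subset_insertI)
  ultimately show ?thesis using g' xf(1) xg by (intro bexI[of _ x] exI[of _ g'] conjI) simp_all
qed

definition first :: "nat set set \<Rightarrow> nat set set" where
  "first c = (ARG_MIN index f. facet f \<and> c \<subseteq> f)"

lemma first: assumes "c \<in> \<Delta>"
  shows "facet (first c)" "c \<subseteq> first c" "facet f \<Longrightarrow> c \<subseteq> f \<Longrightarrow> index (first c) \<le> index f"
proof -
  obtain g where "facet g \<and> c \<subseteq> g" using facet_above[OF assms] by blast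
  from arg_min_nat_lemma[of "\<lambda>f. facet f \<and> c \<subseteq> f" g index, OF this]
  show "facet (first c)" "c \<subseteq> first c" "facet f \<Longrightarrow> c \<subseteq> f \<Longrightarrow> index (first c) \<le> index f"
    by (auto simp: first_def)
qed

lemma first_eqI: "c \<in> \<Delta> \<Longrightarrow> facet f \<Longrightarrow> c \<subseteq> f \<Longrightarrow> (\<And>g. facet g \<Longrightarrow> c \<subseteq> g \<Longrightarrow> \<not> index g < index f) \<Longrightarrow> first c = f"
  using first[of c] index_inj[of "first c" f] by (metis le_neq_implies_less)

text \<open>The vertices whose removal makes the face belong to an earlier facet; the faces first covered by \<open>f\<close> are
those between \<open>restriction f\<close> and \<open>f\<close>.\<close>

definition restriction :: "nat set set \<Rightarrow> nat set set" where
  "restriction f = {x \<in> f. first (f - {x}) \<noteq> f}"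

text \<open>A face of \<open>f\<close> that lies in an earlier facet lies, by the exchange property, in an earlier facet that
contains all vertices of \<open>f\<close> but one.\<close>

lemma first_restriction:
  assumes f: "facet f" and c: "c \<subseteq> f"
  shows "first c = f \<longleftrightarrow> restriction f \<subseteq> c"
proof -
  have c\<Delta>: "c \<in> \<Delta>" by (rule \<Delta>_down[OF facet_\<Delta>[OF f] c])
  show ?thesis
  proof
    assume fc: "first c = f"
    show "restriction f \<subseteq> c"
    proof
      fix x assume x: "x \<in> restriction f"
      show "x \<in> c"
      proof (rule ccontr)
        assume "x \<notin> c"
        then have sub: "c \<subseteq> f - {x}" using c by blast
        have "first (f - {x}) = f"
        proof (rule first_eqI[OF \<Delta>_down[OF facet_\<Delta>[OF f] Diff_subset] f Diff_subset])
          fix g assume g: "facet g" "f - {x} \<subseteq> g"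
          have "index (first c) \<le> index g" by (rule first(3)[OF c\<Delta> g(1) subset_trans[OF sub g(2)]])
          then show "\<not> index g < index f" by (simp add: fc)
        qed
        then show False using x by (simp add: restriction_def)
      qed
    qed
  next
    assume R: "restriction f \<subseteq> c"
    show "first c = f"
    proof (rule first_eqI[OF c\<Delta> f c])
      fix g assume g: "facet g" "c \<subseteq> g"
      show "\<not> index g < index f"
      proof
        assume "index g < index f"
        then obtain x g' where x: "x \<in> f" "x \<notin> g" "facet g'" "f - {x} \<subseteq> g'" "index g' < index f"
          using shelling[OF f g(1)] by blast
        have "index (first (f - {x})) \<le> index g'"
          by (rule first(3)[OF \<Delta>_down[OF facet_\<Delta>[OF f] Diff_subset] x(3,4)])
        then have "first (f - {x}) \<noteq> f" using x(5) by auto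
        then have "x \<in> restriction f" using x(1) by (simp add: restriction_def)
        then show False using R g(2) x(2) by blast
      qed
    qed
  qed
qed

lemma card_facet: "facet f \<Longrightarrow> card f = card S"
  using card_image[OF inj_on_rk[OF facet_\<Delta>]] by (simp add: facet_def)

theorem rank_selection_acyclic:
  assumes "k < card S"
  shows "cycles \<Delta> k = simplicial_boundary ` chain_space \<Delta> (Suc k)"
proof (intro equalityI subsetI)
  fix z assume "z \<in> cycles \<Delta> k"
  then have z: "\<And>c. c \<in> Poly_Mapping.keys z \<Longrightarrow> c \<in> \<Delta>" "\<And>c. c \<in> Poly_Mapping.keys z \<Longrightarrow> card c = k" "simplicial_boundary z = 0"
    by (auto simp: cycles_def chain_space_def faces_def)
  have "\<exists>w. (\<forall>c\<in>Poly_Mapping.keys w. c \<in> \<Delta> \<and> card c = Suc k) \<and> simplicial_boundary w = z"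
  proof (rule partitioned_complex_acyclic[of \<Delta> first "card S" restriction index k z])
    show "first c' = first c \<longleftrightarrow> restriction (first c) \<subseteq> c'" if "c \<in> \<Delta>" "c' \<subseteq> first c" for c c'
      by (rule first_restriction[OF first(1)[OF that(1)] that(2)])
    show "index (first c') \<le> index (first c)" if "c \<in> \<Delta>" "c' \<subseteq> c" for c c'
      by (rule first(3)[OF \<Delta>_down[OF that] first(1)[OF that(1)] subset_trans[OF that(2) first(2)[OF that(1)]]])
    show "first c = first c'" if "c \<in> \<Delta>" "c' \<in> \<Delta>" "index (first c) = index (first c')" for c c'
      by (rule index_inj[OF first(1)[OF that(1)] first(1)[OF that(2)] that(3)])
    show "first c \<in> \<Delta>" "c \<subseteq> first c" "card (first c) = card S" if "c \<in> \<Delta>" for c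
      by (rule facet_\<Delta>[OF first(1)[OF that]], rule first(2)[OF that], rule card_facet[OF first(1)[OF that]])
  qed (use z assms pchain_\<Delta> \<Delta>_down in blast)+
  then show "z \<in> simplicial_boundary ` chain_space \<Delta> (Suc k)"
    unfolding chain_space_def faces_def by blast
next
  fix z assume "z \<in> simplicial_boundary ` chain_space \<Delta> (Suc k)"
  then obtain w where w: "z = simplicial_boundary w" "\<And>c. c \<in> Poly_Mapping.keys w \<Longrightarrow> c \<in> \<Delta> \<and> card c = Suc k"
    unfolding chain_space_def faces_def by blast
  have "c \<in> faces \<Delta> k" if cz: "c \<in> Poly_Mapping.keys z" for c
  proof -
    obtain d x where d: "d \<in> Poly_Mapping.keys w" "x \<in> d" "c = d - {x}"
      using keys_boundary[OF cz[unfolded w(1)]] by blast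
    have "c \<in> \<Delta>" by (rule \<Delta>_down[of d]) (use w(2)[OF d(1)] d(3) in blast)+
    moreover have "card c = k" using w(2)[OF d(1)] d(2,3) by simp
    ultimately show ?thesis by (simp add: faces_def)
  qed
  moreover have "simplicial_boundary z = 0" unfolding w(1) by (rule boundary_boundary) (use w(2) pchain_\<Delta> in blast)
  ultimately show "z \<in> cycles \<Delta> k" unfolding cycles_def chain_space_def by blast
qed

end

section \<open>Polynomial rings over a set of variables\<close>

lemma carrier_poly_ring: "p \<in> carrier (poly_ring Vs) \<longleftrightarrow> (\<forall>m\<in>Poly_Mapping.keys p. Poly_Mapping.keys m \<subseteq> Vs)"
  by (simp add: poly_ring_def)

lemma ops_poly_ring: "add (poly_ring Vs) = (+)" "mult (poly_ring Vs) = (*)" "zero (poly_ring Vs) = 0" "one (poly_ring Vs) = 1"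
  by (simp_all add: poly_ring_def)

lemma poly_ring_add: "p \<in> carrier (poly_ring Vs) \<Longrightarrow> q \<in> carrier (poly_ring Vs) \<Longrightarrow> p + q \<in> carrier (poly_ring Vs)"
  unfolding carrier_poly_ring using Poly_Mapping.keys_add[of p q] by blast

lemma poly_ring_minus: "p \<in> carrier (poly_ring Vs) \<Longrightarrow> - p \<in> carrier (poly_ring Vs)"
  by (simp add: carrier_poly_ring)

lemma poly_ring_mult:
  assumes "p \<in> carrier (poly_ring Vs)" "q \<in> carrier (poly_ring Vs)"
  shows "p * q \<in> carrier (poly_ring Vs)"
  unfolding carrier_poly_ring
proof
  fix m assume "m \<in> Poly_Mapping.keys (p * q)"
  then obtain a b where "m = a + b" "a \<in> Poly_Mapping.keys p" "b \<in> Poly_Mapping.keys q"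
    using keys_mult[of p q] by blast
  then show "Poly_Mapping.keys m \<subseteq> Vs"
    using assms Poly_Mapping.keys_add[of a b] unfolding carrier_poly_ring by blast
qed

lemma poly_ring_zero: "0 \<in> carrier (poly_ring Vs)" and poly_ring_one: "1 \<in> carrier (poly_ring Vs)"
  by (simp_all add: carrier_poly_ring)

lemma poly_ring_pvar: "v \<in> Vs \<Longrightarrow> pvar v \<in> carrier (poly_ring Vs)"
  by (simp add: carrier_poly_ring pvar_def)

lemma poly_ring_pconst: "pconst c \<in> carrier (poly_ring Vs)"
  by (simp add: carrier_poly_ring pconst_def)

lemma cring_poly_ring: "cring (poly_ring Vs :: (('v \<Rightarrow>\<^sub>0 nat) \<Rightarrow>\<^sub>0 'k::comm_ring_1) ring)"
proof (rule cringI)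
  show "abelian_group (poly_ring Vs :: (('v \<Rightarrow>\<^sub>0 nat) \<Rightarrow>\<^sub>0 'k) ring)"
  proof (rule abelian_groupI)
    fix p :: "('v \<Rightarrow>\<^sub>0 nat) \<Rightarrow>\<^sub>0 'k" assume "p \<in> carrier (poly_ring Vs)"
    then show "\<exists>q\<in>carrier (poly_ring Vs). q \<oplus>\<^bsub>poly_ring Vs\<^esub> p = \<zero>\<^bsub>poly_ring Vs\<^esub>"
      by (intro bexI[of _ "- p"]) (simp_all add: ops_poly_ring poly_ring_minus)
  qed (simp_all add: ops_poly_ring poly_ring_add poly_ring_zero add_ac)
  show "Group.comm_monoid (poly_ring Vs :: (('v \<Rightarrow>\<^sub>0 nat) \<Rightarrow>\<^sub>0 'k) ring)"
    by (rule comm_monoidI) (simp_all add: ops_poly_ring poly_ring_mult poly_ring_one mult_ac)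
qed (simp add: ops_poly_ring distrib_right)

lemma a_inv_poly_ring: "p \<in> carrier (poly_ring Vs) \<Longrightarrow> \<ominus>\<^bsub>poly_ring Vs\<^esub> p = - (p :: ('v \<Rightarrow>\<^sub>0 nat) \<Rightarrow>\<^sub>0 'k::comm_ring_1)"
proof -
  assume p: "p \<in> carrier (poly_ring Vs)"
  interpret cring "poly_ring Vs :: (('v \<Rightarrow>\<^sub>0 nat) \<Rightarrow>\<^sub>0 'k) ring" by (rule cring_poly_ring)
  show ?thesis by (rule minus_equality[OF _ p poly_ring_minus[OF p]]) (simp add: ops_poly_ring)
qed

lemma ideal_poly_ringI:
  fixes K :: "(('v \<Rightarrow>\<^sub>0 nat) \<Rightarrow>\<^sub>0 'k::comm_ring_1) set"
  assumes "K \<subseteq> carrier (poly_ring Vs)" "0 \<in> K" "\<And>p q. p \<in> K \<Longrightarrow> q \<in> K \<Longrightarrow> p + q \<in> K"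
    "\<And>c p. c \<in> carrier (poly_ring Vs) \<Longrightarrow> p \<in> K \<Longrightarrow> c * p \<in> K"
  shows "ideal K (poly_ring Vs)"
proof (rule idealI)
  show "Ring.ring (poly_ring Vs :: (('v \<Rightarrow>\<^sub>0 nat) \<Rightarrow>\<^sub>0 'k) ring)" using cring_poly_ring cring_def by blast
  show "subgroup K (add_monoid (poly_ring Vs))"
  proof (rule subgroup.intro)
    fix p assume p: "p \<in> K"
    have "(- 1) * p \<in> K" by (intro assms(4) p poly_ring_minus poly_ring_one)
    then show "inv\<^bsub>add_monoid (poly_ring Vs)\<^esub> p \<in> K"
      using a_inv_poly_ring[of p Vs] p assms(1) by (auto simp: a_inv_def)
  qed (use assms in \<open>auto simp: ops_poly_ring\<close>)
  fix a c :: "('v \<Rightarrow>\<^sub>0 nat) \<Rightarrow>\<^sub>0 'k" assume a: "a \<in> K" and c: "c \<in> carrier (poly_ring Vs)"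
  show "c \<otimes>\<^bsub>poly_ring Vs\<^esub> a \<in> K" using assms(4)[OF c a] by (simp add: ops_poly_ring)
  then show "a \<otimes>\<^bsub>poly_ring Vs\<^esub> c \<in> K" by (simp add: ops_poly_ring mult.commute)
qed

lemma sum_ideal:
  fixes I :: "'r::comm_ring_1 set"
  shows "0 \<in> I \<Longrightarrow> (\<And>p q. p \<in> I \<Longrightarrow> q \<in> I \<Longrightarrow> p + q \<in> I) \<Longrightarrow> (\<And>j. j \<in> J \<Longrightarrow> f j \<in> I) \<Longrightarrow> sum f J \<in> I"
  by (induction J rule: infinite_finite_induct) auto

lemma single_eq_pconst_mult: "Poly_Mapping.single m c = pconst c * Poly_Mapping.single m 1"
  by (simp add: pconst_def mult_single)

lemma pconst_add: "pconst (a + b) = pconst a + pconst b" and pconst_mult: "pconst (a * b) = pconst a * pconst b"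
  and pconst_one: "pconst 1 = 1" and pconst_zero: "pconst 0 = 0" and pconst_minus: "pconst (- a) = - pconst a"
  by (simp_all add: pconst_def single_add mult_single single_uminus)

context finite_matroid begin

section \<open>Relations in the augmented Chow ring\<close>

abbreviation "R \<equiv> aug_poly_ring E rk"
abbreviation "C \<equiv> carrier (aug_poly_ring E rk)"
abbreviation "I \<equiv> aug_ideal E rk"
abbreviation "proper F \<equiv> F \<in> proper_flats E rk"
abbreviation x :: "'a set \<Rightarrow> 'a chow_poly" where "x F \<equiv> pvar (Xvar F)"
abbreviation y :: "'a \<Rightarrow> 'a chow_poly" where "y i \<equiv> pvar (Yvar i)"

lemma C_closed:
  "p \<in> C \<Longrightarrow> q \<in> C \<Longrightarrow> p + q \<in> C" "p \<in> C \<Longrightarrow> - p \<in> C" "p \<in> C \<Longrightarrow> q \<in> C \<Longrightarrow> p * q \<in> C"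
  "0 \<in> C" "1 \<in> C" "pconst c \<in> C"
  unfolding aug_poly_ring_def
  by (auto intro: poly_ring_add poly_ring_minus poly_ring_mult poly_ring_zero poly_ring_one poly_ring_pconst)

lemma C_diff: "p \<in> C \<Longrightarrow> q \<in> C \<Longrightarrow> p - q \<in> C"
  using C_closed(1)[OF _ C_closed(2), of p q] by simp

lemma C_sum: "(\<And>j. j \<in> J \<Longrightarrow> f j \<in> C) \<Longrightarrow> sum f J \<in> C"
  by (rule sum_ideal) (auto intro: C_closed)

lemma C_power: "p \<in> C \<Longrightarrow> p ^ k \<in> C"
  by (induction k) (auto intro: C_closed)

lemma x_C: "proper F \<Longrightarrow> x F \<in> C" and y_C: "i \<in> E \<Longrightarrow> y i \<in> C"
  unfolding aug_poly_ring_def by (auto intro!: poly_ring_pvar)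

lemma proper_iff: "proper F \<longleftrightarrow> flat F \<and> F \<noteq> E" by (auto simp: proper_flats_def)

lemma finite_proper: "finite (proper_flats E rk)" using finite_flats by (simp add: proper_flats_def)

definition gens :: "'a chow_poly set" where
  "gens = {x F * x F' | F F'. proper F \<and> proper F' \<and> \<not> F \<subseteq> F' \<and> \<not> F' \<subseteq> F} \<union>
    {y i * x F | i F. i \<in> E \<and> proper F \<and> i \<notin> F} \<union>
    {y i - (\<Sum>F\<in>{F \<in> proper_flats E rk. i \<notin> F}. x F) | i. i \<in> E}"

lemma gens_C: "gens \<subseteq> C"
  by (auto simp: gens_def intro!: C_closed(3) C_diff C_sum x_C y_C)

lemma cring_R: "cring R" unfolding aug_poly_ring_def by (rule cring_poly_ring)

text \<open>The sum of the three ideals is generated by the union of their generators.\<close>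

lemma ideal_generated:
  "ideal I R" "gens \<subseteq> I" "ideal K R \<Longrightarrow> gens \<subseteq> K \<Longrightarrow> I \<subseteq> K"
proof -
  interpret R: cring R by (rule cring_R)
  define g1 where "g1 = {x F * x F' | F F'. proper F \<and> proper F' \<and> \<not> F \<subseteq> F' \<and> \<not> F' \<subseteq> F}"
  define g2 where "g2 = {y i * x F | i F. i \<in> E \<and> proper F \<and> i \<notin> F}"
  define g3 where "g3 = {y i - (\<Sum>F\<in>{F \<in> proper_flats E rk. i \<notin> F}. x F) | i. i \<in> E}"
  have g: "gens = g1 \<union> g2 \<union> g3" by (simp add: gens_def g1_def g2_def g3_def)
  have sub: "g1 \<subseteq> C" "g2 \<subseteq> C" "g3 \<subseteq> C" using gens_C by (simp_all add: g)
  have I_eq: "I = Idl\<^bsub>R\<^esub> g1 <+>\<^bsub>R\<^esub> Idl\<^bsub>R\<^esub> g2 <+>\<^bsub>R\<^esub> Idl\<^bsub>R\<^esub> g3"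
    by (simp add: aug_ideal_def aug_I1_def aug_I2_def aug_J_def g1_def g2_def g3_def)
  have id: "ideal (Idl\<^bsub>R\<^esub> g1) R" "ideal (Idl\<^bsub>R\<^esub> g2) R" "ideal (Idl\<^bsub>R\<^esub> g3) R"
    by (rule R.genideal_ideal, rule sub)+
  show "ideal I R" unfolding I_eq by (intro R.add_ideals id)
  have add: "add R = (+)" by (simp add: aug_poly_ring_def ops_poly_ring)
  have mem: "p \<in> A <+>\<^bsub>R\<^esub> B \<longleftrightarrow> (\<exists>a\<in>A. \<exists>b\<in>B. p = a + b)" for A B p
    unfolding set_add_def' add by blast
  have z: "0 \<in> Idl\<^bsub>R\<^esub> g" if "ideal (Idl\<^bsub>R\<^esub> g) R" for g
    using additive_subgroup.zero_closed[OF ideal.axioms(1)[OF that]] by (simp add: aug_poly_ring_def ops_poly_ring)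
  show "gens \<subseteq> I"
  proof
    fix p assume "p \<in> gens"
    then consider "p \<in> Idl\<^bsub>R\<^esub> g1" | "p \<in> Idl\<^bsub>R\<^esub> g2" | "p \<in> Idl\<^bsub>R\<^esub> g3"
      using R.genideal_self sub unfolding g by blast
    then have "\<exists>a\<in>Idl\<^bsub>R\<^esub> g1. \<exists>b\<in>Idl\<^bsub>R\<^esub> g2. \<exists>c\<in>Idl\<^bsub>R\<^esub> g3. p = (a + b) + c"
    proof cases
      case 1 then show ?thesis using z[OF id(2)] z[OF id(3)] by (intro bexI[of _ p] bexI[of _ 0]) auto
    next
      case 2 then show ?thesis using z[OF id(1)] z[OF id(3)] by (intro bexI[of _ p] bexI[of _ 0]) auto
    next
      case 3 then show ?thesis using z[OF id(1)] z[OF id(2)] by (intro bexI[of _ p] bexI[of _ 0]) auto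
    qed
    then obtain a b c where "a \<in> Idl\<^bsub>R\<^esub> g1" "b \<in> Idl\<^bsub>R\<^esub> g2" "c \<in> Idl\<^bsub>R\<^esub> g3" "p = (a + b) + c" by blast
    moreover from this have "a + b \<in> Idl\<^bsub>R\<^esub> g1 <+>\<^bsub>R\<^esub> Idl\<^bsub>R\<^esub> g2" using mem by blast
    ultimately show "p \<in> I" unfolding I_eq using mem[of p "Idl\<^bsub>R\<^esub> g1 <+>\<^bsub>R\<^esub> Idl\<^bsub>R\<^esub> g2"] by blast
  qed
  show "I \<subseteq> K" if K: "ideal K R" "gens \<subseteq> K"
  proof
    fix p assume "p \<in> I"
    then obtain d c where "d \<in> Idl\<^bsub>R\<^esub> g1 <+>\<^bsub>R\<^esub> Idl\<^bsub>R\<^esub> g2" "c \<in> Idl\<^bsub>R\<^esub> g3" "p = d + c"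
      unfolding I_eq using mem[of p] by blast
    moreover from this obtain a b where "a \<in> Idl\<^bsub>R\<^esub> g1" "b \<in> Idl\<^bsub>R\<^esub> g2" "d = a + b" using mem[of d] by blast
    ultimately have abc: "a \<in> Idl\<^bsub>R\<^esub> g1" "b \<in> Idl\<^bsub>R\<^esub> g2" "c \<in> Idl\<^bsub>R\<^esub> g3" "p = (a + b) + c" by simp_all
    have min: "Idl\<^bsub>R\<^esub> g \<subseteq> K" if "g \<subseteq> K" for g by (rule R.genideal_minimal[OF K(1) that])
    have "a \<in> K" "b \<in> K" "c \<in> K" using abc min[of g1] min[of g2] min[of g3] K(2) unfolding g by blast+
    then show "p \<in> K" using additive_subgroup.a_closed[OF ideal.axioms(1)[OF K(1)]] by (simp add: abc(4) add)
  qed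
qed

lemma ideal_least:
  assumes "K \<subseteq> C" "0 \<in> K" "\<And>p q. p \<in> K \<Longrightarrow> q \<in> K \<Longrightarrow> p + q \<in> K"
    "\<And>c p. c \<in> C \<Longrightarrow> p \<in> K \<Longrightarrow> c * p \<in> K" "gens \<subseteq> K"
  shows "I \<subseteq> K"
  by (rule ideal_generated(3)[OF _ assms(5)])
    (use assms(1-4) in \<open>unfold aug_poly_ring_def, intro ideal_poly_ringI, auto\<close>)

lemma I_C: "I \<subseteq> C"
  by (rule ideal_least) (use gens_C in \<open>auto intro: C_closed\<close>)

lemma I_zero: "0 \<in> I"
  using additive_subgroup.zero_closed[OF ideal.axioms(1)[OF ideal_generated(1)]] by (simp add: aug_poly_ring_def ops_poly_ring)

lemma I_add: "p \<in> I \<Longrightarrow> q \<in> I \<Longrightarrow> p + q \<in> I"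
  using additive_subgroup.a_closed[OF ideal.axioms(1)[OF ideal_generated(1)]] by (simp add: aug_poly_ring_def ops_poly_ring)

lemma I_mult: "c \<in> C \<Longrightarrow> p \<in> I \<Longrightarrow> c * p \<in> I"
  using ideal.I_l_closed[OF ideal_generated(1)] by (simp add: aug_poly_ring_def ops_poly_ring)

lemma I_mult_right: "p \<in> I \<Longrightarrow> c \<in> C \<Longrightarrow> p * c \<in> I"
  using I_mult by (simp add: mult.commute)

lemma I_minus: "p \<in> I \<Longrightarrow> - p \<in> I"
  using I_mult[OF C_closed(2)[OF C_closed(5)]] by simp

lemma I_diff: "p \<in> I \<Longrightarrow> q \<in> I \<Longrightarrow> p - q \<in> I"
  using I_add[OF _ I_minus, of p q] by simp

lemma I_sum: "(\<And>j. j \<in> J \<Longrightarrow> f j \<in> I) \<Longrightarrow> sum f J \<in> I"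
  by (rule sum_ideal) (auto intro: I_zero I_add)

lemma I_cancel: "p \<in> I \<Longrightarrow> q - p \<in> I \<Longrightarrow> q \<in> I"
  using I_add[of "q - p" p] by simp

lemma I_trans: "p - q \<in> I \<Longrightarrow> q - s \<in> I \<Longrightarrow> p - s \<in> I"
  using I_add[of "p - q" "q - s"] by simp

lemma incomparable_I: "proper F \<Longrightarrow> proper G \<Longrightarrow> \<not> F \<subseteq> G \<Longrightarrow> \<not> G \<subseteq> F \<Longrightarrow> x F * x G \<in> I"
  using ideal_generated(2) unfolding gens_def by blast

lemma y_x_I: "i \<in> E \<Longrightarrow> proper F \<Longrightarrow> i \<notin> F \<Longrightarrow> y i * x F \<in> I"
  using ideal_generated(2) unfolding gens_def by blast

text \<open>The class of a flat whose products with others of its kind span the ring; for a flat generated by an element \<open>i\<close> it is the class of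
\<open>y\<^sub>i\<close>. The difference of two such classes for comparable flats is a \<open>gap\<close>.\<close>

definition h :: "'a set \<Rightarrow> 'a chow_poly" where
  "h F = (\<Sum>G\<in>{G \<in> proper_flats E rk. \<not> F \<subseteq> G}. x G)"

definition gap :: "'a set \<Rightarrow> 'a set \<Rightarrow> 'a chow_poly" where
  "gap F G = (\<Sum>K\<in>{K \<in> proper_flats E rk. F \<subseteq> K \<and> \<not> G \<subseteq> K}. x K)"

lemma h_C: "h F \<in> C" by (auto simp: h_def intro!: C_sum x_C)

lemma h_empty: "h {} = 0" by (simp add: h_def)

lemma proper_sub: "proper F \<Longrightarrow> F \<subseteq> E" using flat_sub by (simp add: proper_iff)

lemma y_h: "i \<in> E \<Longrightarrow> y i - h (cl {i}) \<in> I"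
proof -
  assume i: "i \<in> E"
  have "{F \<in> proper_flats E rk. i \<notin> F} = {F \<in> proper_flats E rk. \<not> cl {i} \<subseteq> F}"
    using cl_min[of "{i}"] sub_cl[of "{i}"] i by (auto simp: proper_iff)
  then have eq: "y i - h (cl {i}) = y i - (\<Sum>F\<in>{F \<in> proper_flats E rk. i \<notin> F}. x F)" by (simp only: h_def)
  have "y i - h (cl {i}) \<in> gens" unfolding gens_def eq by (intro UnI2 CollectI exI[of _ i] conjI refl i)
  then show ?thesis by (rule subsetD[OF ideal_generated(2)])
qed

abbreviation join :: "'a set \<Rightarrow> 'a set \<Rightarrow> 'a set" where "join F G \<equiv> cl (F \<union> G)"

lemma join_sub_iff: "flat F \<Longrightarrow> flat G \<Longrightarrow> flat K \<Longrightarrow> join F G \<subseteq> K \<longleftrightarrow> F \<subseteq> K \<and> G \<subseteq> K"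
proof -
  assume F: "flat F" and G: "flat G" and K: "flat K"
  have "F \<union> G \<subseteq> cl (F \<union> G)" using flat_sub[OF F] flat_sub[OF G] by (intro sub_cl Un_least)
  moreover have "F \<union> G \<subseteq> K \<Longrightarrow> cl (F \<union> G) \<subseteq> K" by (rule cl_min[OF _ K])
  ultimately show ?thesis by (metis Un_subset_iff subset_trans)
qed

lemma join_flat: "flat F \<Longrightarrow> flat G \<Longrightarrow> flat (join F G)"
  using flat_sub by (intro flat_cl) auto

lemma rk_join: "flat F \<Longrightarrow> flat G \<Longrightarrow> rk (join F G) + rk (F \<inter> G) \<le> rk F + rk G"
  using rk_submod[of F G] flat_sub by (simp add: rk_cl)

lemma h_join: "flat F \<Longrightarrow> flat G \<Longrightarrow> h (join F G) = h F + gap F G"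
proof -
  assume F: "flat F" "flat G"
  let ?A = "{K \<in> proper_flats E rk. \<not> F \<subseteq> K}" and ?B = "{K \<in> proper_flats E rk. F \<subseteq> K \<and> \<not> G \<subseteq> K}"
  have eq: "{K \<in> proper_flats E rk. \<not> join F G \<subseteq> K} = ?A \<union> ?B"
  proof (rule Set.set_eqI)
    fix K
    have "proper K \<Longrightarrow> join F G \<subseteq> K \<longleftrightarrow> F \<subseteq> K \<and> G \<subseteq> K"
      using join_sub_iff[OF F, of K] by (simp only: proper_iff)
    then show "K \<in> {K \<in> proper_flats E rk. \<not> join F G \<subseteq> K} \<longleftrightarrow> K \<in> ?A \<union> ?B" by blast
  qed
  have "finite ?A" "finite ?B" using finite_proper by simp_all
  moreover have "?A \<inter> ?B = {}" by blast
  ultimately show ?thesis unfolding h_def gap_def eq by (rule sum.union_disjoint)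
qed

lemma h_diff: "flat F \<Longrightarrow> flat G \<Longrightarrow> F \<subseteq> G \<Longrightarrow> h G = h F + gap F G"
proof -
  assume F: "flat F" "flat G" "F \<subseteq> G"
  have "cl G = G" by (rule antisym[OF cl_min[OF order_refl F(2)] sub_cl[OF flat_sub[OF F(2)]]])
  then have "join F G = G" by (simp only: Un_absorb1[OF F(3)])
  then show ?thesis using h_join[OF F(1,2)] by simp
qed

text \<open>A flat above \<open>F\<close> but not \<open>G\<close> and a flat above \<open>G\<close> but not \<open>F\<close> are incomparable.\<close>

lemma gap_mult_I: "gap F G * gap G F \<in> I"
  unfolding gap_def sum_product
  by (intro I_sum incomparable_I) auto

text \<open>In factored form the relation says that the two gaps from \<open>F\<close> and \<open>G\<close> to their join multiply to zero.\<close>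

lemma h_mult_h: "flat F \<Longrightarrow> flat G \<Longrightarrow> h F * h G - (h (join F G) * h F + h (join F G) * h G - h (join F G) * h (join F G)) \<in> I"
proof -
  assume F: "flat F" "flat G"
  have 1: "h (join F G) = h F + gap F G" by (rule h_join[OF F])
  have 2: "h (join F G) = h G + gap G F" using h_join[OF F(2,1)] by (simp add: Un_commute)
  have "h F * h G - (h (join F G) * h F + h (join F G) * h G - h (join F G) * h (join F G))
      = (h (join F G) - h F) * (h (join F G) - h G)" by (simp add: algebra_simps)
  also have "\<dots> = gap F G * gap G F" by (subst 1, subst 2) simp
  finally show ?thesis using gap_mult_I by simp
qed

lemma x_h_join: "proper K \<Longrightarrow> flat G \<Longrightarrow> \<not> G \<subseteq> K \<Longrightarrow> x K * h (join K G) - x K * h G \<in> I"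
proof -
  assume K: "proper K" and G: "flat G" "\<not> G \<subseteq> K"
  have "h (join K G) = h G + gap G K" using h_join[of G K] G K by (simp add: proper_iff Un_commute)
  then have "x K * h (join K G) - x K * h G = x K * gap G K" by (simp add: algebra_simps)
  also have "\<dots> \<in> I" unfolding gap_def sum_distrib_left
    using K G by (intro I_sum incomparable_I) auto
  finally show ?thesis .
qed

lemma x_h_power_join:
  assumes K: "proper K" and G: "flat G" "\<not> G \<subseteq> K"
  shows "x K * h (join K G) ^ e - x K * h G ^ e \<in> I"
proof (induction e)
  case 0
  then show ?case by (simp add: I_zero)
next
  case (Suc e)
  have "(x K * h (join K G) ^ e - x K * h G ^ e) * h (join K G) \<in> I"
    by (intro I_mult_right Suc h_C)
  moreover have "(x K * h (join K G) - x K * h G) * h G ^ e \<in> I"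
    by (intro I_mult_right x_h_join K G C_power h_C)
  ultimately have "(x K * h (join K G) ^ e - x K * h G ^ e) * h (join K G) + (x K * h (join K G) - x K * h G) * h G ^ e \<in> I"
    by (rule I_add)
  then show ?case by (simp add: algebra_simps)
qed

lemma x_h_cover:
  assumes K: "proper K" and i: "i \<in> E" "i \<notin> K"
  shows "x K * h (cl (insert i K)) \<in> I"
proof -
  have i': "cl {i} \<subseteq> K \<longleftrightarrow> i \<in> K" using cl_min[of "{i}" K] sub_cl[of "{i}"] i K by (auto simp: proper_iff)
  have sub: "K \<subseteq> E" "{i} \<subseteq> E" "insert i K \<subseteq> E" using K i proper_sub by auto
  have fl: "flat (cl {i})" "flat K" using flat_cl[OF sub(2)] K by (auto simp: proper_iff)
  have eq: "join K (cl {i}) = cl (insert i K)"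
  proof (rule antisym)
    show "join K (cl {i}) \<subseteq> cl (insert i K)"
      using sub_cl[OF sub(3)] by (simp add: join_sub_iff[OF fl(2,1) flat_cl[OF sub(3)]] cl_min[OF _ flat_cl[OF sub(3)]])
    show "cl (insert i K) \<subseteq> join K (cl {i})"
      using sub_cl[of "K \<union> cl {i}"] sub_cl[OF sub(2)] sub(1) cl_sub[of "{i}"]
      by (intro cl_min join_flat fl) auto
  qed
  have "x K * h (cl (insert i K)) - x K * h (cl {i}) \<in> I"
    using x_h_join[OF K fl(1)] i' i by (simp add: eq)
  moreover have "x K * h (cl {i}) - x K * y i \<in> I"
    using I_mult[OF x_C[OF K] I_minus[OF y_h[OF i(1)]]] by (simp add: algebra_simps)
  ultimately have "x K * h (cl (insert i K)) - x K * y i \<in> I" by (rule I_trans)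
  moreover have "x K * y i \<in> I" using y_x_I[OF i(1) K i(2)] by (simp add: mult.commute)
  ultimately show ?thesis using I_cancel by blast
qed

text \<open>Modulo \<open>x\<^sub>K\<close>, the class of \<open>G\<close> may be replaced by that of the join of \<open>K\<close> and \<open>G\<close>. One factor is then compared with
the class of the flat generated by \<open>K\<close> and an element \<open>i\<close> of \<open>G\<close>, which annihilates \<open>x\<^sub>K\<close> because \<open>y\<^sub>i\<close> does; the
flats in the remaining gap contain \<open>K\<close> and \<open>i\<close>, so that the rank difference has dropped.\<close>

lemma x_h_power_I:
  assumes "proper K" "flat G" "flat F" "F \<subseteq> K" "F \<subseteq> G" "\<not> G \<subseteq> K" "rk G \<le> rk F + e"
  shows "x K * h G ^ e \<in> I"
  using assms
proof (induction e arbitrary: K G F)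
  case 0
  then have "F \<subset> G" by auto
  then show ?case using flat_rk_less[of F G] 0 flat_sub[of G] by auto
next
  case (Suc e)
  have fl: "flat K" "K \<subseteq> E" "G \<subseteq> E" using Suc.prems flat_sub by (auto simp: proper_iff)
  let ?U = "join K G"
  have U: "flat ?U" "K \<subseteq> ?U" "G \<subseteq> ?U" using join_flat[of K G] join_sub_iff[of K G ?U] fl Suc.prems by auto
  have "rk F \<le> rk (K \<inter> G)" using Suc.prems fl by (intro rk_mono) auto
  then have rU: "rk ?U \<le> rk K + Suc e" using rk_join[OF fl(1) Suc.prems(2)] Suc.prems(7) by linarith
  obtain i where i: "i \<in> G" "i \<notin> K" "i \<in> E" using Suc.prems(6) fl by auto
  let ?F = "cl (insert i K)"
  have sub: "insert i K \<subseteq> E" using i fl by auto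
  have KU: "insert i K \<subseteq> ?U" using U i by blast
  have F: "flat ?F" "?F \<subseteq> ?U" "insert i K \<subseteq> ?F"
    by (rule flat_cl[OF sub], rule cl_min[OF KU U(1)], rule sub_cl[OF sub])
  have "rk K < rk ?F" by (rule flat_rk_less[OF fl(1) _ cl_sub]) (use F(3) i in blast)
  then have rF: "rk ?U \<le> rk ?F + e" using rU by simp
  have hU: "h ?U = h ?F + gap ?F ?U" by (rule h_diff[OF F(1) U(1) F(2)])
  have "x K * h ?U ^ Suc e = x K * h ?F * h ?U ^ e + x K * (gap ?F ?U * h ?U ^ e)"
    by (subst power_Suc, subst (1) hU) (simp add: algebra_simps)
  also have "\<dots> \<in> I"
  proof (rule I_add)
    show "x K * h ?F * h ?U ^ e \<in> I"
      by (intro I_mult_right x_h_cover Suc.prems i C_power h_C)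
    have "gap ?F ?U * h ?U ^ e \<in> I" unfolding gap_def sum_distrib_right
    proof (rule I_sum)
      fix K' assume K': "K' \<in> {K \<in> proper_flats E rk. ?F \<subseteq> K \<and> \<not> ?U \<subseteq> K}"
      show "x K' * h ?U ^ e \<in> I"
        by (rule Suc.IH[of K' ?U ?F]) (use K' U F rF in auto)
    qed
    then show "x K * (gap ?F ?U * h ?U ^ e) \<in> I" by (rule I_mult[OF x_C[OF Suc.prems(1)]])
  qed
  finally have 1: "x K * h ?U ^ Suc e \<in> I" .
  have "x K * h ?U ^ Suc e - x K * h G ^ Suc e \<in> I" by (rule x_h_power_join[OF Suc.prems(1,2,6)])
  from I_diff[OF 1 this] show ?case by simp
qed

lemma h_power_relation:
  assumes "flat F" "flat G" "F \<subset> G"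
  shows "h F * h G ^ (rk G - rk F) - h G ^ Suc (rk G - rk F) \<in> I"
proof -
  have hG: "h G = h F + gap F G" by (rule h_diff[OF assms(1,2) psubset_imp_subset[OF assms(3)]])
  have r: "rk G \<le> rk F + (rk G - rk F)" by simp
  have "gap F G * h G ^ (rk G - rk F) \<in> I" unfolding gap_def sum_distrib_right
    by (rule I_sum, rule x_h_power_I[OF _ assms(2,1) _ psubset_imp_subset[OF assms(3)] _ r]) simp_all
  then have "- (gap F G * h G ^ (rk G - rk F)) \<in> I" by (rule I_minus)
  also have "- (gap F G * h G ^ (rk G - rk F)) = h F * h G ^ (rk G - rk F) - h G ^ Suc (rk G - rk F)"
    by (subst power_Suc, subst (3) hG) (simp add: algebra_simps)
  finally show ?thesis .
qed

lemma h_power_rk: "flat G \<Longrightarrow> G \<noteq> {} \<Longrightarrow> h G ^ Suc (rk G) \<in> I"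
  using I_minus[OF h_power_relation[OF flat_empty, of G]] by (simp add: h_empty rk_empty psubset_eq)

end

context finite_matroid begin

section \<open>Straightening into Feichtner--Yuzvinsky monomials\<close>

definition H :: "'a set multiset \<Rightarrow> 'a chow_poly" where "H q = prod_mset (image_mset h q)"

lemma H_simps [simp]: "H {#} = 1" "H (add_mset G q) = h G * H q" "H (p + q) = H p * H q"
  by (simp_all add: H_def)

lemma H_replicate [simp]: "H (replicate_mset k G) = h G ^ k" by (induction k) simp_all

lemma H_C: "H q \<in> C" by (induction q) (auto intro: C_closed h_C)

definition FY :: "nat \<Rightarrow> 'a set multiset set" where "FY i = {u. fy u \<and> size u = i}"

lemma finite_FY: "finite (FY i)"
proof (rule finite_subset)
  show "FY i \<subseteq> mset ` {xs. set xs \<subseteq> flats E rk \<and> length xs = i}"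
  proof
    fix u assume u: "u \<in> FY i"
    obtain xs where xs: "mset xs = u" using ex_mset by blast
    then have "set xs \<subseteq> flats E rk" "length xs = i" using u by (auto simp: FY_def fy_def)
    then show "u \<in> mset ` {xs. set xs \<subseteq> flats E rk \<and> length xs = i}" using xs by blast
  qed
qed (intro finite_imageI finite_lists_length_eq finite_flats)

definition comb :: "nat \<Rightarrow> ('a set multiset \<Rightarrow> rat) \<Rightarrow> 'a chow_poly" where
  "comb i a = (\<Sum>u\<in>FY i. pconst (a u) * H u)"

definition spanned :: "nat \<Rightarrow> 'a chow_poly set" where
  "spanned i = {p \<in> C. \<exists>a. p - comb i a \<in> I}"

lemma comb_add: "comb i (\<lambda>u. a u + b u) = comb i a + comb i b"
  by (simp add: comb_def pconst_add distrib_right sum.distrib)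

lemma comb_mult: "comb i (\<lambda>u. c * a u) = pconst c * comb i a"
  by (simp add: comb_def pconst_mult sum_distrib_left mult.assoc)

lemma comb_delta: "u \<in> FY i \<Longrightarrow> comb i (\<lambda>v. if v = u then 1 else 0) = H u"
proof -
  assume u: "u \<in> FY i"
  have "comb i (\<lambda>v. if v = u then 1 else 0) = (\<Sum>v\<in>FY i. if v = u then H v else 0)"
    unfolding comb_def by (rule sum.cong) (simp_all add: pconst_one pconst_zero)
  then show ?thesis using u finite_FY by simp
qed

lemma spannedI: "p \<in> C \<Longrightarrow> p - comb i a \<in> I \<Longrightarrow> p \<in> spanned i" unfolding spanned_def by blast

lemma spanned_C: "p \<in> spanned i \<Longrightarrow> p \<in> C" by (simp add: spanned_def)

lemma spanned_add: assumes "p \<in> spanned i" "q \<in> spanned i" shows "p + q \<in> spanned i"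
proof -
  obtain a b where ab: "p - comb i a \<in> I" "q - comb i b \<in> I" using assms unfolding spanned_def by blast
  have eq: "p + q - comb i (\<lambda>u. a u + b u) = (p - comb i a) + (q - comb i b)" by (simp add: comb_add)
  have "p + q - comb i (\<lambda>u. a u + b u) \<in> I" unfolding eq by (rule I_add[OF ab])
  then show ?thesis by (rule spannedI[rotated]) (intro C_closed assms[THEN spanned_C])
qed

lemma spanned_pconst: assumes "p \<in> spanned i" shows "pconst c * p \<in> spanned i"
proof -
  obtain a where a: "p - comb i a \<in> I" using assms unfolding spanned_def by blast
  have eq: "pconst c * p - comb i (\<lambda>u. c * a u) = pconst c * (p - comb i a)" by (simp add: comb_mult algebra_simps)
  have "pconst c * p - comb i (\<lambda>u. c * a u) \<in> I" unfolding eq by (rule I_mult[OF C_closed(6) a])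
  then show ?thesis by (rule spannedI[rotated]) (intro C_closed assms[THEN spanned_C])
qed

lemma spanned_I: "p \<in> I \<Longrightarrow> p \<in> spanned i"
  by (rule spannedI[of _ _ "\<lambda>_. 0"]) (use I_C in \<open>auto simp: comb_def pconst_zero\<close>)

lemma spanned_minus: "p \<in> spanned i \<Longrightarrow> - p \<in> spanned i"
  using spanned_pconst[of p i "- 1"] by (simp add: pconst_minus pconst_one)

lemma spanned_diff: "p \<in> spanned i \<Longrightarrow> q \<in> spanned i \<Longrightarrow> p - q \<in> spanned i"
  using spanned_add[of p i "- q"] spanned_minus[of q i] by simp

lemma spanned_sum: "(\<And>j. j \<in> J \<Longrightarrow> f j \<in> spanned i) \<Longrightarrow> sum f J \<in> spanned i"
  by (rule sum_ideal) (auto intro: spanned_add spanned_I I_zero)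

lemma spanned_cong: "q \<in> spanned i \<Longrightarrow> p - q \<in> I \<Longrightarrow> p \<in> spanned i"
  using spanned_add[of "p - q" i q] spanned_I[of "p - q" i] by simp

lemma spanned_FY: "u \<in> FY i \<Longrightarrow> H u \<in> spanned i"
  by (rule spannedI[of _ _ "\<lambda>v. if v = u then 1 else 0"]) (simp_all add: H_C comb_delta I_zero)

definition colevel :: "'a set multiset \<Rightarrow> nat" where "colevel q = (\<Sum>G\<in>#q. rk E - rk G)"

lemma colevel_simps [simp]: "colevel {#} = 0" "colevel (add_mset G q) = (rk E - rk G) + colevel q"
  "colevel (p + q) = colevel p + colevel q"
  by (simp_all add: colevel_def)

lemma colevel_replicate [simp]: "colevel (replicate_mset k G) = k * (rk E - rk G)"
  by (induction k) simp_all

lemma rk_less_join: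
  assumes "flat F" "flat G" "\<not> G \<subseteq> F"
  shows "rk F < rk (join F G)" "rk (join F G) \<le> rk E"
proof -
  have U: "F \<subseteq> join F G" "G \<subseteq> join F G"
    using join_sub_iff[OF assms(1,2) join_flat[OF assms(1,2)]] by simp_all
  show "rk F < rk (join F G)" by (rule flat_rk_less[OF assms(1) _ cl_sub]) (use U assms(3) in blast)
  show "rk (join F G) \<le> rk E" by (rule rk_mono[OF cl_sub order_refl])
qed

text \<open>Straightening: each violation of the conditions of \<open>fy\<close> is removed by one of the relations among the
classes \<open>h\<close>, and every replacement moves flats upwards, so that \<open>colevel\<close> decreases.\<close>

lemma H_spanned:
  assumes "\<forall>G\<in>#q. flat G \<and> G \<noteq> {}"
  shows "H q \<in> spanned (size q)"
  using assms
proof (induction "colevel q" arbitrary: q rule: less_induct)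
  case less
  consider (fy) "fy q"
    | (incomparable) F G where "F \<in># q" "G \<in># q" "\<not> F \<subseteq> G" "\<not> G \<subseteq> F"
    | (power) G where "G \<in># q" "rk G < count q G"
    | (gap) F G where "F \<in># q" "G \<in># q" "F \<subset> G" "rk G - rk F \<le> count q G"
    using less.prems unfolding fy_def not_less[symmetric] by blast
  then show ?case
  proof cases
    case fy
    then show ?thesis by (intro spanned_FY) (simp add: FY_def)
  next
    case incomparable
    have fl: "flat F" "flat G" "F \<noteq> {}" "G \<noteq> {}" using incomparable less.prems by auto
    let ?U = "join F G"
    have U: "flat ?U" "?U \<noteq> {}"
      using join_flat[OF fl(1,2)] join_sub_iff[OF fl(1,2) join_flat[OF fl(1,2)]] fl(3) by auto
    have r: "rk F < rk ?U" "rk G < rk ?U" "rk ?U \<le> rk E"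
      using rk_less_join[OF fl(1,2) incomparable(4)] rk_less_join[OF fl(2,1) incomparable(3)]
      by (simp_all add: Un_commute)
    obtain q' where q': "q = add_mset F (add_mset G q')"
      using incomparable by (metis mset_add insert_noteq_member order_refl)
    have IH: "H (add_mset A (add_mset B q')) \<in> spanned (size q)"
      if "A \<in> {F, G, ?U}" "B = ?U" for A B
    proof -
      have sz: "size (add_mset A (add_mset B q')) = size q" by (simp add: q')
      have "colevel (add_mset A (add_mset B q')) < colevel q"
        using that r by (auto simp: q')
      then have "H (add_mset A (add_mset B q')) \<in> spanned (size (add_mset A (add_mset B q')))"
        by (rule less.hyps) (use that U less.prems fl in \<open>auto simp: q'\<close>)
      then show ?thesis by (simp only: sz)
    qed
    show ?thesis
    proof (rule spanned_cong)
      show "H (add_mset F (add_mset ?U q')) + H (add_mset G (add_mset ?U q')) - H (add_mset ?U (add_mset ?U q')) \<in> spanned (size q)"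
        by (intro spanned_diff spanned_add IH) simp_all
      have "H q - (H (add_mset F (add_mset ?U q')) + H (add_mset G (add_mset ?U q')) - H (add_mset ?U (add_mset ?U q')))
         = H q' * (h F * h G - (h ?U * h F + h ?U * h G - h ?U * h ?U))"
        by (simp add: q' algebra_simps)
      also have "\<dots> \<in> I" by (intro I_mult H_C h_mult_h fl)
      finally show "H q - (H (add_mset F (add_mset ?U q')) + H (add_mset G (add_mset ?U q')) - H (add_mset ?U (add_mset ?U q'))) \<in> I" .
    qed
  next
    case power
    then have "replicate_mset (Suc (rk G)) G \<subseteq># q" using count_le_replicate_mset_subset_eq[of "Suc (rk G)" q G] by simp
    then obtain q' where q': "q = replicate_mset (Suc (rk G)) G + q'" by (rule mset_subset_eq_exists_conv[THEN iffD1, THEN exE])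
    have "h G ^ Suc (rk G) \<in> I" using power less.prems by (intro h_power_rk) auto
    then have "h G ^ Suc (rk G) * H q' \<in> I" by (rule I_mult_right[OF _ H_C])
    then show ?thesis by (intro spanned_I) (simp only: q' H_simps H_replicate)
  next
    case gap
    let ?d = "rk G - rk F"
    have fl: "flat F" "flat G" "G \<noteq> {}" using gap less.prems by auto
    have "rk F < rk G" by (rule flat_rk_less[OF fl(1) gap(3) flat_sub[OF fl(2)]])
    have "add_mset F (replicate_mset ?d G) \<subseteq># q"
    proof (rule mset_subset_eqI)
      fix A show "count (add_mset F (replicate_mset ?d G)) A \<le> count q A"
        using gap by (auto simp: Suc_le_eq)
    qed
    then obtain q' where q': "q = add_mset F (replicate_mset ?d G) + q'" by (rule mset_subset_eq_exists_conv[THEN iffD1, THEN exE])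
    let ?q = "replicate_mset (Suc ?d) G + q'"
    have "rk G \<le> rk E" by (rule rk_mono[OF flat_sub[OF fl(2)] order_refl])
    then have "colevel ?q < colevel q" using \<open>rk F < rk G\<close> by (simp add: q')
    then have "H ?q \<in> spanned (size ?q)" by (rule less.hyps) (use less.prems fl in \<open>auto simp: q' split: if_splits\<close>)
    moreover have "size ?q = size q" by (simp add: q')
    ultimately have IH: "H ?q \<in> spanned (size q)" by (simp only:)
    show ?thesis
    proof (rule spanned_cong[OF IH])
      have "H q - H ?q = (h F * h G ^ ?d - h G ^ Suc ?d) * H q'" by (simp add: q' algebra_simps)
      also have "\<dots> \<in> I" by (intro I_mult_right H_C h_power_relation fl gap(3))
      finally show "H q - H ?q \<in> I" .
    qed
  qed
qed

lemma h_mult_spanned: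
  assumes "flat G" "p \<in> spanned i"
  shows "h G * p \<in> spanned (Suc i)"
proof (cases "G = {}")
  case True
  then show ?thesis by (simp add: h_empty spanned_I I_zero)
next
  case False
  obtain a where a: "p - comb i a \<in> I" using assms(2) unfolding spanned_def by blast
  show ?thesis
  proof (rule spanned_cong)
    show "h G * comb i a \<in> spanned (Suc i)" unfolding comb_def sum_distrib_left
    proof (rule spanned_sum)
      fix u assume u: "u \<in> FY i"
      have "H (add_mset G u) \<in> spanned (size (add_mset G u))"
        by (rule H_spanned) (use u False assms in \<open>auto simp: FY_def fy_def\<close>)
      then have "pconst (a u) * H (add_mset G u) \<in> spanned (Suc i)" using u by (intro spanned_pconst) (simp add: FY_def)
      then show "h G * (pconst (a u) * H u) \<in> spanned (Suc i)" by (simp add: mult.left_commute)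
    qed
    have "h G * p - h G * comb i a = h G * (p - comb i a)" by (simp add: algebra_simps)
    then show "h G * p - h G * comb i a \<in> I" using I_mult[OF h_C a] by simp
  qed
qed

text \<open>The class \<open>x\<^sub>F\<close> is expressed through \<open>h\<close> and the variables of larger flats by Moebius inversion, one step at a
time.\<close>

lemma x_mult_spanned:
  assumes "proper F" "p \<in> spanned i"
  shows "x F * p \<in> spanned (Suc i)"
  using assms(1)
proof (induction "card (E - F)" arbitrary: F rule: less_induct)
  case less
  let ?B = "{G \<in> proper_flats E rk. F \<subset> G}"
  have fl: "flat F" "F \<noteq> E" using less.prems by (auto simp: proper_iff)
  have 1: "h E = (\<Sum>G\<in>proper_flats E rk. x G)"
  proof -
    have "\<not> E \<subseteq> G" if "proper G" for G using proper_sub[OF that] that unfolding proper_iff by blast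
    then have "{G \<in> proper_flats E rk. \<not> E \<subseteq> G} = proper_flats E rk" by blast
    then show ?thesis by (simp only: h_def)
  qed
  have split: "proper_flats E rk = {G \<in> proper_flats E rk. \<not> F \<subseteq> G} \<union> insert F ?B" using less.prems by auto
  have "(\<Sum>G\<in>{G \<in> proper_flats E rk. \<not> F \<subseteq> G} \<union> insert F ?B. x G) = h F + (\<Sum>G\<in>insert F ?B. x G)"
    unfolding h_def by (rule sum.union_disjoint) (use finite_proper in auto)
  also have "(\<Sum>G\<in>insert F ?B. x G) = x F + (\<Sum>G\<in>?B. x G)"
    by (rule sum.insert) (use finite_proper in auto)
  finally have "h E = h F + (x F + (\<Sum>G\<in>?B. x G))" using 1 split by simp
  then have eq: "x F = h E - h F - (\<Sum>G\<in>?B. x G)" by simp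
  have "x F * p = h E * p - h F * p - (\<Sum>G\<in>?B. x G * p)"
    by (subst eq) (simp add: left_diff_distrib sum_distrib_right)
  also have "\<dots> \<in> spanned (Suc i)"
  proof (intro spanned_diff spanned_sum h_mult_spanned fl flat_E assms(2))
    fix G assume G: "G \<in> ?B"
    then have "E - G \<subset> E - F" using proper_sub[of G] by blast
    then have "card (E - G) < card (E - F)" using finite_E by (intro psubset_card_mono) auto
    then show "x G * p \<in> spanned (Suc i)" by (rule less.hyps) (use G in blast)
  qed
  finally show ?case .
qed

lemma y_mult_spanned:
  assumes "i \<in> E" "p \<in> spanned k"
  shows "y i * p \<in> spanned (Suc k)"
proof (rule spanned_cong)
  show "h (cl {i}) * p \<in> spanned (Suc k)"
    by (rule h_mult_spanned[OF flat_cl assms(2)]) (use assms in auto)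
  show "y i * p - h (cl {i}) * p \<in> I"
    using I_mult_right[OF y_h[OF assms(1)] spanned_C[OF assms(2)]] by (simp add: algebra_simps)
qed

lemma fy_empty: "fy {#}" by (simp add: fy_def)

lemma monomial_spanned:
  assumes "Poly_Mapping.keys m \<subseteq> Xvar ` proper_flats E rk \<union> Yvar ` E"
    and "(\<Sum>v\<in>Poly_Mapping.keys m. Poly_Mapping.lookup m v) = i"
  shows "Poly_Mapping.single m 1 \<in> spanned i"
  using assms
proof (induction i arbitrary: m)
  case 0
  then have "m = 0" by (auto intro!: poly_mapping_eqI simp: in_keys_iff)
  moreover have "H {#} \<in> spanned 0" by (rule spanned_FY) (simp add: FY_def fy_empty)
  ultimately show ?case by simp
next
  case (Suc i)
  then obtain v where v: "v \<in> Poly_Mapping.keys m" by (metis sum.empty all_not_in_conv Zero_not_Suc)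
  define m' where "m' = m - Poly_Mapping.single v 1"
  have l: "Poly_Mapping.lookup m' w = Poly_Mapping.lookup m w - (if w = v then 1 else 0)" for w
    by (simp add: m'_def lookup_minus lookup_single when_def)
  have lv: "Poly_Mapping.lookup m v \<noteq> 0" using v by (simp add: in_keys_iff)
  have m: "m = Poly_Mapping.single v 1 + m'"
    by (rule poly_mapping_eqI) (use lv in \<open>auto simp: lookup_add l lookup_single when_def\<close>)
  have keys: "Poly_Mapping.keys m' \<subseteq> Poly_Mapping.keys m" by (auto simp: in_keys_iff l split: if_splits)
  have "(\<Sum>w\<in>Poly_Mapping.keys m'. Poly_Mapping.lookup m' w) = (\<Sum>w\<in>Poly_Mapping.keys m. Poly_Mapping.lookup m' w)"
    by (rule sum.mono_neutral_left) (use keys in \<open>auto simp: in_keys_iff\<close>)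
  moreover have "(\<Sum>w\<in>Poly_Mapping.keys m. Poly_Mapping.lookup m w)
      = (\<Sum>w\<in>Poly_Mapping.keys m. (if w = v then 1 else 0) + Poly_Mapping.lookup m' w)"
    by (rule sum.cong) (use lv in \<open>auto simp: l\<close>)
  moreover have "\<dots> = 1 + (\<Sum>w\<in>Poly_Mapping.keys m. Poly_Mapping.lookup m' w)"
    using v by (simp add: sum.distrib)
  ultimately have "(\<Sum>w\<in>Poly_Mapping.keys m'. Poly_Mapping.lookup m' w) = i" using Suc.prems(2) by linarith
  then have IH: "Poly_Mapping.single m' 1 \<in> spanned i" by (intro Suc.IH subset_trans[OF keys Suc.prems(1)])
  have eq: "Poly_Mapping.single m 1 = (pvar v * Poly_Mapping.single m' 1 :: 'a chow_poly)"
    by (subst m) (simp add: pvar_def mult_single)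
  have "v \<in> Xvar ` proper_flats E rk \<union> Yvar ` E" using v Suc.prems(1) by blast
  then show ?case unfolding eq using x_mult_spanned[OF _ IH] y_mult_spanned[OF _ IH] by blast
qed

lemma homogeneous_spanned:
  assumes "p \<in> C" "homogeneous i p"
  shows "p \<in> spanned i"
proof -
  have "(\<Sum>m\<in>Poly_Mapping.keys p. pconst (Poly_Mapping.lookup p m) * Poly_Mapping.single m 1) \<in> spanned i"
  proof (intro spanned_sum spanned_pconst monomial_spanned)
    fix m assume m: "m \<in> Poly_Mapping.keys p"
    show "Poly_Mapping.keys m \<subseteq> Xvar ` proper_flats E rk \<union> Yvar ` E"
      using assms(1) m by (simp add: aug_poly_ring_def carrier_poly_ring)
    show "(\<Sum>v\<in>Poly_Mapping.keys m. Poly_Mapping.lookup m v) = i" using assms(2) m by (simp add: homogeneous_def)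
  qed
  then show ?thesis by (simp only: single_eq_pconst_mult[symmetric] sum_singles)
qed

end

section \<open>Substitution into polynomials\<close>

definition mon_eval :: "('v \<Rightarrow> 'r::comm_ring_1) \<Rightarrow> ('v \<Rightarrow>\<^sub>0 nat) \<Rightarrow> 'r" where
  "mon_eval X m = (\<Prod>v\<in>Poly_Mapping.keys m. X v ^ Poly_Mapping.lookup m v)"

lemma mon_eval_superset:
  assumes "finite S" "Poly_Mapping.keys m \<subseteq> S"
  shows "mon_eval X m = (\<Prod>v\<in>S. X v ^ Poly_Mapping.lookup m v)"
  unfolding mon_eval_def by (rule prod.mono_neutral_left) (use assms in \<open>auto simp: in_keys_iff\<close>)

lemma mon_eval_add: "mon_eval X (m + n) = mon_eval X m * mon_eval X n"
proof -
  let ?S = "Poly_Mapping.keys m \<union> Poly_Mapping.keys n"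
  have "mon_eval X (m + n) = (\<Prod>v\<in>?S. X v ^ Poly_Mapping.lookup (m + n) v)"
    by (rule mon_eval_superset) (use Poly_Mapping.keys_add[of m n] in auto)
  also have "\<dots> = (\<Prod>v\<in>?S. X v ^ Poly_Mapping.lookup m v) * (\<Prod>v\<in>?S. X v ^ Poly_Mapping.lookup n v)"
    by (simp add: lookup_add power_add prod.distrib)
  finally show ?thesis by (simp add: mon_eval_superset[of ?S])
qed

lemma mon_eval_single: "mon_eval X (Poly_Mapping.single v k) = X v ^ k"
  by (simp add: mon_eval_def)

definition poly_eval :: "('v \<Rightarrow> ('b::comm_monoid_add \<Rightarrow>\<^sub>0 'k::comm_ring_1)) \<Rightarrow> (('v \<Rightarrow>\<^sub>0 nat) \<Rightarrow>\<^sub>0 'k) \<Rightarrow> ('b \<Rightarrow>\<^sub>0 'k)" where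
  "poly_eval X p = (\<Sum>m\<in>Poly_Mapping.keys p. Poly_Mapping.single 0 (Poly_Mapping.lookup p m) * mon_eval X m)"

lemma poly_eval_add: "poly_eval X (p + q) = poly_eval X p + poly_eval X q"
  unfolding poly_eval_def by (rule setsum_keys_plus_distrib) (simp_all add: single_add distrib_right)

lemma poly_eval_single: "poly_eval X (Poly_Mapping.single m c) = Poly_Mapping.single 0 c * mon_eval X m"
  by (simp add: poly_eval_def)

lemma poly_eval_zero: "poly_eval X 0 = 0" by (simp add: poly_eval_def)

lemma poly_eval_minus: "poly_eval X (- p) = - poly_eval X p"
  using poly_eval_add[of X p "- p"] by (simp add: poly_eval_zero eq_neg_iff_add_eq_0 add.commute)

lemma poly_eval_diff: "poly_eval X (p - q) = poly_eval X p - poly_eval X q"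
  using poly_eval_add[of X p "- q"] by (simp add: poly_eval_minus)

lemma poly_eval_sum: "poly_eval X (sum f J) = (\<Sum>j\<in>J. poly_eval X (f j))"
  by (induction J rule: infinite_finite_induct) (simp_all add: poly_eval_zero poly_eval_add)

lemma single_zero_mult: "Poly_Mapping.single 0 (c * d) =
    (Poly_Mapping.single 0 c * Poly_Mapping.single 0 d :: 'b::comm_monoid_add \<Rightarrow>\<^sub>0 'k::comm_ring_1)"
  by (simp add: mult_single)

lemma poly_eval_mult: "poly_eval X (p * q) = poly_eval X p * poly_eval X q"
proof (rule pm_additive_eq[of "\<lambda>p. poly_eval X (p * q)" "\<lambda>p. poly_eval X p * poly_eval X q"])
  fix m c
  show "poly_eval X (Poly_Mapping.single m c * q) = poly_eval X (Poly_Mapping.single m c) * poly_eval X q"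
  proof (rule pm_additive_eq[of "\<lambda>q. poly_eval X (Poly_Mapping.single m c * q)" "\<lambda>q. poly_eval X (Poly_Mapping.single m c) * poly_eval X q"])
    fix n d
    have "Poly_Mapping.single m c * Poly_Mapping.single n d = Poly_Mapping.single (m + n) (c * d)"
      by (rule mult_single)
    then show "poly_eval X (Poly_Mapping.single m c * Poly_Mapping.single n d)
        = poly_eval X (Poly_Mapping.single m c) * poly_eval X (Poly_Mapping.single n d)"
      by (simp only: poly_eval_single mon_eval_add single_zero_mult mult_ac)
  qed (simp_all add: poly_eval_add distrib_left)
qed (simp_all add: poly_eval_add distrib_right)

lemma poly_eval_one: "poly_eval X 1 = 1"
  by (simp add: poly_eval_single[of X 0 1, unfolded single_one] mon_eval_def)

lemma poly_eval_pvar: "poly_eval X (pvar v) = X v"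
  by (simp add: pvar_def poly_eval_single mon_eval_single)

lemma poly_eval_pconst: "poly_eval X (pconst c) = Poly_Mapping.single 0 c"
  by (simp add: pconst_def poly_eval_single mon_eval_def)

context finite_matroid begin

section \<open>The degree map\<close>

abbreviation mono1 :: "'a set multiset \<Rightarrow> 'a set multiset \<Rightarrow>\<^sub>0 rat" where "mono1 q \<equiv> Poly_Mapping.single q 1"

definition Deg :: "('a set multiset \<Rightarrow>\<^sub>0 rat) \<Rightarrow> rat" where "Deg = lin_ext (deg E)"

lemma Deg_simps: "Deg (p + q) = Deg p + Deg q" "Deg (p - q) = Deg p - Deg q" "Deg (- p) = - Deg p"
  "Deg 0 = 0" "Deg (Poly_Mapping.single s c) = c * deg E s" "Deg (sum f J) = (\<Sum>j\<in>J. Deg (f j))"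
  by (simp_all add: Deg_def lin_ext_add lin_ext_diff lin_ext_minus lin_ext_sum)

lemma Deg_eq_zeroI:
  assumes "\<And>q. Deg (p * mono1 q) = 0"
  shows "Deg (p * w) = 0"
proof -
  have "Deg (p * Poly_Mapping.single q c) = 0" for q c
  proof -
    have "p * Poly_Mapping.single q c = Poly_Mapping.single 0 c * (p * mono1 q)"
      by (metis mult.left_commute mult_single add_0 mult.right_neutral)
    moreover have "lin_ext (deg E) (Poly_Mapping.single 0 c * (p * mono1 q)) = c * lin_ext (deg E) (p * mono1 q)"
      by (subst lin_ext_mult) simp
    ultimately show ?thesis using assms[of q] by (simp add: Deg_def)
  qed
  then show ?thesis
    using pm_additive_eq[of "\<lambda>w. Deg (p * w)" "\<lambda>w. 0" w] by (simp add: distrib_left Deg_simps)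
qed

lemma below_moebius_exists:
  fixes g :: "'a set \<Rightarrow> 'c::ab_group_add"
  shows "\<exists>\<xi>. \<forall>N\<in>flats E rk. (\<Sum>G\<in>{G \<in> flats E rk. N \<subseteq> G}. \<xi> G) = g N"
proof (rule moebius_inverse_exists[OF finite_flats, of "\<lambda>G N. N \<subseteq> G" "\<lambda>G. card (E - G)"])
  fix G N assume "flat G" "flat N" "N \<subseteq> G" "G \<noteq> N"
  then have "E - G \<subset> E - N" using flat_sub[of G] by blast
  then show "card (E - G) < card (E - N)" using finite_E by (intro psubset_card_mono) auto
qed simp

lemma above_moebius_unique:
  fixes \<xi> :: "'a set \<Rightarrow> 'c::ab_group_add"
  assumes "F \<in> \<F>" "\<F> \<subseteq> flats E rk"
    "\<And>N. N \<in> \<F> \<Longrightarrow> (\<Sum>G\<in>{G \<in> \<F>. N \<subseteq> G}. \<xi> G) = (\<Sum>G\<in>{G \<in> \<F>. N \<subseteq> G}. \<xi>' G)"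
  shows "\<xi> F = \<xi>' F"
proof (rule moebius_inverse_unique[of \<F> "\<lambda>G N. N \<subseteq> G" "\<lambda>G. card (E - G)" \<xi> \<xi>'])
  show "finite \<F>" using assms(2) finite_flats finite_subset by blast
  fix G N assume "G \<in> \<F>" "N \<in> \<F>" "N \<subseteq> G" "G \<noteq> N"
  then have "E - G \<subset> E - N" using flat_sub[of G] assms(2) by blast
  then show "card (E - G) < card (E - N)" using finite_E by (intro psubset_card_mono) auto
qed (use assms in simp_all)

text \<open>The image of the variable of a flat in the algebra whose basis consists of formal products of classes \<open>h\<close>:
the Moebius inverse of the linear relation that expresses the class of \<open>N\<close> by variables. The value at \<open>E\<close>,
which has no variable, closes the system so that the sum over all flats vanishes.\<close>

definition X :: "'a set \<Rightarrow> 'a set multiset \<Rightarrow>\<^sub>0 rat" where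
  "X = (SOME X. \<forall>N\<in>flats E rk. (\<Sum>G\<in>{G \<in> flats E rk. N \<subseteq> G}. X G) = (if N = {} then 0 else - mono1 {#N#}))"

lemma sum_X: "flat N \<Longrightarrow> (\<Sum>G\<in>{G \<in> flats E rk. N \<subseteq> G}. X G) = (if N = {} then 0 else - mono1 {#N#})"
  using someI_ex[OF below_moebius_exists[of "\<lambda>N. if N = {} then 0 else - mono1 {#N#}"]] unfolding X_def by blast

lemma sum_X_not_above:
  assumes "flat N" "N \<noteq> {}"
  shows "(\<Sum>G\<in>{G \<in> proper_flats E rk. \<not> N \<subseteq> G}. X G) = mono1 {#N#}"
proof -
  have NE: "N \<subseteq> E" by (rule flat_sub[OF assms(1)])
  have "(\<Sum>G\<in>flats E rk. X G) = 0" using sum_X[OF flat_empty] by simp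
  moreover have "flats E rk = {G \<in> proper_flats E rk. \<not> N \<subseteq> G} \<union> {G \<in> flats E rk. N \<subseteq> G}"
    using NE unfolding proper_flats_def by blast
  moreover have "(\<Sum>G\<in>{G \<in> proper_flats E rk. \<not> N \<subseteq> G} \<union> {G \<in> flats E rk. N \<subseteq> G}. X G)
    = (\<Sum>G\<in>{G \<in> proper_flats E rk. \<not> N \<subseteq> G}. X G) + (\<Sum>G\<in>{G \<in> flats E rk. N \<subseteq> G}. X G)"
    by (rule sum.union_disjoint) (use finite_flats finite_proper in auto)
  ultimately have "(\<Sum>G\<in>{G \<in> proper_flats E rk. \<not> N \<subseteq> G}. X G) + (\<Sum>G\<in>{G \<in> flats E rk. N \<subseteq> G}. X G) = 0" by simp
  then show ?thesis using sum_X[OF assms(1)] assms(2) by simp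
qed

definition good :: "'a set multiset \<Rightarrow> bool" where
  "good q \<longleftrightarrow> (\<forall>G\<in>#q. G \<subseteq> E) \<and> Suc (size q) = rk E \<and> rado q"

lemma deg_add: "flat N \<Longrightarrow> deg E (add_mset N q) = (if good q \<and> \<not> N \<subseteq> max_tight q then 1 else 0)"
  using flat_sub[of N] by (simp add: deg_def good_def rado_add_iff)

text \<open>Both sides have the same sums over the flats above each \<open>N\<close>, by the description of the degree of a product
with one further factor.\<close>

lemma Deg_X:
  assumes F: "proper F"
  shows "Deg (X F * mono1 q) = (if good q \<and> max_tight q = F then 1 else 0)"
proof -
  have fl: "flat F" "F \<noteq> E" using F by (auto simp: proper_iff)
  define \<xi>' :: "'a set \<Rightarrow> rat" where "\<xi>' G = (if good q then (if G = max_tight q then 1 else 0) - (if G = E then 1 else 0) else 0)" for G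
  have "Deg (X F * mono1 q) = \<xi>' F"
  proof (rule above_moebius_unique[of F "flats E rk" "\<lambda>F. Deg (X F * mono1 q)", OF fl(1) order_refl])
    fix N assume N: "flat N"
    have NE: "N \<subseteq> E" by (rule flat_sub[OF N])
    have "(\<Sum>G\<in>{G \<in> flats E rk. N \<subseteq> G}. Deg (X G * mono1 q)) = Deg ((\<Sum>G\<in>{G \<in> flats E rk. N \<subseteq> G}. X G) * mono1 q)"
      by (simp add: Deg_simps sum_distrib_right)
    also have "\<dots> = (if N = {} then 0 else - deg E (add_mset N q))"
      by (simp add: sum_X[OF N] Deg_simps mult_single)
    also have "\<dots> = (if good q \<and> \<not> N \<subseteq> max_tight q then - 1 else 0)"
      using deg_add[OF N, of q] by auto
    also have "\<dots> = (\<Sum>G\<in>{G \<in> flats E rk. N \<subseteq> G}. \<xi>' G)"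
    proof (cases "good q")
      case True
      let ?A = "{G \<in> flats E rk. N \<subseteq> G}"
      have fin: "finite ?A" using finite_flats by simp
      have flN: "flat (max_tight q)" using True flat_max_tight by (simp add: good_def)
      have "(\<Sum>G\<in>?A. \<xi>' G) = (\<Sum>G\<in>?A. if G = max_tight q then 1 else 0) - (\<Sum>G\<in>?A. if G = E then 1 else 0)"
        using True by (simp only: \<xi>'_def if_True sum_subtractf)
      also have "\<dots> = (if max_tight q \<in> ?A then 1 else 0) - (if E \<in> ?A then 1 else 0)"
        by (simp only: sum.delta'[OF fin] sum.delta[OF fin])
      finally show ?thesis using True N NE flN flat_E by simp
    qed (simp add: \<xi>'_def)
    finally show "(\<Sum>G\<in>{G \<in> flats E rk. N \<subseteq> G}. Deg (X G * mono1 q)) = (\<Sum>G\<in>{G \<in> flats E rk. N \<subseteq> G}. \<xi>' G)" .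
  qed
  then show ?thesis using fl(2) by (simp add: \<xi>'_def)
qed

lemma good_rado: "good q \<Longrightarrow> rado q" by (simp add: good_def)

lemma Deg_X_X_aux:
  assumes F: "proper F" "proper F'" "\<not> F' \<subseteq> F" and ne: "\<not> (rado q \<and> max_tight q = F)"
  shows "Deg (X F * X F' * mono1 q) = 0"
proof -
  let ?U = "{G \<in> flats E rk. F' \<subseteq> G}"
  have "Deg (X F * X F' * mono1 q) = (\<lambda>_. 0 :: rat) F'"
  proof (rule above_moebius_unique[of F' ?U "\<lambda>G. Deg (X F * X G * mono1 q)" "\<lambda>_. 0"])
    show "F' \<in> ?U" using F(2) by (simp add: proper_iff)
    fix N assume N: "N \<in> ?U"
    then have flN: "flat N" and F'N: "F' \<subseteq> N" by auto
    have eq: "{G \<in> ?U. N \<subseteq> G} = {G \<in> flats E rk. N \<subseteq> G}" using F'N by blast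
    have "(\<Sum>G\<in>{G \<in> flats E rk. N \<subseteq> G}. Deg (X F * X G * mono1 q)) = Deg (X F * (\<Sum>G\<in>{G \<in> flats E rk. N \<subseteq> G}. X G) * mono1 q)"
      by (simp add: Deg_simps sum_distrib_right sum_distrib_left)
    also have "\<dots> = (if N = {} then 0 else - Deg (X F * mono1 (add_mset N q)))"
      by (simp add: sum_X[OF flN] Deg_simps mult.assoc mult_single)
    also have "\<dots> = 0"
    proof -
      have "\<not> (good (add_mset N q) \<and> max_tight (add_mset N q) = F)"
      proof
        assume g: "good (add_mset N q) \<and> max_tight (add_mset N q) = F"
        then have r: "rado (add_mset N q)" by (simp add: good_def)
        then have "rado q" using rado_add_mset by blast
        then have "F \<noteq> max_tight q" using ne by auto
        then have "N \<subseteq> F" using max_tight_add_cases[OF r, of F] g by blast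
        then show False using F'N F(3) by blast
      qed
      then show ?thesis by (simp only: Deg_X[OF F(1)] if_False neg_0_equal_iff_equal) simp
    qed
    finally show "(\<Sum>G\<in>{G \<in> ?U. N \<subseteq> G}. Deg (X F * X G * mono1 q)) = (\<Sum>G\<in>{G \<in> ?U. N \<subseteq> G}. 0)"
      unfolding eq by simp
  qed simp
  then show ?thesis by simp
qed

lemma Deg_X_X:
  assumes "proper F" "proper F'" "\<not> F \<subseteq> F'" "\<not> F' \<subseteq> F"
  shows "Deg (X F * X F' * mono1 q) = 0"
proof (cases "rado q \<and> max_tight q = F")
  case True
  then have "\<not> (rado q \<and> max_tight q = F')" using assms(3) by auto
  then have "Deg (X F' * X F * mono1 q) = 0" by (rule Deg_X_X_aux[OF assms(2,1,3)])
  then show ?thesis by (simp add: mult.commute)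
qed (rule Deg_X_X_aux[OF assms(1,2,4)])

lemma Deg_y_X:
  assumes i: "i \<in> E" and F: "proper F" "i \<notin> F"
  shows "Deg (mono1 {#cl {i}#} * X F * mono1 q) = 0"
proof -
  have "mono1 {#cl {i}#} * X F * mono1 q = X F * mono1 (add_mset (cl {i}) q)"
    by (simp add: mult.assoc mult.left_commute mult_single)
  moreover have "\<not> (good (add_mset (cl {i}) q) \<and> max_tight (add_mset (cl {i}) q) = F)"
    using element_in_max_tight_add[of i q] i F(2) good_rado by blast
  ultimately show ?thesis by (simp only: Deg_X[OF F(1)] if_False)
qed

fun chow_image :: "'a chow_var \<Rightarrow> 'a set multiset \<Rightarrow>\<^sub>0 rat" where
  "chow_image (Xvar F) = X F"
| "chow_image (Yvar i) = mono1 {#cl {i}#}"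

abbreviation "\<theta> \<equiv> poly_eval chow_image"

lemma cl_singleton: assumes "i \<in> E" shows "flat (cl {i})" "cl {i} \<noteq> {}" "i \<in> cl {i}"
  using flat_cl[of "{i}"] sub_cl[of "{i}"] assms by auto

text \<open>The degree of formal products descends to the ring: the linear relations map to zero by construction
of \<open>X\<close>, and the two families of quadratic relations pair to zero with every monomial. The elements that
pair to zero with everything form an ideal, so it suffices to test generators.\<close>

lemma Deg_ideal:
  assumes "p \<in> I"
  shows "Deg (\<theta> p * w) = 0"
proof -
  let ?K = "{p \<in> C. \<forall>w. Deg (\<theta> p * w) = 0}"
  have "I \<subseteq> ?K"
  proof (rule ideal_least)
    fix c p assume c: "c \<in> C" and p: "p \<in> ?K"
    have "Deg (\<theta> (c * p) * w) = 0" for w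
    proof -
      have "\<theta> (c * p) * w = \<theta> p * (\<theta> c * w)" by (simp add: poly_eval_mult mult_ac)
      then show ?thesis using p by simp
    qed
    then show "c * p \<in> ?K" using C_closed(3)[OF c] p by blast
  next
    fix p q assume "p \<in> ?K" "q \<in> ?K"
    then show "p + q \<in> ?K" by (simp add: C_closed poly_eval_add distrib_right Deg_simps)
  next
    show "gens \<subseteq> ?K"
    proof
      fix g assume g: "g \<in> gens"
      have "Deg (\<theta> g * w) = 0" for w
      proof -
        consider F F' where "g = x F * x F'" "proper F" "proper F'" "\<not> F \<subseteq> F'" "\<not> F' \<subseteq> F"
          | i F where "g = y i * x F" "i \<in> E" "proper F" "i \<notin> F"
          | i where "g = y i - (\<Sum>F\<in>{F \<in> proper_flats E rk. i \<notin> F}. x F)" "i \<in> E"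
          using g unfolding gens_def by blast
        then show ?thesis
        proof cases
          case 1
          then have "\<theta> g = X F * X F'" by (simp add: poly_eval_mult poly_eval_pvar)
          then show ?thesis using Deg_eq_zeroI Deg_X_X[OF 1(2-5)] by simp
        next
          case 2
          then have "\<theta> g = mono1 {#cl {i}#} * X F" by (simp add: poly_eval_mult poly_eval_pvar)
          then show ?thesis using Deg_eq_zeroI Deg_y_X[OF 2(2-4)] by simp
        next
          case 3
          have "i \<notin> F \<longleftrightarrow> \<not> cl {i} \<subseteq> F" if "proper F" for F
            using cl_min[of "{i}" F] cl_singleton(3)[OF 3(2)] that by (auto simp: proper_iff)
          then have "{F \<in> proper_flats E rk. i \<notin> F} = {F \<in> proper_flats E rk. \<not> cl {i} \<subseteq> F}" by blast
          then have "\<theta> g = mono1 {#cl {i}#} - (\<Sum>F\<in>{F \<in> proper_flats E rk. \<not> cl {i} \<subseteq> F}. X F)"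
            by (simp add: 3(1) poly_eval_diff poly_eval_sum poly_eval_pvar)
          then have "\<theta> g = 0" using sum_X_not_above[OF cl_singleton(1,2)[OF 3(2)]] by simp
          then show ?thesis by (simp add: Deg_simps)
        qed
      qed
      then show "g \<in> ?K" using g gens_C by blast
    qed
  qed (auto simp: C_closed poly_eval_zero Deg_simps)
  then show ?thesis using assms by blast
qed

lemma \<theta>_h: "flat F \<Longrightarrow> F \<noteq> {} \<Longrightarrow> \<theta> (h F) = mono1 {#F#}"
  by (simp add: h_def poly_eval_sum poly_eval_pvar sum_X_not_above)

lemma \<theta>_H: "\<forall>G\<in>#q. flat G \<and> G \<noteq> {} \<Longrightarrow> \<theta> (H q) = mono1 q"
  by (induction q) (simp_all add: poly_eval_one poly_eval_mult \<theta>_h mult_single)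

lemma size_fy: "fy u \<Longrightarrow> size u \<le> rk E"
  using test_functional_exists[OF flat_E, of u] by (auto simp: fy_def dest: flat_sub)

text \<open>In a relation among the monomials, the one of least weight is detected by its test functional, which
vanishes on the others of the relation.\<close>

lemma comb_independent:
  assumes "comb i a \<in> I" "u \<in> FY i"
  shows "a u = 0"
proof (rule ccontr)
  assume "a u \<noteq> 0"
  define S where "S = {u \<in> FY i. a u \<noteq> 0}"
  have "\<exists>u. u \<in> S \<and> (\<forall>v. v \<in> S \<longrightarrow> wt u \<le> wt v)"
    using assms(2) \<open>a u \<noteq> 0\<close> ex_has_least_nat[of "\<lambda>u. u \<in> S" u wt] by (auto simp: S_def)
  then obtain u' where u': "u' \<in> S" "\<And>v. v \<in> S \<Longrightarrow> wt u' \<le> wt v" by blast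
  have fl: "\<forall>G\<in>#v. flat G \<and> G \<noteq> {}" "\<forall>G\<in>#v. flat G \<and> G \<subseteq> E" "\<forall>G\<in>#v. G \<subseteq> E" "size v = i" if "v \<in> FY i" for v
    using that flat_sub by (auto simp: FY_def fy_def)
  have u'FY: "u' \<in> FY i" "fy u'" "a u' \<noteq> 0" using u'(1) by (auto simp: S_def FY_def)
  obtain v where v: "lin_ext (\<lambda>s. deg E (s + u')) v \<noteq> 0"
    "\<forall>q. (\<forall>G\<in>#q. flat G \<and> G \<subseteq> E) \<and> size q = size u' \<and> lin_ext (\<lambda>s. deg E (s + q)) v \<noteq> 0 \<longrightarrow> q = u' \<or> wt q < wt u'"
    using test_functional_exists[OF flat_E u'FY(2) fl(3)[OF u'FY(1)]] by blast
  have val: "Deg (mono1 q * v) = lin_ext (\<lambda>s. deg E (s + q)) v" for q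
    by (simp add: Deg_def lin_ext_mult add.commute)
  have "\<theta> (comb i a) = (\<Sum>u\<in>FY i. Poly_Mapping.single 0 (a u) * mono1 u)"
    unfolding comb_def poly_eval_sum by (rule sum.cong) (simp_all add: poly_eval_mult poly_eval_pconst \<theta>_H fl)
  then have "\<theta> (comb i a) * v = (\<Sum>u\<in>FY i. Poly_Mapping.single 0 (a u) * (mono1 u * v))"
    by (simp add: sum_distrib_right mult.assoc)
  moreover have "Deg (Poly_Mapping.single 0 c * p) = c * Deg p" for c p
    by (simp add: Deg_def lin_ext_mult[of _ "Poly_Mapping.single 0 c"])
  ultimately have "Deg (\<theta> (comb i a) * v) = (\<Sum>u\<in>FY i. a u * Deg (mono1 u * v))"
    by (simp add: Deg_simps)
  then have "(\<Sum>u\<in>FY i. a u * Deg (mono1 u * v)) = 0" using Deg_ideal[OF assms(1)] by simp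
  moreover have "(\<Sum>u\<in>FY i. a u * Deg (mono1 u * v)) = (\<Sum>u\<in>FY i. if u = u' then a u' * Deg (mono1 u' * v) else 0)"
  proof (rule sum.cong[OF refl])
    fix q assume q: "q \<in> FY i"
    show "a q * Deg (mono1 q * v) = (if q = u' then a u' * Deg (mono1 u' * v) else 0)"
    proof (cases "q = u' \<or> a q = 0")
      case False
      then have "q \<in> S" using q by (simp add: S_def)
      then have "\<not> wt q < wt u'" using u'(2) by (simp add: not_less)
      moreover have "size q = size u'" using fl(4) q u'FY(1) by simp
      ultimately have "lin_ext (\<lambda>s. deg E (s + q)) v = 0" using v(2) fl(2)[OF q] False by blast
      then show ?thesis using False by (simp add: val)
    qed auto
  qed
  ultimately have "a u' * Deg (mono1 u' * v) = 0" using u'FY(1) finite_FY by simp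
  then show False using u'FY(3) v(1) val by simp
qed

end

lemma pm_push_mult:
  fixes p q :: "'b::comm_monoid_add \<Rightarrow>\<^sub>0 'k::comm_ring_1"
  assumes g: "\<And>a b. g (a + b) = g a + (g b :: 'c::comm_monoid_add)"
  shows "pm_push g (p * q) = pm_push g p * pm_push g q"
proof (rule pm_additive_eq[of "\<lambda>p. pm_push g (p * q)" "\<lambda>p. pm_push g p * pm_push g q"])
  fix m c
  show "pm_push g (Poly_Mapping.single m c * q) = pm_push g (Poly_Mapping.single m c) * pm_push g q"
    by (rule pm_additive_eq[of "\<lambda>q. pm_push g (Poly_Mapping.single m c * q)" "\<lambda>q. pm_push g (Poly_Mapping.single m c) * pm_push g q"])
      (simp_all add: pm_push_add distrib_left mult_single g)
qed (simp_all add: pm_push_add distrib_right)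

definition tdeg :: "('v \<Rightarrow>\<^sub>0 nat) \<Rightarrow> nat" where
  "tdeg m = (\<Sum>v\<in>Poly_Mapping.keys m. Poly_Mapping.lookup m v)"

lemma tdeg_add: "tdeg (m + n) = tdeg m + tdeg n"
  unfolding tdeg_def by (rule setsum_keys_plus_distrib) simp_all

lemma tdeg_push: "tdeg (pm_push f m) = tdeg m"
  by (rule pm_additive_eq[of "\<lambda>m. tdeg (pm_push f m)" tdeg]) (simp_all add: pm_push_add tdeg_add, simp add: tdeg_def)

lemma homogeneous_iff: "homogeneous d p \<longleftrightarrow> (\<forall>m\<in>Poly_Mapping.keys p. tdeg m = d)"
  by (simp add: homogeneous_def tdeg_def)

lemma homogeneous_add: "homogeneous d p \<Longrightarrow> homogeneous d q \<Longrightarrow> homogeneous d (p + q)"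
  using Poly_Mapping.keys_add[of p q] unfolding homogeneous_iff by blast

lemma homogeneous_zero: "homogeneous d 0" by (simp add: homogeneous_iff)

lemma homogeneous_sum: "(\<And>j. j \<in> J \<Longrightarrow> homogeneous d (f j)) \<Longrightarrow> homogeneous d (sum f J)"
  by (induction J rule: infinite_finite_induct) (auto intro: homogeneous_add homogeneous_zero)

lemma homogeneous_mult: assumes "homogeneous d p" "homogeneous e q" shows "homogeneous (d + e) (p * q)"
  unfolding homogeneous_iff
proof
  fix m assume "m \<in> Poly_Mapping.keys (p * q)"
  then obtain a b where "m = a + b" "a \<in> Poly_Mapping.keys p" "b \<in> Poly_Mapping.keys q"
    using keys_mult[of p q] by blast
  then show "tdeg m = d + e" using assms by (simp add: homogeneous_iff tdeg_add)
qed

lemma homogeneous_pconst: "homogeneous 0 (pconst c)"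
  by (simp add: homogeneous_iff pconst_def tdeg_def)

lemma homogeneous_pvar: "homogeneous 1 (pvar v)"
  by (simp add: homogeneous_iff pvar_def tdeg_def)

lemma homogeneous_push: assumes "homogeneous d p" shows "homogeneous d (pm_push (pm_push f) p)"
  unfolding homogeneous_iff
proof
  fix m assume "m \<in> Poly_Mapping.keys (pm_push (pm_push f) p)"
  then obtain m' where "m' \<in> Poly_Mapping.keys p" "m = pm_push f m'" using keys_pm_push[of "pm_push f" p] by blast
  then show "tdeg m = d" using assms by (simp add: homogeneous_iff tdeg_push)
qed

context finite_matroid begin

section \<open>The action of automorphisms\<close>

definition aut :: "('a \<Rightarrow> 'a) \<Rightarrow> bool" where
  "aut \<sigma> \<longleftrightarrow> \<sigma> permutes E \<and> (\<forall>S\<subseteq>E. rk (\<sigma> ` S) = rk S)"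

lemma aut_permutes: "aut \<sigma> \<Longrightarrow> \<sigma> permutes E" by (simp add: aut_def)

lemma aut_image_sub: assumes "aut \<sigma>" shows "\<sigma> ` S \<subseteq> E \<longleftrightarrow> S \<subseteq> E"
proof -
  have "\<sigma> z \<in> E \<longleftrightarrow> z \<in> E" for z by (rule permutes_in_image[OF aut_permutes[OF assms]])
  then show ?thesis by blast
qed

abbreviation inv' :: "('a \<Rightarrow> 'a) \<Rightarrow> 'a \<Rightarrow> 'a" where "inv' \<equiv> inv_into UNIV"

lemma aut_inj: "aut \<sigma> \<Longrightarrow> inj \<sigma>" by (rule permutes_inj[OF aut_permutes])

lemma aut_image_inj: assumes "aut \<sigma>" shows "inj (image \<sigma> :: 'a set \<Rightarrow> 'a set)"
  by (rule injI) (simp only: inj_image_eq_iff[OF aut_inj[OF assms]])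

lemma aut_image_subset_iff: "aut \<sigma> \<Longrightarrow> \<sigma> ` A \<subseteq> \<sigma> ` B \<longleftrightarrow> A \<subseteq> B"
  by (rule inj_image_subset_iff[OF aut_inj])

lemma aut_image_psubset_iff: "aut \<sigma> \<Longrightarrow> \<sigma> ` A \<subset> \<sigma> ` B \<longleftrightarrow> A \<subset> B"
  unfolding less_le by (simp only: aut_image_subset_iff inj_image_eq_iff[OF aut_inj])

lemma aut_rk: "aut \<sigma> \<Longrightarrow> S \<subseteq> E \<Longrightarrow> rk (\<sigma> ` S) = rk S" by (simp add: aut_def)

lemma aut_inv_cancel: assumes "aut \<sigma>" shows "inv' \<sigma> ` \<sigma> ` S = S" "\<sigma> ` inv' \<sigma> ` S = S" "inv' \<sigma> (\<sigma> z) = z" "\<sigma> (inv' \<sigma> z) = z"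
  using permutes_inverses[OF aut_permutes[OF assms]] by (simp_all add: image_image)

lemma aut_inv: assumes a: "aut \<sigma>" shows "aut (inv' \<sigma>)"
proof -
  have p: "inv' \<sigma> permutes E" by (rule permutes_inv[OF aut_permutes[OF a]])
  have "rk (inv' \<sigma> ` S) = rk S" if S: "S \<subseteq> E" for S
  proof -
    have "inv' \<sigma> ` S \<subseteq> E" using aut_image_sub[OF a, of "inv' \<sigma> ` S"] S by (simp only: aut_inv_cancel[OF a])
    then show ?thesis using aut_rk[OF a, of "inv' \<sigma> ` S"] by (simp only: aut_inv_cancel[OF a])
  qed
  then show ?thesis using p by (simp add: aut_def)
qed

lemma aut_flat: assumes a: "aut \<sigma>" and F: "flat F" shows "flat (\<sigma> ` F)"
  unfolding flats_def
proof (intro CollectI conjI ballI)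
  show "\<sigma> ` F \<subseteq> E" using aut_image_sub[OF a] flat_sub[OF F] by simp
  fix i assume i: "i \<in> E - \<sigma> ` F"
  define j where "j = inv' \<sigma> i"
  have ij: "i = \<sigma> j" by (simp only: j_def aut_inv_cancel[OF a])
  have jE: "j \<in> E" using aut_image_sub[OF a, of "{j}"] i ij by simp
  have jF: "j \<notin> F" using i ij by blast
  have "rk (\<sigma> ` F) = rk F" by (rule aut_rk[OF a flat_sub[OF F]])
  also have "\<dots> < rk (insert j F)" using F jE jF unfolding flats_def by blast
  also have "\<dots> = rk (\<sigma> ` insert j F)" using jE flat_sub[OF F] by (intro aut_rk[OF a, symmetric]) simp
  also have "\<sigma> ` insert j F = insert i (\<sigma> ` F)" by (simp only: image_insert ij)
  finally show "rk (\<sigma> ` F) < rk (insert i (\<sigma> ` F))" .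
qed

lemma aut_E: assumes "aut \<sigma>" shows "\<sigma> ` E = E"
  by (rule permutes_image[OF aut_permutes[OF assms]])

lemma aut_proper: assumes a: "aut \<sigma>" and F: "proper F" shows "proper (\<sigma> ` F)"
proof -
  have "\<sigma> ` F \<noteq> \<sigma> ` E" using F inj_image_eq_iff[OF aut_inj[OF a], of F E] by (simp only: proper_iff simp_thms)
  then show ?thesis using F aut_flat[OF a] by (simp only: proper_iff aut_E[OF a] simp_thms)
qed

abbreviation "\<rho> \<sigma> \<equiv> pm_push (pm_push (relabel \<sigma>))"

lemma \<rho>_simps: "\<rho> \<sigma> (p + q) = \<rho> \<sigma> p + \<rho> \<sigma> q" "\<rho> \<sigma> (p - q) = \<rho> \<sigma> p - \<rho> \<sigma> q"
   "\<rho> \<sigma> (p * q) = \<rho> \<sigma> p * (\<rho> \<sigma> q :: 'a chow_poly)" "\<rho> \<sigma> (x F) = x (\<sigma> ` F)" "\<rho> \<sigma> (y i) = y (\<sigma> i)"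
   "\<rho> \<sigma> (pconst c) = (pconst c :: 'a chow_poly)" "\<rho> \<sigma> 0 = 0" "\<rho> \<sigma> 1 = (1 :: 'a chow_poly)"
   "\<rho> \<sigma> (sum f J) = (\<Sum>j\<in>J. \<rho> \<sigma> (f j))"
proof -
  show c: "\<rho> \<sigma> (pconst c) = (pconst c :: 'a chow_poly)" for c by (simp add: pconst_def)
  show "\<rho> \<sigma> 1 = (1 :: 'a chow_poly)" using c[of 1] by (simp only: pconst_one)
  show "\<rho> \<sigma> (p * q) = \<rho> \<sigma> p * (\<rho> \<sigma> q :: 'a chow_poly)" by (rule pm_push_mult) (rule pm_push_add)
qed (simp_all add: pm_push_add pm_push_diff pm_push_sum pvar_def)

lemma \<rho>_inv: assumes "aut \<sigma>" shows "\<rho> (inv' \<sigma>) (\<rho> \<sigma> p) = (p :: 'a chow_poly)" "\<rho> \<sigma> (\<rho> (inv' \<sigma>) p) = p"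
proof -
  have r: "relabel (inv' \<sigma>) (relabel \<sigma> v) = v" "relabel \<sigma> (relabel (inv' \<sigma>) v) = v" for v
    by (cases v; simp only: relabel.simps aut_inv_cancel[OF assms])+
  show "\<rho> (inv' \<sigma>) (\<rho> \<sigma> p) = p" "\<rho> \<sigma> (\<rho> (inv' \<sigma>) p) = p"
    unfolding pm_push_push by (simp_all only: r) (rule pm_push_ident, rule pm_push_ident, rule refl)+
qed

lemma \<rho>_C: assumes a: "aut \<sigma>" and p: "p \<in> C" shows "\<rho> \<sigma> p \<in> C"
  unfolding aug_poly_ring_def carrier_poly_ring
proof
  fix m assume "m \<in> Poly_Mapping.keys (\<rho> \<sigma> p)"
  then obtain m' where m': "m' \<in> Poly_Mapping.keys p" "m = pm_push (relabel \<sigma>) m'"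
    using keys_pm_push[of "pm_push (relabel \<sigma>)" p] by blast
  have rel: "relabel \<sigma> v \<in> Xvar ` proper_flats E rk \<union> Yvar ` E" if "v \<in> Xvar ` proper_flats E rk \<union> Yvar ` E" for v
  proof -
    have "\<sigma> i \<in> E" if "i \<in> E" for i using aut_image_sub[OF a, of "{i}"] that by simp
    then show ?thesis using that aut_proper[OF a] by auto
  qed
  have km: "Poly_Mapping.keys m' \<subseteq> Xvar ` proper_flats E rk \<union> Yvar ` E"
    using p m'(1) by (simp only: aug_poly_ring_def carrier_poly_ring)
  show "Poly_Mapping.keys m \<subseteq> Xvar ` proper_flats E rk \<union> Yvar ` E"
    unfolding m'(2) by (rule subset_trans[OF keys_pm_push image_subsetI[OF rel[OF subsetD[OF km]]]])
qed

lemma sum_proper_reindex: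
  assumes a: "aut \<sigma>" and PQ: "\<And>F. Q (\<sigma> ` F) \<longleftrightarrow> P F"
  shows "(\<Sum>F\<in>{F \<in> proper_flats E rk. P F}. x (\<sigma> ` F)) = (\<Sum>F\<in>{F \<in> proper_flats E rk. Q F}. x F)"
proof (rule sum.reindex_bij_witness[of _ "image (inv' \<sigma>)" "image \<sigma>"])
  fix F assume F: "F \<in> {F \<in> proper_flats E rk. Q F}"
  have "Q (\<sigma> ` inv' \<sigma> ` F)" using F by (simp only: aut_inv_cancel[OF a] mem_Collect_eq)
  then show "inv' \<sigma> ` F \<in> {F \<in> proper_flats E rk. P F}" using aut_proper[OF aut_inv[OF a]] F PQ by blast
next
  fix F assume "F \<in> {F \<in> proper_flats E rk. P F}"
  then show "\<sigma> ` F \<in> {F \<in> proper_flats E rk. Q F}" using aut_proper[OF a] PQ by blast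
qed (simp_all only: aut_inv_cancel[OF a])

lemma \<rho>_h: assumes a: "aut \<sigma>" shows "\<rho> \<sigma> (h F) = h (\<sigma> ` F)"
proof -
  have "\<rho> \<sigma> (h F) = (\<Sum>G\<in>{G \<in> proper_flats E rk. \<not> F \<subseteq> G}. x (\<sigma> ` G))"
    by (simp only: h_def \<rho>_simps)
  also have "\<dots> = h (\<sigma> ` F)" unfolding h_def
    by (rule sum_proper_reindex[OF a]) (simp only: aut_image_subset_iff[OF a])
  finally show ?thesis .
qed

lemma \<rho>_H: "aut \<sigma> \<Longrightarrow> \<rho> \<sigma> (H q) = H (image_mset (image \<sigma>) q)"
  by (induction q) (simp_all add: \<rho>_simps \<rho>_h)

text \<open>Each of the three families of generators is permuted by an automorphism.\<close>

lemma \<rho>_I_sub: assumes a: "aut \<sigma>" and p: "p \<in> I" shows "\<rho> \<sigma> p \<in> I"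
proof -
  have "I \<subseteq> {p \<in> C. \<rho> \<sigma> p \<in> I}"
  proof (rule ideal_least)
    fix c p assume "c \<in> C" "p \<in> {p \<in> C. \<rho> \<sigma> p \<in> I}"
    then show "c * p \<in> {p \<in> C. \<rho> \<sigma> p \<in> I}"
      by (simp add: \<rho>_simps C_closed I_mult \<rho>_C[OF a])
  next
    show "gens \<subseteq> {p \<in> C. \<rho> \<sigma> p \<in> I}"
    proof
      fix g assume g: "g \<in> gens"
      consider F F' where "g = x F * x F'" "proper F" "proper F'" "\<not> F \<subseteq> F'" "\<not> F' \<subseteq> F"
        | i F where "g = y i * x F" "i \<in> E" "proper F" "i \<notin> F"
        | i where "g = y i - (\<Sum>F\<in>{F \<in> proper_flats E rk. i \<notin> F}. x F)" "i \<in> E"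
        using g unfolding gens_def by blast
      then have "\<rho> \<sigma> g \<in> I"
      proof cases
        case 1
        then show ?thesis
          by (simp only: \<rho>_simps) (intro incomparable_I aut_proper[OF a], simp_all only: aut_image_subset_iff[OF a] not_False_eq_True)
      next
        case 2
        have "\<sigma> i \<in> E" using aut_image_sub[OF a, of "{i}"] 2 by simp
        moreover have "\<sigma> i \<notin> \<sigma> ` F" using inj_image_mem_iff[OF aut_inj[OF a], of i F] 2 by simp
        ultimately show ?thesis unfolding 2(1) \<rho>_simps by (intro y_x_I aut_proper[OF a] 2(3))
      next
        case 3
        have iE: "\<sigma> i \<in> E" using aut_image_sub[OF a, of "{i}"] 3 by simp
        have "(\<Sum>F\<in>{F \<in> proper_flats E rk. i \<notin> F}. x (\<sigma> ` F)) = (\<Sum>F\<in>{F \<in> proper_flats E rk. \<sigma> i \<notin> F}. x F)"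
          by (rule sum_proper_reindex[OF a]) (simp only: inj_image_mem_iff[OF aut_inj[OF a]])
        then have "\<rho> \<sigma> g = y (\<sigma> i) - (\<Sum>F\<in>{F \<in> proper_flats E rk. \<sigma> i \<notin> F}. x F)" by (simp only: 3(1) \<rho>_simps)
        then have "\<rho> \<sigma> g \<in> gens" unfolding gens_def using iE by blast
        then show ?thesis using ideal_generated(2) by blast
      qed
      then show "g \<in> {p \<in> C. \<rho> \<sigma> p \<in> I}" using g gens_C by blast
    qed
  qed (auto simp: C_closed \<rho>_simps I_zero I_add)
  then show ?thesis using p by blast
qed

lemma \<rho>_I: assumes a: "aut \<sigma>" shows "\<rho> \<sigma> ` I = I"
proof (intro equalityI subsetI)
  fix p assume "p \<in> I"
  then have "\<rho> (inv' \<sigma>) p \<in> I" by (rule \<rho>_I_sub[OF aut_inv[OF a]])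
  then show "p \<in> \<rho> \<sigma> ` I" using \<rho>_inv(2)[OF a, of p] by (metis imageI)
qed (use \<rho>_I_sub[OF a] in blast)

lemma fyD:
  assumes "fy u"
  shows "G \<in># u \<Longrightarrow> flat G" "G \<in># u \<Longrightarrow> G \<noteq> {}" "F \<in># u \<Longrightarrow> G \<in># u \<Longrightarrow> F \<subseteq> G \<or> G \<subseteq> F"
    "G \<in># u \<Longrightarrow> count u G \<le> rk G" "F \<in># u \<Longrightarrow> G \<in># u \<Longrightarrow> F \<subset> G \<Longrightarrow> count u G < rk G - rk F"
  using assms by (simp_all add: fy_def)

lemma fy_image: assumes a: "aut \<sigma>" and u: "fy u" shows "fy (image_mset (image \<sigma>) u)"
proof -
  have cnt: "count (image_mset (image \<sigma>) u) (\<sigma> ` G) = count u G" for G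
    by (induction u) (simp_all add: inj_eq[OF aut_image_inj[OF a]])
  have r: "rk (\<sigma> ` G) = rk G" if "G \<in># u" for G by (rule aut_rk[OF a flat_sub[OF fyD(1)[OF u that]]])
  show ?thesis unfolding fy_def set_image_mset ball_simps
  proof (intro conjI ballI impI)
    fix G assume G: "G \<in># u"
    show "flat (\<sigma> ` G)" by (rule aut_flat[OF a fyD(1)[OF u G]])
    show "\<sigma> ` G \<noteq> {}" using fyD(2)[OF u G] by simp
    show "count (image_mset (image \<sigma>) u) (\<sigma> ` G) \<le> rk (\<sigma> ` G)"
      unfolding cnt r[OF G] by (rule fyD(4)[OF u G])
    fix F assume F: "F \<in># u"
    show "\<sigma> ` G \<subseteq> \<sigma> ` F \<or> \<sigma> ` F \<subseteq> \<sigma> ` G"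
      unfolding aut_image_subset_iff[OF a] by (rule fyD(3)[OF u G F])
  next
    fix G F assume G: "G \<in># u" and F: "F \<in># u" and less: "\<sigma> ` F \<subset> \<sigma> ` G"
    then have "F \<subset> G" by (simp only: aut_image_psubset_iff[OF a])
    then show "count (image_mset (image \<sigma>) u) (\<sigma> ` G) < rk (\<sigma> ` G) - rk (\<sigma> ` F)"
      unfolding cnt r[OF G] r[OF F] by (rule fyD(5)[OF u F G])
  qed
qed

section \<open>Traces on the graded pieces\<close>

abbreviation co :: "'a chow_poly \<Rightarrow> 'a chow_poly set" where "co p \<equiv> I +>\<^bsub>R\<^esub> p"

lemma add_R: "add R = (+)" "mult R = (*)" by (simp_all add: aug_poly_ring_def ops_poly_ring)

lemma co_eq_image: "co p = (\<lambda>w. w + p) ` I"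
  unfolding a_r_coset_def' add_R by blast

lemma mem_co: "s \<in> co p \<longleftrightarrow> s - p \<in> I"
proof
  assume "s - p \<in> I"
  then have "(s - p) + p \<in> co p" unfolding co_eq_image by (rule imageI)
  then show "s \<in> co p" by simp
qed (auto simp: co_eq_image)

lemma co_eq_iff: "co p = co q \<longleftrightarrow> p - q \<in> I"
proof
  assume "co p = co q"
  moreover have "p \<in> co p" by (simp add: mem_co I_zero)
  ultimately show "p - q \<in> I" by (simp add: mem_co)
next
  assume pq: "p - q \<in> I"
  show "co p = co q"
  proof (rule Set.set_eqI)
    fix s
    show "s \<in> co p \<longleftrightarrow> s \<in> co q"
      unfolding mem_co using I_trans[OF _ pq, of s] I_trans[of s q p] I_minus[OF pq] by auto
  qed
qed

lemma co_add: "co p <+>\<^bsub>R\<^esub> co q = co (p + q)"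
proof (intro equalityI subsetI)
  fix s assume "s \<in> co p <+>\<^bsub>R\<^esub> co q"
  then obtain a b where ab: "s = a + b" "a - p \<in> I" "b - q \<in> I" unfolding set_add_def' add_R by (auto simp: mem_co)
  have eq: "s - (p + q) = (a - p) + (b - q)" by (simp add: ab(1))
  show "s \<in> co (p + q)" unfolding mem_co eq by (rule I_add[OF ab(2,3)])
next
  fix s assume "s \<in> co (p + q)"
  then have "s - q \<in> co p" by (simp add: mem_co diff_diff_eq add.commute)
  moreover have "q \<in> co q" by (simp add: mem_co I_zero)
  moreover have "s = (s - q) + q" by simp
  ultimately show "s \<in> co p <+>\<^bsub>R\<^esub> co q" unfolding set_add_def' add_R by blast
qed

abbreviation "V i \<equiv> aug_chow_part E rk i"

lemma V_carrier: "carrier (V i) = {co p | p. p \<in> C \<and> homogeneous i p}" by (simp add: aug_chow_part_def)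

lemma V_add: "co p \<oplus>\<^bsub>V i\<^esub> co q = co (p + q)"
  by (simp add: aug_chow_part_def aug_chow_ring_def FactRing_def co_add)

lemma V_smult: "p \<in> C \<Longrightarrow> c \<odot>\<^bsub>V i\<^esub> co p = co (pconst c * p)"
  using ideal.rcoset_mult_add[OF ideal_generated(1) C_closed(6), of p c]
  by (simp add: aug_chow_part_def aug_chow_ring_def FactRing_def add_R)

text \<open>The coordinates of a class of degree \<open>i\<close> in the basis of Feichtner--Yuzvinsky monomials.\<close>

definition coords :: "nat \<Rightarrow> 'a chow_poly \<Rightarrow> 'a set multiset \<Rightarrow> rat" where
  "coords i p = (SOME a. p - comb i a \<in> I)"

lemma coords_unique:
  assumes "p - comb i a \<in> I" "p - q \<in> I" "u \<in> FY i"
  shows "coords i q u = a u"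
proof -
  have 1: "q - comb i a \<in> I" using I_trans[of q p "comb i a"] I_minus[OF assms(2)] assms(1) by simp
  have 2: "q - comb i (coords i q) \<in> I"
    unfolding coords_def by (rule someI[where P = "\<lambda>a. q - comb i a \<in> I", OF 1])
  have "comb i (\<lambda>u. coords i q u + (- 1) * a u) = comb i (coords i q) - comb i a"
    by (simp only: comb_add comb_mult pconst_minus pconst_one) simp
  also have "\<dots> = (q - comb i a) - (q - comb i (coords i q))" by simp
  also have "\<dots> \<in> I" by (rule I_diff[OF 1 2])
  finally have "coords i q u + (- 1) * a u = 0" by (rule comb_independent[OF _ assms(3)])
  then show ?thesis by simp
qed

definition kap :: "nat \<Rightarrow> 'a chow_poly set \<Rightarrow> 'a set multiset \<Rightarrow> rat" where
  "kap i Y = coords i (SOME p. p \<in> Y)"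

lemma kap_co: assumes "p - comb i a \<in> I" "u \<in> FY i" shows "kap i (co p) u = a u"
proof -
  have "p \<in> co p" by (simp add: mem_co I_zero)
  then have "(SOME q. q \<in> co p) \<in> co p" by (rule someI)
  then have "p - (SOME q. q \<in> co p) \<in> I" using I_minus[of "(SOME q. q \<in> co p) - p"] by (simp add: mem_co)
  then show ?thesis unfolding kap_def by (rule coords_unique[OF assms(1) _ assms(2)])
qed

lemma homogeneous_h: "homogeneous 1 (h F)" unfolding h_def by (intro homogeneous_sum homogeneous_pvar)

lemma homogeneous_H: "homogeneous (size q) (H q)"
proof (induction q)
  case empty
  show ?case using homogeneous_pconst[of 1] by (simp add: pconst_one)
next
  case (add G q)
  then show ?case using homogeneous_mult[OF homogeneous_h add, of G] by simp
qed

lemma act_co: assumes "aut \<sigma>" shows "aug_chow_act \<sigma> (co p) = co (\<rho> \<sigma> p)"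
proof -
  have "aug_chow_act \<sigma> (co p) = (\<lambda>w. w + \<rho> \<sigma> p) ` (\<rho> \<sigma> ` I)"
    by (simp add: aug_chow_act_def co_eq_image image_image \<rho>_simps)
  then show ?thesis by (simp only: \<rho>_I[OF assms] co_eq_image)
qed

text \<open>The monomials \<open>H u\<close> for \<open>u \<in> FY i\<close> span the graded piece, are independent, and are permuted by the
automorphism; the trace of a permuted basis counts its fixed points.\<close>

theorem trace_aug_chow_part:
  assumes a: "aut \<sigma>"
  shows "lin_trace (aug_chow_part_C E rk i) (aug_chow_act_C \<sigma>) = of_nat (card {u \<in> FY i. image_mset (image \<sigma>) u = u})"
proof -
  have VE: "\<exists>p c. v = co p \<and> p \<in> C \<and> homogeneous i p \<and> p - comb i c \<in> I" if "v \<in> carrier (V i)" for v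
    using that homogeneous_spanned[of _ i] unfolding V_carrier spanned_def by blast
  have VI: "co p \<in> carrier (V i)" if "p \<in> C" "homogeneous i p" for p using that unfolding V_carrier by blast
  have hom_smult: "homogeneous i (pconst c * p)" if "homogeneous i p" for c and p :: "'a chow_poly"
    using homogeneous_mult[OF homogeneous_pconst that] by simp
  have H_V: "co (H u) \<in> carrier (V i)" if "u \<in> FY i" for u
    using that homogeneous_H[of u] by (intro VI H_C) (simp add: FY_def)
  have kap_H: "kap i (co (H w)) u = (if u = w then 1 else 0)" if "u \<in> FY i" "w \<in> FY i" for u w
    by (rule kap_co) (simp_all add: that comb_delta I_zero)
  have act_V: "co (\<rho> \<tau> p) \<in> carrier (V i)" if "aut \<tau>" "p \<in> C" "homogeneous i p" for \<tau> p
    by (intro VI \<rho>_C homogeneous_push that)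
  have "lin_trace (complexify (V i)) (complexify_map (aug_chow_act \<sigma>))
      = (\<Sum>u\<in>FY i. of_rat (kap i (aug_chow_act \<sigma> (co (H u))) u))"
  proof (rule lin_trace_complexify[OF _ _ finite_FY])
    fix v w assume "v \<in> carrier (V i)" "w \<in> carrier (V i)"
    then obtain p c q d where p: "v = co p" "p \<in> C" "homogeneous i p" "p - comb i c \<in> I"
      and q: "w = co q" "q \<in> C" "homogeneous i q" "q - comb i d \<in> I" using VE by meson
    show "v \<oplus>\<^bsub>V i\<^esub> w \<in> carrier (V i)" unfolding p(1) q(1) V_add by (intro VI C_closed homogeneous_add p q)
    show "aug_chow_act \<sigma> (v \<oplus>\<^bsub>V i\<^esub> w) = aug_chow_act \<sigma> v \<oplus>\<^bsub>V i\<^esub> aug_chow_act \<sigma> w"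
      unfolding p(1) q(1) V_add act_co[OF a] \<rho>_simps ..
    have pq: "p + q - comb i (\<lambda>u. c u + d u) \<in> I"
    proof -
      have "p + q - comb i (\<lambda>u. c u + d u) = (p - comb i c) + (q - comb i d)" by (simp add: comb_add)
      then show ?thesis using I_add[OF p(4) q(4)] by (simp only:)
    qed
    show "kap i (v \<oplus>\<^bsub>V i\<^esub> w) u = kap i v u + kap i w u" if "u \<in> FY i" for u
      unfolding p(1) q(1) V_add kap_co[OF pq that] kap_co[OF p(4) that] kap_co[OF q(4) that] ..
    show "v = w" if "\<And>u. u \<in> FY i \<Longrightarrow> kap i v u = kap i w u"
    proof -
      have "c u = d u" if "u \<in> FY i" for u
        using \<open>\<And>u. u \<in> FY i \<Longrightarrow> kap i v u = kap i w u\<close>[OF that]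
        unfolding p(1) q(1) kap_co[OF p(4) that] kap_co[OF q(4) that] .
      then have "comb i c = comb i d" unfolding comb_def by (intro sum.cong refl) simp
      then have "p - q = (p - comb i c) - (q - comb i d)" by simp
      then have "p - q \<in> I" using I_diff[OF p(4) q(4)] by (simp only:)
      then show ?thesis unfolding p(1) q(1) co_eq_iff .
    qed
    fix e :: rat
    show "e \<odot>\<^bsub>V i\<^esub> v \<in> carrier (V i)" unfolding p(1) V_smult[OF p(2)] by (intro VI C_closed p(2) hom_smult p(3))
    show "aug_chow_act \<sigma> (e \<odot>\<^bsub>V i\<^esub> v) = e \<odot>\<^bsub>V i\<^esub> aug_chow_act \<sigma> v"
      unfolding p(1) V_smult[OF p(2)] act_co[OF a] V_smult[OF \<rho>_C[OF a p(2)]] \<rho>_simps ..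
    have ep: "pconst e * p - comb i (\<lambda>u. e * c u) \<in> I"
    proof -
      have "pconst e * p - comb i (\<lambda>u. e * c u) = pconst e * (p - comb i c)" by (simp only: comb_mult right_diff_distrib)
      then show ?thesis using I_mult[OF C_closed(6) p(4)] by (simp only:)
    qed
    show "kap i (e \<odot>\<^bsub>V i\<^esub> v) u = e * kap i v u" if "u \<in> FY i" for u
      unfolding p(1) V_smult[OF p(2)] kap_co[OF ep that] kap_co[OF p(4) that] ..
  next
    show "bij_betw (aug_chow_act \<sigma>) (carrier (V i)) (carrier (V i))"
    proof (rule bij_betwI[of _ _ _ "aug_chow_act (inv' \<sigma>)"])
      show "aug_chow_act \<sigma> \<in> carrier (V i) \<rightarrow> carrier (V i)"
        using act_V[OF a] by (auto simp: V_carrier act_co[OF a])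
      show "aug_chow_act (inv' \<sigma>) \<in> carrier (V i) \<rightarrow> carrier (V i)"
        using act_V[OF aut_inv[OF a]] by (auto simp: V_carrier act_co[OF aut_inv[OF a]])
    qed (auto simp: V_carrier act_co[OF a] act_co[OF aut_inv[OF a]] \<rho>_inv[OF a])
  qed (simp_all add: H_V kap_H)
  also have "\<dots> = (\<Sum>u\<in>FY i. if image_mset (image \<sigma>) u = u then 1 else 0)"
  proof (rule sum.cong[OF refl])
    fix u assume u: "u \<in> FY i"
    then have "image_mset (image \<sigma>) u \<in> FY i" using fy_image[OF a] by (simp add: FY_def)
    then show "of_rat (kap i (aug_chow_act \<sigma> (co (H u))) u) = (if image_mset (image \<sigma>) u = u then 1 else (0::complex))"
      using u by (simp add: act_co[OF a] \<rho>_H[OF a] kap_H) 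
  qed
  also have "\<dots> = of_nat (card {u \<in> FY i. image_mset (image \<sigma>) u = u})"
    using finite_FY by (simp add: sum.If_cases Int_def)
  finally show ?thesis by (simp only: aug_chow_part_C_def aug_chow_act_C_def)
qed

end

section \<open>Signed counts of fixed Feichtner--Yuzvinsky multisets\<close>

lemma sum_alternating_signs: "(\<Sum>m=1..d. (- 1) ^ m) = (if odd d then - 1 else (0 :: 'b::comm_ring_1))"
  by (induction d) auto

context finite_matroid
begin

text \<open>The conditions on a multiset do not involve flats above it, so the top member can be split off.\<close>

lemma fy_add_top:
  assumes F: "flat F" "F \<noteq> {}" and top: "\<And>G. G \<in># v \<Longrightarrow> G \<subset> F" and m: "0 < m"
  shows "fy (v + replicate_mset m F) \<longleftrightarrow> fy v \<and> m \<le> rk F \<and> (\<forall>G\<in>#v. m < rk F - rk G)"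
proof -
  have F_v: "F \<notin># v" using top[of F] by blast
  have cF: "count (v + replicate_mset m F) F = m" using F_v by (simp add: not_in_iff)
  have cG: "count (v + replicate_mset m F) G = count v G" if "G \<in># v" for G using top[OF that] by auto
  have set_u: "set_mset (v + replicate_mset m F) = insert F (set_mset v)" using m by auto
  show ?thesis
  proof
    assume u: "fy (v + replicate_mset m F)"
    have "filter_mset (\<lambda>G. G \<noteq> F) (v + replicate_mset m F) = v"
      using F_v by (induction m) (auto simp: filter_mset_eq_conv)
    then have "fy v" using fy_filter[OF u, of "\<lambda>G. G \<noteq> F"] by simp
    moreover have "m \<le> rk F" using fyD(4)[OF u, of F] unfolding cF set_u by simp
    moreover have "m < rk F - rk G" if "G \<in># v" for G
      using fyD(5)[OF u, of G F] top[OF that] that unfolding cF set_u by simp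
    ultimately show "fy v \<and> m \<le> rk F \<and> (\<forall>G\<in>#v. m < rk F - rk G)" by blast
  next
    assume v: "fy v \<and> m \<le> rk F \<and> (\<forall>G\<in>#v. m < rk F - rk G)"
    then have fv: "fy v" by blast
    show "fy (v + replicate_mset m F)"
      unfolding fy_def set_u ball_simps
    proof (intro conjI ballI impI)
      fix G assume G: "G \<in># v"
      show "flat G" by (rule fyD(1)[OF fv G])
      show "G \<noteq> {}" by (rule fyD(2)[OF fv G])
      show "F \<subseteq> G \<or> G \<subseteq> F" "G \<subseteq> F \<or> F \<subseteq> G" using top[OF G] by blast+
      show "count (v + replicate_mset m F) G \<le> rk G" unfolding cG[OF G] by (rule fyD(4)[OF fv G])
      show "count (v + replicate_mset m F) G < rk G - rk F" if "F \<subset> G" using that top[OF G] by blast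
      show "count (v + replicate_mset m F) F < rk F - rk G" unfolding cF using v G by simp
      fix G' assume G': "G' \<in># v"
      show "G \<subseteq> G' \<or> G' \<subseteq> G" by (rule fyD(3)[OF fv G G'])
      show "count (v + replicate_mset m F) G < rk G - rk G'" if "G' \<subset> G"
        unfolding cG[OF G] by (rule fyD(5)[OF fv G' G that])
    qed (use F cF v in auto)
  qed
qed

definition flat_chain :: "'a set set \<Rightarrow> bool" where
  "flat_chain c \<longleftrightarrow> (\<forall>F\<in>c. flat F \<and> F \<noteq> {}) \<and> (\<forall>F\<in>c. \<forall>G\<in>c. F \<subseteq> G \<or> G \<subseteq> F)"

lemma finite_flat_chain: "flat_chain c \<Longrightarrow> finite c"
  by (rule finite_subset[OF _ finite_flats]) (auto simp: flat_chain_def)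

lemma flat_chain_eq: assumes "flat_chain c" "F \<in> c" "G \<in> c" "rk F = rk G" shows "F = G"
proof -
  have fl: "flat F" "flat G" and cmp: "F \<subseteq> G \<or> G \<subseteq> F" using assms(1-3) by (simp_all add: flat_chain_def)
  from cmp show ?thesis
  proof
    assume "F \<subseteq> G"
    then have "G = F" by (rule flat_eqI[OF fl(1) _ flat_sub[OF fl(2)]]) (simp add: assms(4))
    then show ?thesis by simp
  next
    assume "G \<subseteq> F"
    then show ?thesis by (rule flat_eqI[OF fl(2) _ flat_sub[OF fl(1)]]) (simp add: assms(4))
  qed
qed

text \<open>Multisets with support \<open>c\<close> are built by choosing multiplicities from the bottom up, and the top multiplicity
ranges over an interval from \<open>1\<close> to \<open>d\<close> that depends on the two highest flats only. The alternating sum over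
it vanishes for even \<open>d\<close>. If all lower flats have odd rank, then \<open>d\<close> has the parity of the rank of the top.\<close>

lemma signed_fy_with_support:
  assumes "flat_chain c"
  shows "(\<Sum>u | fy u \<and> set_mset u = c. (- 1) ^ size u) =
    (if \<forall>F\<in>c. odd (rk F) then (- 1) ^ card c else (0 :: 'b::comm_ring_1))"
  using assms
proof (induction "card c" arbitrary: c)
  case 0
  then have "c = {}" using finite_flat_chain[OF 0(2)] by simp
  moreover have "{u. fy u \<and> set_mset u = {}} = {{#}}" by (auto simp: fy_def)
  ultimately show ?case by simp
next
  case (Suc N)
  note fin = finite_flat_chain[OF Suc.prems]
  have "c \<noteq> {}" using Suc.hyps(2) by auto
  then obtain F where F: "F \<in> c" "\<And>G. G \<in> c \<Longrightarrow> rk G \<le> rk F" using finite_has_max_value[OF fin, of rk] by blast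
  define c' where "c' = c - {F}"
  have c: "c = insert F c'" "F \<notin> c'" using F(1) by (auto simp: c'_def)
  have chain': "flat_chain c'" using Suc.prems by (simp add: flat_chain_def c'_def)
  have card_c: "card c = Suc (card c')" "N = card c'" using card.remove[OF fin F(1)] Suc.hyps(2) by (simp_all add: c'_def)
  have flF: "flat F" "F \<noteq> {}" using Suc.prems F(1) by (simp_all add: flat_chain_def)
  have below: "G \<subset> F" if G: "G \<in> c'" for G
  proof -
    have Gc: "G \<in> c" "G \<noteq> F" using G by (simp_all add: c'_def)
    have "G \<subseteq> F \<or> F \<subseteq> G" using Suc.prems Gc(1) F(1) by (simp add: flat_chain_def)
    moreover have "G = F" if FG: "F \<subseteq> G"
    proof (rule flat_chain_eq[OF Suc.prems Gc(1) F(1)])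
      have "flat G" using Suc.prems Gc(1) by (simp add: flat_chain_def)
      then have "rk F \<le> rk G" by (rule rk_mono[OF FG flat_sub])
      then show "rk G = rk F" by (rule order_antisym[OF F(2)[OF Gc(1)]])
    qed
    ultimately show ?thesis using Gc(2) by blast
  qed
  \<comment> \<open>The bound is rk F itself for the first flat of the chain and one less than the rank gap otherwise.\<close>
  define d where "d = (if c' = {} then rk F else rk F - Suc (Max (rk ` c')))"
  have fin': "finite c'" by (rule finite_flat_chain[OF chain'])
  have highest: "\<exists>G\<in>c'. rk G = Max (rk ` c')" if "c' \<noteq> {}"
  proof -
    have "Max (rk ` c') \<in> rk ` c'" by (rule Max_in) (use fin' that in simp_all)
    then show ?thesis by (metis imageE)
  qed
  have d_iff: "m \<le> rk F \<and> (\<forall>G\<in>c'. m < rk F - rk G) \<longleftrightarrow> m \<le> d" if "0 < m" for m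
  proof (cases "c' = {}")
    case True
    then show ?thesis by (simp add: d_def)
  next
    case False
    obtain G where G: "G \<in> c'" "rk G = Max (rk ` c')" using highest[OF False] by blast
    have le: "rk G' \<le> rk G" if "G' \<in> c'" for G' using G(2) fin' that by simp
    have "(\<forall>G\<in>c'. m < rk F - rk G) \<longleftrightarrow> m < rk F - rk G" 
    proof
      assume r: "m < rk F - rk G"
      show "\<forall>G\<in>c'. m < rk F - rk G"
      proof
        fix G' assume "G' \<in> c'"
        then show "m < rk F - rk G'" using le[of G'] r by linarith
      qed
    qed (use G(1) in blast)
    then show ?thesis using False that G(2) by (auto simp: d_def)
  qed
  have parity: "odd d \<longleftrightarrow> odd (rk F)" if odd: "\<forall>G\<in>c'. odd (rk G)"
  proof (cases "c' = {}")
    case True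
    then show ?thesis by (simp add: d_def)
  next
    case False
    obtain G where G: "G \<in> c'" "rk G = Max (rk ` c')" using highest[OF False] by blast
    have "flat G" using chain' G(1) by (simp add: flat_chain_def)
    then have "rk G < rk F" using flat_rk_less[of G F] below[OF G(1)] flat_sub[OF flF(1)] by blast
    moreover have "odd (Max (rk ` c'))" unfolding G(2)[symmetric] by (rule bspec[OF odd G(1)])
    ultimately show ?thesis using G(2) False by (simp add: d_def)
  qed
  have "(\<Sum>u | fy u \<and> set_mset u = c. (- 1) ^ size u) =
      (\<Sum>(m, v) \<in> {1..d} \<times> {v. fy v \<and> set_mset v = c'}. (- 1) ^ m * (- 1) ^ size v :: 'b)"
  proof (rule sum.reindex_bij_witness[where i = "\<lambda>(m, v). v + replicate_mset m F"
        and j = "\<lambda>u. (count u F, filter_mset (\<lambda>G. G \<noteq> F) u)"])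
    fix u assume u: "u \<in> {u. fy u \<and> set_mset u = c}"
    let ?v = "filter_mset (\<lambda>G. G \<noteq> F) u"
    have u_eq: "?v + replicate_mset (count u F) F = u" by (rule multiset_eqI) simp
    have pos: "0 < count u F" using u F(1) by auto
    have set_v: "set_mset ?v = c'" using u by (auto simp: c'_def)
    then have "fy ?v \<and> count u F \<le> d"
      using fy_add_top[OF flF _ pos, of ?v] u d_iff[OF pos] below by (simp add: u_eq)
    then show "(count u F, ?v) \<in> {1..d} \<times> {v. fy v \<and> set_mset v = c'}"
      using pos set_v by simp
    show "(case (count u F, ?v) of (m, v) \<Rightarrow> v + replicate_mset m F) = u" using u_eq by simp
    have "size u = count u F + size ?v" using arg_cong[OF u_eq, of size] by simp
    then show "(case (count u F, ?v) of (m, v) \<Rightarrow> (- 1) ^ m * (- 1) ^ size v) = ((- 1) ^ size u :: 'b)"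
      by (simp add: power_add)
  next
    fix mv assume "mv \<in> {1..d} \<times> {v. fy v \<and> set_mset v = c'}"
    then obtain m v where mv: "mv = (m, v)" "0 < m" "m \<le> d" "fy v" "set_mset v = c'" by auto
    have F_v: "F \<notin># v" using mv(5) c(2) by simp
    have "filter_mset (\<lambda>G. G \<noteq> F) (v + replicate_mset m F) = v"
      by (rule multiset_eqI) (use F_v in \<open>auto simp: not_in_iff\<close>)
    moreover have "count (v + replicate_mset m F) F = m" using F_v by (simp add: not_in_iff)
    ultimately show "(count (case mv of (m, v) \<Rightarrow> v + replicate_mset m F) F,
        filter_mset (\<lambda>G. G \<noteq> F) (case mv of (m, v) \<Rightarrow> v + replicate_mset m F)) = mv"
      by (simp add: mv(1))
    have "fy (v + replicate_mset m F)"
      using fy_add_top[OF flF _ mv(2), of v] d_iff[OF mv(2)] below mv(3-5) by simp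
    moreover have "set_mset (v + replicate_mset m F) = c" using mv(2,5) c(1) by auto
    ultimately show "(case mv of (m, v) \<Rightarrow> v + replicate_mset m F) \<in> {u. fy u \<and> set_mset u = c}"
      by (simp add: mv(1))
  qed
  also have "\<dots> = (\<Sum>m=1..d. (- 1) ^ m) * (\<Sum>v | fy v \<and> set_mset v = c'. (- 1) ^ size v)"
    by (simp add: sum_product sum.cartesian_product)
  also have "\<dots> = (if odd d then - 1 else 0) * (if \<forall>G\<in>c'. odd (rk G) then (- 1) ^ card c' else 0)"
    unfolding sum_alternating_signs Suc.hyps(1)[OF card_c(2) chain'] ..
  also have "\<dots> = (if \<forall>G\<in>c. odd (rk G) then (- 1) ^ card c else 0)"
    using parity by (simp add: c(1) card_c(1)[unfolded c(1)])
  finally show ?case .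
qed

definition fixed_odd_chains :: "('a \<Rightarrow> 'a) \<Rightarrow> 'a set set set" where
  "fixed_odd_chains \<sigma> = {c. flat_chain c \<and> (\<forall>F\<in>c. \<sigma> ` F = F \<and> odd (rk F))}"

lemma finite_fixed_odd_chains: "finite (fixed_odd_chains \<sigma>)"
  by (rule finite_subset[of _ "Pow (flats E rk)"]) (auto simp: fixed_odd_chains_def flat_chain_def finite_flats)

text \<open>Flats of a chain are told apart by their rank, so a multiset is fixed if and only if each of its flats is.
The fixed multisets can therefore be grouped by their support.\<close>

theorem signed_fixed_fy:
  assumes a: "aut \<sigma>"
  shows "(\<Sum>i=0..rk E. (- 1) ^ i * of_nat (card {u \<in> FY i. image_mset (image \<sigma>) u = u})) =
    (\<Sum>c\<in>fixed_odd_chains \<sigma>. (- 1) ^ card c :: 'b::comm_ring_1)"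
proof -
  let ?U = "{u. fy u \<and> image_mset (image \<sigma>) u = u}"
  let ?C = "{c. flat_chain c \<and> (\<forall>F\<in>c. \<sigma> ` F = F)}"
  have U: "{u. fy u} = (\<Union>i\<in>{0..rk E}. FY i)" using size_fy by (auto simp: FY_def)
  have finU: "finite ?U" by (rule finite_subset[of _ "{u. fy u}"]) (blast, simp add: U finite_FY)
  have finC: "finite ?C"
    by (rule finite_subset[of _ "Pow (flats E rk)"]) (auto simp: flat_chain_def finite_flats)
  have fixed: "\<sigma> ` F = F" if u: "fy u" "image_mset (image \<sigma>) u = u" and F: "F \<in># u" for u F
  proof (rule flat_chain_eq[of "set_mset u"])
    show "flat_chain (set_mset u)" using u(1) by (simp add: flat_chain_def fy_def)
    have "\<sigma> ` F \<in># image_mset (image \<sigma>) u" using F by simp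
    then show "\<sigma> ` F \<in># u" by (simp only: u(2))
    show "rk (\<sigma> ` F) = rk F" by (rule aut_rk[OF a flat_sub[OF fyD(1)[OF u(1) F]]])
  qed (rule F)
  have "(\<Sum>i=0..rk E. (- 1) ^ i * of_nat (card {u \<in> FY i. image_mset (image \<sigma>) u = u})) =
      (\<Sum>i=0..rk E. \<Sum>u | u \<in> ?U \<and> size u = i. (- 1) ^ size u :: 'b)"
  proof (rule sum.cong[OF refl])
    fix i
    have eq: "{u. u \<in> ?U \<and> size u = i} = {u \<in> FY i. image_mset (image \<sigma>) u = u}" by (auto simp: FY_def)
    have "(\<Sum>u | u \<in> ?U \<and> size u = i. (- 1) ^ size u :: 'b) = (\<Sum>u | u \<in> ?U \<and> size u = i. (- 1) ^ i)"
      by (rule sum.cong[OF refl]) simp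
    then show "(- 1) ^ i * of_nat (card {u \<in> FY i. image_mset (image \<sigma>) u = u}) =
        (\<Sum>u | u \<in> ?U \<and> size u = i. (- 1) ^ size u :: 'b)"
      unfolding eq by (simp add: mult.commute)
  qed
  also have "\<dots> = (\<Sum>u\<in>?U. (- 1) ^ size u)" by (rule sum.group[OF finU]) (use size_fy in auto)
  also have "\<dots> = (\<Sum>c\<in>?C. \<Sum>u | u \<in> ?U \<and> set_mset u = c. (- 1) ^ size u)"
    by (rule sum.group[symmetric, OF finU finC]) (use fixed in \<open>auto simp: flat_chain_def fy_def\<close>)
  also have "\<dots> = (\<Sum>c\<in>?C. if \<forall>F\<in>c. odd (rk F) then (- 1) ^ card c else 0)"
  proof (rule sum.cong[OF refl])
    fix c assume c: "c \<in> ?C"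
    have "image_mset (image \<sigma>) u = u" if "set_mset u = c" for u
      using image_mset_cong[of u "image \<sigma>" id] c that by simp
    then have "{u. u \<in> ?U \<and> set_mset u = c} = {u. fy u \<and> set_mset u = c}" by auto
    then show "(\<Sum>u | u \<in> ?U \<and> set_mset u = c. (- 1) ^ size u) = (if \<forall>F\<in>c. odd (rk F) then (- 1) ^ card c else (0::'b))"
      using signed_fy_with_support[of c] c by simp
  qed
  also have "\<dots> = (\<Sum>c\<in>fixed_odd_chains \<sigma>. (- 1) ^ card c)"
  proof -
    have eq: "fixed_odd_chains \<sigma> = {c \<in> ?C. \<forall>F\<in>c. odd (rk F)}" by (auto simp: fixed_odd_chains_def)
    show ?thesis unfolding eq by (rule sum.inter_filter[OF finC, symmetric])
  qed
  finally show ?thesis .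
qed

text \<open>In odd rank \<open>E\<close> itself is a fixed flat of odd rank comparable to all others; adding or removing it pairs up
chains of opposite sign.\<close>

lemma sum_fixed_odd_chains_odd_rank:
  assumes a: "aut \<sigma>" and r: "odd (rk E)"
  shows "(\<Sum>c\<in>fixed_odd_chains \<sigma>. (- 1) ^ card c) = (0 :: 'b::comm_ring_1)"
proof -
  let ?A = "{c \<in> fixed_odd_chains \<sigma>. E \<notin> c}"
  have E: "E \<noteq> {}" using r rk_empty by auto
  have sub: "F \<subseteq> E" if "c \<in> fixed_odd_chains \<sigma>" "F \<in> c" for c F
    using that flat_sub[of F] by (simp add: fixed_odd_chains_def flat_chain_def)
  have ins: "insert E c \<in> fixed_odd_chains \<sigma>" if c: "c \<in> fixed_odd_chains \<sigma>" for c
    using c E r flat_E aut_E[OF a] sub[OF c] by (auto simp: fixed_odd_chains_def flat_chain_def)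
  have del: "c - {E} \<in> ?A" if "c \<in> fixed_odd_chains \<sigma>" for c
    using that by (auto simp: fixed_odd_chains_def flat_chain_def)
  have split: "fixed_odd_chains \<sigma> = ?A \<union> insert E ` ?A"
  proof (intro equalityI subsetI)
    fix c assume c: "c \<in> fixed_odd_chains \<sigma>"
    show "c \<in> ?A \<union> insert E ` ?A"
    proof (cases "E \<in> c")
      case True
      then have "c = insert E (c - {E})" by blast
      then show ?thesis using del[OF c] by blast
    qed (use c in simp)
  qed (use ins in auto)
  have inj: "inj_on (insert E) ?A" by (rule inj_onI) (auto simp: insert_ident)
  have fin: "finite c" if "c \<in> ?A" for c using that finite_flat_chain[of c] by (simp add: fixed_odd_chains_def)
  have "(\<Sum>c\<in>fixed_odd_chains \<sigma>. (- 1) ^ card c) = (\<Sum>c\<in>?A. (- 1) ^ card c) + (\<Sum>c\<in>insert E ` ?A. (- 1) ^ card c :: 'b)"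
    by (subst split, rule sum.union_disjoint) (use finite_fixed_odd_chains in auto)
  also have "(\<Sum>c\<in>insert E ` ?A. (- 1) ^ card c) = (\<Sum>c\<in>?A. - ((- 1) ^ card c) :: 'b)"
    unfolding sum.reindex[OF inj] by (rule sum.cong[OF refl]) (use fin in simp)
  finally show ?thesis by (simp add: sum_negf)
qed

end

section \<open>The homology of the rank selection as a representation\<close>

context nat_matroid
begin

lemma zero_notin_S: "0 \<notin> S" and rank_notin_S: "rk E \<notin> S" using S by auto

lemma rank_selected_eq: "rank_selected (flats E rk) rk {} E S - {{}, E} = P"
  using zero_notin_S rank_notin_S rk_empty by (auto simp: rank_selected_def)

lemma top_homology: "reduced_homology \<Delta> (int (card S) - 1) = quot_vs (sub_vs (cycles \<Delta> (card S))) {0}"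
proof (rule reduced_homology_top)
  have finS: "finite S" using S finite_subset by blast
  have "card c \<le> card S" if "c \<in> \<Delta>" for c
  proof -
    have "card c = card (rk ` c)" by (rule card_image[OF inj_on_rk[OF that], symmetric])
    also have "\<dots> \<le> card S" by (rule card_mono[OF finS]) (use \<Delta>D(4)[OF that] in blast)
    finally show ?thesis .
  qed
  then show "faces \<Delta> (Suc (card S)) = {}" by (fastforce simp: faces_def)
qed

lemma complex_automorphism_aut: assumes a: "aut \<sigma>" shows "complex_automorphism \<Delta> (image \<sigma>)"
proof
  show "finite \<Delta>" by (rule finite_\<Delta>)
  show "pchain c" if "c \<in> \<Delta>" for c by (rule pchain_\<Delta>[OF that])
  show "c' \<in> \<Delta>" if "c \<in> \<Delta>" "c' \<subseteq> c" for c c' by (rule \<Delta>_down[OF that])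
  show "inj (image \<sigma> :: nat set \<Rightarrow> nat set)" by (rule aut_image_inj[OF a])
  show "\<sigma> ` x \<subset> \<sigma> ` y \<longleftrightarrow> x \<subset> y" for x y by (rule aut_image_psubset_iff[OF a])
  fix c assume c: "c \<in> \<Delta>"
  have "flat (\<sigma> ` x)" "rk (\<sigma> ` x) \<in> S" if "x \<in> c" for x
    using aut_flat[OF a \<Delta>D(3)[OF c that]] aut_rk[OF a flat_sub[OF \<Delta>D(3)[OF c that]]] \<Delta>D(4)[OF c that] by simp_all
  moreover have "x \<subseteq> y \<or> y \<subseteq> x" if "x \<in> c" "y \<in> c" for x y using c that unfolding \<Delta>_iff by simp
  ultimately show "image \<sigma> ` c \<in> \<Delta>" unfolding \<Delta>_iff by (auto simp: aut_image_subset_iff[OF a])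
qed

lemma homology_coordinates:
  obtains B where "quotient_coordinates (sub_vs (cycles \<Delta> (card S))) {0} B (\<lambda>b. b) (pm.representation B)"
proof -
  interpret complex_automorphism \<Delta> "image id"
    by (rule complex_automorphism_aut) (simp add: aut_def permutes_id)
  let ?Z = "cycles \<Delta> (card S)"
  obtain B where B: "B \<subseteq> ?Z" "pm.independent B" "?Z \<subseteq> pm.span B"
    using pm.maximal_independent_subset[of ?Z] by blast
  have "B \<subseteq> pm.span ((\<lambda>c. Poly_Mapping.single c 1) ` faces \<Delta> (card S))"
    using B(1) chains_span[of \<Delta> "card S"] by (auto simp: cycles_def)
  then have fin: "finite B"
    using pm.independent_span_bound[OF finite_imageI[OF finite_faces] B(2)] by blast
  have "pm.span B = ?Z"
    by (rule subset_antisym[OF pm.span_minimal[OF B(1) subspace_cycles] B(3)])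
  then show ?thesis using that coordinates_of_basis[OF fin B(2)] by simp
qed

text \<open>Homology is concentrated in top degree, where its character is, up to sign, the alternating number of
fixed faces.\<close>

lemma homology_character:
  assumes a: "aut \<sigma>"
  shows "lin_trace (reduced_homology \<Delta> (int (card S) - 1)) (flats_homology_act \<sigma>) =
    (- 1) ^ card S * (\<Sum>c | c \<in> \<Delta> \<and> image \<sigma> ` c = c. (- 1) ^ card c)"
proof -
  interpret complex_automorphism \<Delta> "image \<sigma>" by (rule complex_automorphism_aut[OF a])
  let ?D = "{c \<in> \<Delta>. image \<sigma> ` c = c}"
  have card_le: "card c \<le> card S" if c: "c \<in> \<Delta>" for c
  proof -
    obtain f where "facet f" "c \<subseteq> f" using facet_above[OF c] by blast
    then show ?thesis using card_mono[OF \<Delta>D(1)[OF facet_\<Delta>]] card_facet by metis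
  qed
  have "lin_trace (reduced_homology \<Delta> (int (card S) - 1)) (flats_homology_act \<sigma>) = sub_trace (cycles \<Delta> (card S)) push"
    by (simp add: top_homology sub_trace_def flats_homology_act_def homology_map_def)
  also have "\<dots> = (\<Sum>k\<le>card S. (- 1) ^ (card S - k) * of_nat (card {c \<in> faces \<Delta> k. image \<sigma> ` c = c}))"
  proof (rule hopf_trace[OF rank_selection_acyclic])
    fix z assume "z \<in> chain_space \<Delta> 0"
    then have keys_empty: "c = {}" if "c \<in> Poly_Mapping.keys z" for c
      using that \<Delta>D(1)[of c] by (auto simp: chain_space_def faces_def)
    have empty: "(\<Sum>x\<in>c. g x) = 0" if "c \<in> Poly_Mapping.keys z" for c and g :: "nat set \<Rightarrow> nat set set \<Rightarrow>\<^sub>0 complex"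
      unfolding keys_empty[OF that] by simp
    show "simplicial_boundary z = 0" unfolding simplicial_boundary_def by (rule sum.neutral) (simp add: empty)
  qed
  also have "\<dots> = (\<Sum>k\<le>card S. \<Sum>c | c \<in> ?D \<and> card c = k. (- 1) ^ card S * (- 1) ^ card c)"
  proof (rule sum.cong[OF refl])
    fix k assume k: "k \<in> {..card S}"
    have eq: "{c \<in> faces \<Delta> k. image \<sigma> ` c = c} = {c. c \<in> ?D \<and> card c = k}" by (auto simp: faces_def)
    have "(- 1) ^ card S * (- 1) ^ k = ((- 1) ^ (card S - k) :: complex)"
      using k by (simp add: minus_one_power_iff)
    then have "(\<Sum>c | c \<in> ?D \<and> card c = k. (- 1) ^ card S * (- 1) ^ card c) = (\<Sum>c | c \<in> ?D \<and> card c = k. (- 1) ^ (card S - k) :: complex)"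
      by (intro sum.cong) auto
    also have "\<dots> = (- 1) ^ (card S - k) * of_nat (card {c \<in> ?D. card c = k})" by simp
    finally show "(- 1) ^ (card S - k) * of_nat (card {c \<in> faces \<Delta> k. image \<sigma> ` c = c}) =
      (\<Sum>c | c \<in> ?D \<and> card c = k. (- 1) ^ card S * (- 1) ^ card c :: complex)"
      unfolding eq by (rule sym)
  qed
  also have "\<dots> = (\<Sum>c\<in>?D. (- 1) ^ card S * (- 1) ^ card c)"
    by (rule sum.group) (use finite_\<Delta> card_le in auto)
  finally show ?thesis by (simp add: sum_distrib_left)
qed

lemma homology_genuine:
  fixes \<Gamma> :: "(nat \<Rightarrow> nat) monoid"
  assumes aut: "\<And>g. g \<in> carrier \<Gamma> \<Longrightarrow> aut g" and one: "\<one>\<^bsub>\<Gamma>\<^esub> \<in> carrier \<Gamma>" "\<one>\<^bsub>\<Gamma>\<^esub> = id"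
    and mult: "\<And>g h. g \<otimes>\<^bsub>\<Gamma>\<^esub> h = g \<circ> h"
  shows "rep_class \<Gamma> (reduced_homology \<Delta> (int (card S) - 1)) flats_homology_act \<in> genuine_classes \<Gamma>"
proof -
  obtain B where B: "quotient_coordinates (sub_vs (cycles \<Delta> (card S))) {0} B (\<lambda>b. b) (pm.representation B)"
    by (rule homology_coordinates)
  have rep_in: "rep_class \<Gamma> (quot_vs (sub_vs (cycles \<Delta> (card S))) {0}) (\<lambda>g. (`) (pm_push ((`) ((`) g)))) \<in> genuine_classes \<Gamma>"
  proof (rule rep_class_quotient_genuine[OF B])
    fix g z assume "g \<in> carrier \<Gamma>" "z \<in> carrier (sub_vs (cycles \<Delta> (card S)))"
    then show "pm_push ((`) ((`) g)) z \<in> carrier (sub_vs (cycles \<Delta> (card S)))"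
      using complex_automorphism.push_cycles[OF complex_automorphism_aut[OF aut]] by simp
  next
    show "pm_push ((`) ((`) \<one>\<^bsub>\<Gamma>\<^esub>)) z = z" for z :: "nat set set \<Rightarrow>\<^sub>0 complex" by (rule pm_push_ident) (simp add: one)
    show "pm_push ((`) ((`) (g \<otimes>\<^bsub>\<Gamma>\<^esub> h))) z = pm_push ((`) ((`) g)) (pm_push ((`) ((`) h)) z)"
      for g h and z :: "nat set set \<Rightarrow>\<^sub>0 complex"
      by (simp add: pm_push_push mult image_image comp_def)
    show "\<one>\<^bsub>\<Gamma>\<^esub> \<in> carrier \<Gamma>" by (rule one(1))
  qed (simp_all add: pm_push_add pm_push_scale)
  have act: "flats_homology_act = (\<lambda>g. (`) (pm_push ((`) ((`) g))))"
    by (simp only: fun_eq_iff flats_homology_act_def homology_map_def simp_thms)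
  show ?thesis unfolding top_homology act by (rule rep_in)
qed

end

section \<open>The Charney--Davis quantity\<close>

lemma sum_fun_apply: "(sum f A :: 'a \<Rightarrow> 'b::comm_monoid_add) x = (\<Sum>a\<in>A. f a x)"
  by (induction A rule: infinite_finite_induct) simp_all

lemma sign_fun: "((- 1) ^ k :: 'a \<Rightarrow> complex) = (\<lambda>_. (- 1) ^ k)"
  by (induction k) (simp_all add: fun_eq_iff)

lemma sign_twice: "(- 1) ^ k * ((- 1) ^ k * x) = (x :: 'a::comm_ring_1)"
  by (simp add: mult.assoc[symmetric] power_add[symmetric])

lemma card_Odd: assumes "even r" "0 < r" shows "card (Odd (r - 1)) = r div 2"
proof -
  have "Odd (r - 1) = (\<lambda>k. 2 * k + 1) ` {..<r div 2}"
  proof (intro equalityI subsetI)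
    fix s assume s: "s \<in> Odd (r - 1)"
    then have "s = 2 * (s div 2) + 1" by (simp add: Odd_def)
    moreover have "s div 2 < r div 2" using s assms by (auto simp: Odd_def elim!: oddE evenE)
    ultimately show "s \<in> (\<lambda>k. 2 * k + 1) ` {..<r div 2}" by blast
  next
    fix s assume "s \<in> (\<lambda>k. 2 * k + 1) ` {..<r div 2}"
    then obtain k where k: "s = 2 * k + 1" "k < r div 2" by blast
    have "s \<le> r - 1" using k by linarith
    then show "s \<in> Odd (r - 1)" using k(1) by (simp add: Odd_def)
  qed
  moreover have "inj_on (\<lambda>k. 2 * k + 1 :: nat) {..<r div 2}" by (rule inj_onI) simp
  ultimately show ?thesis by (simp add: card_image)
qed

text \<open>In even rank the flat \<open>E\<close> is excluded by its rank, so the chains counted by the graded character are the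
fixed faces of the rank-selected complex.\<close>

lemma (in nat_matroid) fixed_odd_chains_eq:
  assumes a: "aut \<sigma>" and r: "even (rk E)" and S_odd: "S = Odd (rk E - 1)"
  shows "fixed_odd_chains \<sigma> = {c \<in> \<Delta>. image \<sigma> ` c = c}"
proof (intro equalityI subsetI)
  fix c assume "c \<in> fixed_odd_chains \<sigma>"
  then have c: "flat_chain c" "\<And>F. F \<in> c \<Longrightarrow> \<sigma> ` F = F" "\<And>F. F \<in> c \<Longrightarrow> odd (rk F)"
    by (simp_all add: fixed_odd_chains_def)
  have "rk F \<in> S" if F: "F \<in> c" for F
  proof -
    have "flat F" using c(1) F by (simp add: flat_chain_def)
    then have "rk F \<le> rk E" using rk_mono[OF flat_sub order_refl] by blast
    moreover have "rk F \<noteq> rk E" using c(3)[OF F] r by auto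
    ultimately show ?thesis using c(3)[OF F] by (simp add: S_odd Odd_def)
  qed
  moreover have "image \<sigma> ` c = c" using c(2) by simp
  ultimately show "c \<in> {c \<in> \<Delta>. image \<sigma> ` c = c}" using c(1) by (auto simp: \<Delta>_iff flat_chain_def)
next
  fix c assume c: "c \<in> {c \<in> \<Delta>. image \<sigma> ` c = c}"
  then have c\<Delta>: "c \<in> \<Delta>" by simp
  have "F \<noteq> {}" "odd (rk F)" "flat F" "\<sigma> ` F = F" if F: "F \<in> c" for F
  proof -
    show "F \<noteq> {}" using \<Delta>D(4)[OF c\<Delta> F] zero_notin_S rk_empty by auto
    show "odd (rk F)" using \<Delta>D(4)[OF c\<Delta> F] by (simp add: S_odd Odd_def)
    show fl: "flat F" by (rule \<Delta>D(3)[OF c\<Delta> F])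
    have "\<sigma> ` F \<in> image \<sigma> ` c" using F by (rule imageI)
    then have "\<sigma> ` F \<in> c" using c by simp
    then show "\<sigma> ` F = F"
      using bounded_eq[OF c\<Delta>, of "\<sigma> ` F" F] F aut_rk[OF a flat_sub[OF fl]] by simp
  qed
  then show "c \<in> fixed_odd_chains \<sigma>" using c\<Delta> by (simp add: fixed_odd_chains_def flat_chain_def \<Delta>_iff)
qed

text \<open>Both sides are class functions and are compared at each group element. The sign \<open>(-1) ^ (r div 2)\<close> in front
of the homology cancels against the one in the Charney--Davis quantity.\<close>

theorem theorem1p11:
  fixes n r :: nat and rk :: "nat set \<Rightarrow> nat" and G :: "(nat \<Rightarrow> nat) set"
    and \<Gamma> :: "(nat \<Rightarrow> nat) monoid"
  assumes "n \<ge> 1"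
    and "matroid {1..n} rk"
    and "loopless {1..n} rk"
    and "r = rk {1..n}"
    and "subgroup G (matroid_aut n rk)"
    and "\<Gamma> = (matroid_aut n rk)\<lparr>carrier := G\<rparr>"
  shows "(\<Sum>i=0..r. (-1) ^ i * rep_class \<Gamma> (aug_chow_part_C {1..n} rk i) aug_chow_act_C) =
      (if even r
       then (-1) ^ (r div 2) *
         rep_class \<Gamma> (flats_rank_selected_homology {1..n} rk (Odd (r - 1)) ((int r - 2) div 2))
           flats_homology_act
       else 0)
    \<and> charney_davis \<Gamma> r (aug_chow_part_C {1..n} rk) aug_chow_act_C \<in> genuine_classes \<Gamma>"
proof -
  interpret finite_matroid "{1..n}" rk using assms(2,3) by (rule finite_matroid.intro)
  define X where "X = (\<Sum>i=0..r. (-1) ^ i * rep_class \<Gamma> (aug_chow_part_C {1..n} rk i) aug_chow_act_C)"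
  have aut: "aut g" if "g \<in> G" for g
    unfolding aut_def using subgroup.subset[OF assms(5)] that by (auto simp: matroid_aut_def sym_group_def)
  have \<Gamma>: "carrier \<Gamma> = G" "\<one>\<^bsub>\<Gamma>\<^esub> = id" "\<And>g h. g \<otimes>\<^bsub>\<Gamma>\<^esub> h = g \<circ> h" "id \<in> G"
    using subgroup.one_closed[OF assms(5)] by (simp_all add: assms(6) matroid_aut_def sym_group_def)
  have X_apply: "X g = (if g \<in> G then (\<Sum>c\<in>fixed_odd_chains g. (- 1) ^ card c) else 0)" for g
  proof (cases "g \<in> G")
    case True
    have "X g = (\<Sum>i=0..r. (- 1) ^ i * rep_class \<Gamma> (aug_chow_part_C {1..n} rk i) aug_chow_act_C g)"
      by (simp add: X_def sum_fun_apply sign_fun)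
    also have "\<dots> = (\<Sum>i=0..rk {1..n}. (- 1) ^ i * of_nat (card {u \<in> FY i. image_mset (image g) u = u}))"
      unfolding rep_class_def \<Gamma>(1) trace_aug_chow_part[OF aut[OF True]] assms(4) by (simp only: True if_True)
    finally show ?thesis unfolding signed_fixed_fy[OF aut[OF True]] by (simp only: True if_True)
  qed (simp add: X_def sum_fun_apply rep_class_def \<Gamma>)
  have cd: "charney_davis \<Gamma> r (aug_chow_part_C {1..n} rk) aug_chow_act_C =
      (if even r then (- 1) ^ (r div 2) * X else X)"
    by (simp add: charney_davis_def equivariant_hilb_def poly_sum poly_monom X_def mult.commute)
  show ?thesis
  proof (cases "even r")
    case False
    then have odd_rank: "odd (rk {1..n})" unfolding assms(4) .
    have "X g = 0" for g
      by (cases "g \<in> G") (simp_all only: X_apply if_True if_False sum_fixed_odd_chains_odd_rank[OF aut odd_rank])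
    then have "X = 0" by (simp add: fun_eq_iff)
    moreover have "(0 :: (nat \<Rightarrow> nat) \<Rightarrow> complex) \<in> genuine_classes \<Gamma>"
      unfolding genuine_classes_def
      by (intro CollectI exI[of _ 0] exI[of _ "\<lambda>_. 1\<^sub>m 0"]) (simp add: fun_eq_iff)
    ultimately show ?thesis using False cd unfolding X_def[symmetric] by simp
  next
    case True
    have "0 < r" using rk_pos[of "{1..n}"] assms(1,4) by simp
    have nm: "nat_matroid {1..n} rk n (Odd (r - 1))"
    proof (intro nat_matroid.intro nat_matroid_axioms.intro)
      show "finite_matroid {1..n} rk" by (rule finite_matroid_axioms)
      show "Odd (r - 1) \<subseteq> {1..<rk {1..n}}"
        using \<open>0 < r\<close> assms(4) by (auto simp: Odd_def elim: oddE)
    qed auto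
    interpret N: nat_matroid "{1..n}" rk n "Odd (r - 1)" by (rule nm)
    have dim: "(int r - 2) div 2 = int (card (Odd (r - 1))) - 1"
      unfolding card_Odd[OF True \<open>0 < r\<close>] using True by (auto elim!: evenE)
    let ?H = "flats_rank_selected_homology {1..n} rk (Odd (r - 1)) ((int r - 2) div 2)"
    have H: "?H = reduced_homology N.\<Delta> (int (card (Odd (r - 1))) - 1)"
      unfolding flats_rank_selected_homology_def N.rank_selected_eq dim ..
    have "X g = (- 1) ^ (r div 2) * rep_class \<Gamma> ?H flats_homology_act g" for g
    proof (cases "g \<in> G")
      case g: True
      have fixed: "fixed_odd_chains g = {c \<in> N.\<Delta>. image g ` c = c}"
        by (rule N.fixed_odd_chains_eq[OF aut[OF g]]) (use True assms(4) in simp_all)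
      show ?thesis
        unfolding X_apply rep_class_def \<Gamma>(1) H N.homology_character[OF aut[OF g]]
        unfolding card_Odd[OF True \<open>0 < r\<close>] fixed
        by (simp only: g if_True sign_twice)
    qed (simp add: X_apply rep_class_def \<Gamma>)
    then have X: "X = (- 1) ^ (r div 2) * rep_class \<Gamma> ?H flats_homology_act"
      by (simp add: fun_eq_iff sign_fun)
    have "rep_class \<Gamma> ?H flats_homology_act \<in> genuine_classes \<Gamma>"
      unfolding H
    proof (rule N.homology_genuine)
      show "aut g" if "g \<in> carrier \<Gamma>" for g using that unfolding \<Gamma>(1) by (rule aut)
    qed (simp_all add: \<Gamma>)
    then show ?thesis using X True cd sign_twice unfolding X_def[symmetric] by simp
  qed
qed

end
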